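(* Let $(M,\tau)$ be a tracial von Neumann algebra and let $\psi$ be a normal hyperstate on $\mathcal B(L^2(M,\tau))$. Set $\varphi=\frac12\psi+\frac12\langle\,\cdot\,\hat1,\hat1\rangle$ and let $A_n\in\mathrm{TC}(L^2(M,\tau))$ denote the density matrix corresponding to the normal u.c.p. $M$-bimodular map $\mathcal P_\varphi^n$. Then the following conditions are equivalent: 1. For all $x\in M$ we have $\|xA_n-A_nx\|_{\rm TC}\to0$. 2. For all $x\in M$ we have $xA_n-A_nx\to0$ weakly. 3. $\mathrm{Har}(\mathcal P_\varphi)=M$.
   Context: A tracial von Neumann algebra $(M,\tau)$ is a finite von Neumann algebra with a faithful normal tracial state; $M$ acts on $L^2(M,\tau)$ by left multiplication and $\hat x$ denotes $x\in M$ as a vector. A hyperstate on $\mathcal B(L^2(M,\tau))$ is a state $\varphi$ with $\varphi|_M=\tau$. Its associated map $\mathcal P_\varphi$ is the unique unital completely positive (u.c.p.) $M$-bimodular map on $\mathcal B(L^2(M,\tau))$ with $\langle\mathcal P_\varphi(T)\hat y,\hat z\rangle=\varphi(z^*Ty)$ for $y,z\in M$; it is normal when $\varphi$ is. $\mathrm{Har}(\mathcal P_\varphi)=\{T\in\mathcal B(L^2(M,\tau)):\mathcal P_\varphi(T)=T\}$. $\mathrm{TC}(L^2(M,\tau))$ is the space of trace-class operators with trace-class norm $\|\cdot\|_{\rm TC}$; its dual is identified with $\mathcal B(L^2(M,\tau))$ through $(A,T)\mapsto\mathrm{Tr}(AT)$, and "weakly" in condition 2 refers to the weak topology on $\mathrm{TC}(L^2(M,\tau))$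 given by this pairing. The density matrix $A_n$ is the unique positive trace-class operator with $\langle\mathcal P_\varphi^n(T)\hat1,\hat1\rangle=\mathrm{Tr}(A_nT)$ for all $T\in\mathcal B(L^2(M,\tau))$. *)

theory Defs
  imports "HOL-Analysis.Analysis"
begin

section \<open>Complex Hilbert spaces\<close>

class scaleC = scaleR +
  fixes scaleC :: "complex \<Rightarrow> 'a \<Rightarrow> 'a"  (infixr "*\<^sub>C" 75)

class complex_vector = real_vector + scaleC +
  assumes scaleC_add_right: "a *\<^sub>C (x + y) = a *\<^sub>C x + a *\<^sub>C y"
    and scaleC_add_left: "(a + b) *\<^sub>C x = a *\<^sub>C x + b *\<^sub>C x"
    and scaleC_scaleC: "a *\<^sub>C b *\<^sub>C x = (a * b) *\<^sub>C x"
    and scaleC_of_real: "complex_of_real r *\<^sub>C x = r *\<^sub>R x"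

text \<open>
  The inner product is linear in the first argument.  Positive definiteness of \<open>cinner\<close>, and
  the fact that it induces the norm, come from \<open>real_inner\<close> through \<open>inner_eq_Re_cinner\<close>:
  by \<open>cinner_commute\<close> the number \<open>cinner x x\<close> is real, hence equal to \<open>inner x x\<close>.
\<close>

class complex_inner = complex_vector + real_inner +
  fixes cinner :: "'a \<Rightarrow> 'a \<Rightarrow> complex"
  assumes cinner_commute: "cinner x y = cnj (cinner y x)"
    and cinner_add_left: "cinner (x + y) z = cinner x z + cinner y z"
    and cinner_scaleC_left: "cinner (c *\<^sub>C x) y = c * cinner x y"
    and inner_eq_Re_cinner: "inner x y = Re (cinner x y)"

class chilbert_space = complex_inner + banach

instantiation complex :: chilbert_space
begin
definition scaleC_complex :: "complex \<Rightarrow> complex \<Rightarrow> complex" where "scaleC_complex a x = a * x"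
definition cinner_complex :: "complex \<Rightarrow> complex \<Rightarrow> complex" where "cinner_complex x y = x * cnj y"
instance
  by standard
    (simp_all add: scaleC_complex_def cinner_complex_def algebra_simps inner_complex_def
      scaleR_conv_of_real)
end

lemma scaleC_zero_right [simp]: "a *\<^sub>C (0::'a::complex_vector) = 0"
  using scaleC_add_right[of a "0::'a" 0] by simp

lemma scaleC_minus_right: "a *\<^sub>C (- x) = - (a *\<^sub>C (x::'a::complex_vector))"
proof -
  have "a *\<^sub>C (- x) + a *\<^sub>C x = 0"
    by (simp flip: scaleC_add_right)
  then show ?thesis
    by (simp add: eq_neg_iff_add_eq_0)
qed

lemma scaleC_diff_right: "a *\<^sub>C (x - y) = a *\<^sub>C x - a *\<^sub>C (y::'a::complex_vector)"
  using scaleC_add_right[of a x "- y"] by (simp add: scaleC_minus_right)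

lemma norm_scaleC: "norm (a *\<^sub>C x) = cmod a * norm (x::'a::complex_inner)"
proof -
  have *: "cinner (a *\<^sub>C x) (a *\<^sub>C x) = (a * cnj a) * cinner x x"
  proof -
    have "cinner (a *\<^sub>C x) (a *\<^sub>C x) = a * cnj (cinner (a *\<^sub>C x) x)"
      by (metis cinner_commute cinner_scaleC_left)
    also have "\<dots> = a * cnj a * cnj (cinner x x)"
      by (simp add: cinner_scaleC_left)
    also have "cnj (cinner x x) = cinner x x"
      by (metis cinner_commute)
    finally show ?thesis .
  qed
  have "inner (a *\<^sub>C x) (a *\<^sub>C x) = (cmod a)\<^sup>2 * inner x x"
    by (simp only: inner_eq_Re_cinner * complex_norm_square[symmetric] Re_complex_of_real)
      simp
  then show ?thesis
    by (simp add: norm_eq_sqrt_inner real_sqrt_mult)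
qed

lemma bounded_linear_scaleC: "bounded_linear (\<lambda>x::'a::complex_inner. a *\<^sub>C x)"
proof (rule bounded_linear_intro)
  fix x y :: 'a and r :: real
  show "a *\<^sub>C (x + y) = a *\<^sub>C x + a *\<^sub>C y"
    by (rule scaleC_add_right)
  show "a *\<^sub>C (r *\<^sub>R x) = r *\<^sub>R (a *\<^sub>C x)"
    by (simp add: scaleC_scaleC mult.commute flip: scaleC_of_real)
  show "norm (a *\<^sub>C x) \<le> norm x * cmod a"
    by (simp add: norm_scaleC)
qed

section \<open>Bounded operators\<close>

text \<open>\<open>'a bop\<close> is \<open>B(H)\<close>, with composition as multiplication.\<close>

typedef (overloaded) ('a::complex_inner) bop =
  "{T :: 'a \<Rightarrow> 'a. bounded_linear T \<and> (\<forall>c x. T (c *\<^sub>C x) = c *\<^sub>C T x)}"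
  morphisms bop_apply Bop
  by (rule exI[of _ "\<lambda>x. x"]) simp

setup_lifting type_definition_bop

notation bop_apply  (infixr "*\<^sub>V" 70)

instantiation bop :: (complex_inner) "{complex_vector, ring, monoid_mult}"
begin

lift_definition zero_bop :: "'a bop" is "\<lambda>x. 0" by simp
lift_definition one_bop :: "'a bop" is "\<lambda>x. x" by simp
lift_definition plus_bop :: "'a bop \<Rightarrow> 'a bop \<Rightarrow> 'a bop" is "\<lambda>S T x. S x + T x"
  by (simp add: bounded_linear_add scaleC_add_right)
lift_definition minus_bop :: "'a bop \<Rightarrow> 'a bop \<Rightarrow> 'a bop" is "\<lambda>S T x. S x - T x"
  by (simp add: bounded_linear_sub scaleC_diff_right)
lift_definition uminus_bop :: "'a bop \<Rightarrow> 'a bop" is "\<lambda>T x. - T x"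
  by (simp add: bounded_linear_minus scaleC_minus_right)
lift_definition times_bop :: "'a bop \<Rightarrow> 'a bop \<Rightarrow> 'a bop" is "\<lambda>S T x. S (T x)"
  by (simp add: bounded_linear_compose)
lift_definition scaleC_bop :: "complex \<Rightarrow> 'a bop \<Rightarrow> 'a bop" is "\<lambda>c T x. c *\<^sub>C T x"
  by (simp add: bounded_linear_compose[OF bounded_linear_scaleC] scaleC_scaleC mult.commute)
definition scaleR_bop :: "real \<Rightarrow> 'a bop \<Rightarrow> 'a bop" where
  "scaleR_bop r T = complex_of_real r *\<^sub>C T"

instance
proof
  fix a b c :: "'a bop" and r s :: real and z w :: complex
  show "a + b + c = a + (b + c)" "a + b = b + a" "0 + a = a" "- a + a = 0" "a - b = a + - b"
    subgoal by transfer (simp add: add.assoc)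
    subgoal by transfer (simp add: add.commute)
    subgoal by transfer simp
    subgoal by transfer simp
    subgoal by transfer simp
    done
  show "a * b * c = a * (b * c)" "1 * a = a" "a * 1 = a"
    by (transfer; simp)+
  show "(a + b) * c = a * c + b * c"
    by transfer simp
  show "a * (b + c) = a * b + a * c"
    by transfer (simp add: fun_eq_iff linear_add bounded_linear.linear)
  show "z *\<^sub>C (a + b) = z *\<^sub>C a + z *\<^sub>C b" "(z + w) *\<^sub>C a = z *\<^sub>C a + w *\<^sub>C a"
    "z *\<^sub>C w *\<^sub>C a = (z * w) *\<^sub>C a"
    by (transfer; simp add: scaleC_add_right scaleC_add_left scaleC_scaleC)+
  show "complex_of_real r *\<^sub>C a = r *\<^sub>R a"
    by (simp add: scaleR_bop_def)
  show "r *\<^sub>R (a + b) = r *\<^sub>R a + r *\<^sub>R b" "(r + s) *\<^sub>R a = r *\<^sub>R a + s *\<^sub>R a"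
    "r *\<^sub>R s *\<^sub>R a = (r * s) *\<^sub>R a" "1 *\<^sub>R a = a"
    unfolding scaleR_bop_def
    subgoal by transfer (simp only: scaleC_add_right)
    subgoal by transfer (simp only: of_real_add scaleC_add_left)
    subgoal by transfer (simp only: scaleC_scaleC of_real_mult)
    subgoal by transfer (simp only: scaleC_of_real scaleR_one)
    done
qed

end

definition adj :: "'a::complex_inner bop \<Rightarrow> 'a bop" where
  "adj T = (THE S. \<forall>x y. cinner (T *\<^sub>V x) y = cinner x (S *\<^sub>V y))"

definition positive_op :: "'a::complex_inner bop \<Rightarrow> bool" where
  "positive_op T \<longleftrightarrow> (\<forall>x. cinner (T *\<^sub>V x) x \<in> \<real>\<^sub>\<ge>\<^sub>0)"

section \<open>Trace class operators\<close>

definition is_onb :: "'a::complex_inner set \<Rightarrow> bool" where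
  "is_onb E \<longleftrightarrow> (\<forall>e\<in>E. \<forall>f\<in>E. cinner e f = (if e = f then 1 else 0)) \<and>
     (\<forall>x. (\<forall>e\<in>E. cinner x e = 0) \<longrightarrow> x = 0)"

definition some_onb :: "'a::complex_inner set" where
  "some_onb = (SOME E. is_onb E)"

text \<open>The absolute value \<open>(A\<^sup>* A)\<^bsup>1/2\<^esup>\<close>.\<close>

definition abs_op :: "'a::complex_inner bop \<Rightarrow> 'a bop" where
  "abs_op A = (THE B. positive_op B \<and> B * B = adj A * A)"

definition trace_class :: "'a::complex_inner bop \<Rightarrow> bool" where
  "trace_class A \<longleftrightarrow> (\<lambda>e. cinner (abs_op A *\<^sub>V e) e) summable_on some_onb"

definition trace :: "'a::complex_inner bop \<Rightarrow> complex" where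
  "trace A = (\<Sum>\<^sub>\<infinity>e\<in>some_onb. cinner (A *\<^sub>V e) e)"

definition trace_norm :: "'a::complex_inner bop \<Rightarrow> real" where
  "trace_norm A = Re (trace (abs_op A))"

text \<open>The weak topology on the trace class operators given by the pairing with \<open>B(H)\<close>.\<close>

definition tc_weakly_tendsto :: "(nat \<Rightarrow> 'a::complex_inner bop) \<Rightarrow> 'a bop \<Rightarrow> bool" where
  "tc_weakly_tendsto X A \<longleftrightarrow> (\<forall>T. (\<lambda>n. trace (X n * T)) \<longlonglongrightarrow> trace (A * T))"

text \<open>The weak-* topology on \<open>B(H)\<close> as the dual of the trace class operators.\<close>

definition ultraweak_topology :: "'a::complex_inner bop topology" where
  "ultraweak_topology = topology_generated_by
     {{T. trace (A * T) \<in> U} | A U. trace_class A \<and> open U}"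

section \<open>Tracial von Neumann algebras\<close>

definition commutant :: "'a::complex_inner bop set \<Rightarrow> 'a bop set" where
  "commutant S = {T. \<forall>s\<in>S. T * s = s * T}"

definition von_neumann_algebra :: "'a::complex_inner bop set \<Rightarrow> bool" where
  "von_neumann_algebra M \<longleftrightarrow> (\<forall>x\<in>M. adj x \<in> M) \<and> commutant (commutant M) = M"

definition finite_von_neumann_algebra :: "'a::complex_inner bop set \<Rightarrow> bool" where
  "finite_von_neumann_algebra M \<longleftrightarrow>
     von_neumann_algebra M \<and> (\<forall>v\<in>M. adj v * v = 1 \<longrightarrow> v * adj v = 1)"

definition state_on :: "'a::complex_inner bop set \<Rightarrow> ('a bop \<Rightarrow> complex) \<Rightarrow> bool" where
  "state_on M \<phi> \<longleftrightarrow>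
     (\<forall>x\<in>M. \<forall>y\<in>M. \<phi> (x + y) = \<phi> x + \<phi> y) \<and>
     (\<forall>c. \<forall>x\<in>M. \<phi> (c *\<^sub>C x) = c * \<phi> x) \<and>
     (\<forall>x\<in>M. positive_op x \<longrightarrow> \<phi> x \<in> \<real>\<^sub>\<ge>\<^sub>0) \<and>
     \<phi> 1 = 1"

definition normal_on :: "'a::complex_inner bop set \<Rightarrow> ('a bop \<Rightarrow> complex) \<Rightarrow> bool" where
  "normal_on M \<phi> \<longleftrightarrow> continuous_map (subtopology ultraweak_topology M) euclidean \<phi>"

definition tracial_von_neumann_algebra ::
    "'a::complex_inner bop set \<Rightarrow> ('a bop \<Rightarrow> complex) \<Rightarrow> bool" where
  "tracial_von_neumann_algebra M \<tau> \<longleftrightarrow>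
     finite_von_neumann_algebra M \<and> state_on M \<tau> \<and> normal_on M \<tau> \<and>
     (\<forall>x\<in>M. \<tau> (adj x * x) = 0 \<longrightarrow> x = 0) \<and>
     (\<forall>x\<in>M. \<forall>y\<in>M. \<tau> (x * y) = \<tau> (y * x))"

text \<open>
  \<open>'h\<close> together with \<open>hat\<close> is (a realisation of) \<open>L\<^sup>2(M,\<tau>)\<close>: the Hilbert space completion of \<open>M\<close>
  with respect to \<open>\<langle>x,y\<rangle> = \<tau>(y\<^sup>* x)\<close>, which is determined up to a unique unitary that is
  compatible with \<open>hat\<close>.  The values of \<open>hat\<close> outside \<open>M\<close> are irrelevant.  The algebra \<open>M\<close> itself
  is given on an arbitrary Hilbert space \<open>'k\<close>.
\<close>

definition is_L2 :: "'k::chilbert_space bop set \<Rightarrow> ('k bop \<Rightarrow> complex) \<Rightarrow>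
    ('k bop \<Rightarrow> 'h::chilbert_space) \<Rightarrow> bool" where
  "is_L2 M \<tau> hat \<longleftrightarrow>
     (\<forall>x\<in>M. \<forall>y\<in>M. hat (x + y) = hat x + hat y) \<and>
     (\<forall>c. \<forall>x\<in>M. hat (c *\<^sub>C x) = c *\<^sub>C hat x) \<and>
     (\<forall>x\<in>M. \<forall>y\<in>M. cinner (hat x) (hat y) = \<tau> (adj y * x)) \<and>
     closure (hat ` M) = UNIV"

definition lmult :: "'k::chilbert_space bop set \<Rightarrow> ('k bop \<Rightarrow> 'h::chilbert_space) \<Rightarrow>
    'k bop \<Rightarrow> 'h bop" where
  "lmult M hat x = (THE S. \<forall>y\<in>M. S *\<^sub>V hat y = hat (x * y))"

section \<open>Hyperstates and their associated maps\<close>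

definition hyperstate :: "'k::chilbert_space bop set \<Rightarrow> ('k bop \<Rightarrow> complex) \<Rightarrow>
    ('k bop \<Rightarrow> 'h::chilbert_space) \<Rightarrow> ('h bop \<Rightarrow> complex) \<Rightarrow> bool" where
  "hyperstate M \<tau> hat \<phi> \<longleftrightarrow> state_on UNIV \<phi> \<and> (\<forall>x\<in>M. \<phi> (lmult M hat x) = \<tau> x)"

text \<open>
  A matrix \<open>(T i j)\<close> over \<open>B(H)\<close> is positive as an operator on \<open>H\<^sup>n\<close>, and complete positivity
  means that every amplification to \<open>n \<times> n\<close> matrices preserves positivity.
\<close>

definition positive_matrix :: "nat \<Rightarrow> (nat \<Rightarrow> nat \<Rightarrow> 'a::complex_inner bop) \<Rightarrow> bool" where
  "positive_matrix n T \<longleftrightarrow>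
     (\<forall>\<xi>. (\<Sum>i<n. \<Sum>j<n. cinner (T i j *\<^sub>V \<xi> j) (\<xi> i)) \<in> \<real>\<^sub>\<ge>\<^sub>0)"

definition ucp :: "('a::complex_inner bop \<Rightarrow> 'a bop) \<Rightarrow> bool" where
  "ucp P \<longleftrightarrow>
     (\<forall>S T. P (S + T) = P S + P T) \<and> (\<forall>c T. P (c *\<^sub>C T) = c *\<^sub>C P T) \<and> P 1 = 1 \<and>
     (\<forall>n T. positive_matrix n T \<longrightarrow> positive_matrix n (\<lambda>i j. P (T i j)))"

definition bimodular :: "'a::complex_inner bop set \<Rightarrow> ('a bop \<Rightarrow> 'a bop) \<Rightarrow> bool" where
  "bimodular N P \<longleftrightarrow> (\<forall>x\<in>N. \<forall>y\<in>N. \<forall>T. P (x * T * y) = x * P T * y)"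

definition hyperstate_map :: "'k::chilbert_space bop set \<Rightarrow> ('k bop \<Rightarrow> 'h::chilbert_space) \<Rightarrow>
    ('h bop \<Rightarrow> complex) \<Rightarrow> 'h bop \<Rightarrow> 'h bop" where
  "hyperstate_map M hat \<phi> = (THE P. ucp P \<and> bimodular (lmult M hat ` M) P \<and>
     (\<forall>T. \<forall>y\<in>M. \<forall>z\<in>M. cinner (P T *\<^sub>V hat y) (hat z) =
        \<phi> (adj (lmult M hat z) * T * lmult M hat y)))"

definition Har :: "('a::complex_inner bop \<Rightarrow> 'a bop) \<Rightarrow> 'a bop set" where
  "Har P = {T. P T = T}"

definition density_matrix :: "('k::chilbert_space bop \<Rightarrow> 'h::chilbert_space) \<Rightarrow>
    ('h bop \<Rightarrow> 'h bop) \<Rightarrow> 'h bop" where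
  "density_matrix hat P = (THE A. positive_op A \<and> trace_class A \<and>
     (\<forall>T. cinner (P T *\<^sub>V hat 1) (hat 1) = trace (A * T)))"

end

theory Submission
  imports Defs
begin

text \<open>
  Write \<open>x\<close> for left multiplication by \<open>x\<close> on the \<open>L\<^sup>2\<close> space and \<open>1\<close> for the vector of the unit.
  Bimodularity of \<open>P\<^sup>n\<close> and cyclicity of the trace give, for every operator \<open>T\<close>,
  \<open>Tr ((x A\<^sub>n - A\<^sub>n x) T) = \<langle>(P\<^sup>n(T) x - x P\<^sup>n(T)) 1, 1\<rangle>\<close>
  (\<open>trace_commutator\<close>, \<open>density_commutator\<close>), and everything is read off from this identity.

  Norm convergence implies weak convergence by the duality bound \<open>trace_times_bound\<close>.

  Suppose that the commutators tend to zero weakly, and let \<open>T\<close> be harmonic.  Then \<open>z T\<close> is harmonic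
  for \<open>z\<close> in \<open>M\<close>, the right hand side of the identity at \<open>z T\<close> does not depend on \<open>n\<close>, and it must be
  zero.  This says that \<open>T\<close> commutes with right multiplications, so it is a left multiplication by
  the commutation theorem (\<open>left_multiplication_if_right_modular\<close>, \<open>Har_if_weak\<close>).  The commutation
  theorem is proved directly for the tracial vector: bounded balls of \<open>M\<close> are closed and convex in the
  \<open>L\<^sup>2\<close> space, and the polar decomposition shows that \<open>T 1\<close> cannot be separated from such a ball.

  Suppose conversely that all harmonic operators lie in \<open>M\<close>.  Choose contractions \<open>V\<^sub>n\<close> at which the
  trace norm of the commutator is attained.  Since \<open>P\<close> is the average of the identity and the
  contraction associated with \<open>\<psi>\<close>, the norm of \<open>P\<^bsup>n+1\<^esup> - P\<^sup>n\<close> is at most \<open>1 / \<surd>(n + 1)\<close>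
  (\<open>average_power_step\<close>); this is what the averaging in the definition of \<open>\<phi>\<close> is for.  Hence the
  cluster points of \<open>P\<^sup>n(V\<^sub>n)\<close> in the weak operator topology are harmonic, lie in \<open>M\<close>, and contribute
  zero because \<open>\<tau>\<close> is a trace.  As the unit ball is compact (\<open>bounded_ball_wot_compact\<close>), the trace
  norms tend to zero (\<open>trace_norm_if_Har\<close>).  Because the \<open>V\<^sub>n\<close> may vary, this gives norm
  convergence and not only weak convergence.

  The operator theory behind this (adjoints, square roots, polar decomposition, the trace, densities of
  normal states) is developed from the Hilbert space axioms.  Normality is used throughout in the form of
  continuity for the weak operator topology on bounded sets (\<open>normal_on_imp_wot_normal_on\<close>).
\<close>

section \<open>Inner products on complex Hilbert spaces\<close>

lemma cinner_add_right: "cinner x (y + z) = cinner x y + cinner x (z::'a::complex_inner)"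
  by (metis cinner_commute cinner_add_left complex_cnj_add)

lemma cinner_scaleC_right: "cinner x (c *\<^sub>C y) = cnj c * cinner x (y::'a::complex_inner)"
  by (metis cinner_commute cinner_scaleC_left complex_cnj_mult)

lemma scaleC_one [simp]: "1 *\<^sub>C x = (x::'a::complex_vector)"
  using scaleC_of_real[of 1 x] by simp

lemma scaleC_zero_left [simp]: "0 *\<^sub>C x = (0::'a::complex_vector)"
  using scaleC_of_real[of 0 x] by simp

lemma scaleC_minus_one: "(-1) *\<^sub>C x = - (x::'a::complex_vector)"
  using scaleC_of_real[of "-1" x] by simp

lemma scaleC_sum_right: "c *\<^sub>C sum f S = (\<Sum>i\<in>S. c *\<^sub>C (f i :: 'a::complex_vector))"
  by (induction S rule: infinite_finite_induct) (simp_all add: scaleC_add_right)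

lemma cinner_scaleR_left: "cinner (r *\<^sub>R x) y = of_real r * cinner x (y::'a::complex_inner)"
  by (metis cinner_scaleC_left scaleC_of_real)

lemma cinner_scaleR_right: "cinner x (r *\<^sub>R y) = of_real r * cinner x (y::'a::complex_inner)"
  by (metis cinner_scaleC_right scaleC_of_real complex_cnj_complex_of_real)

lemma cinner_self: "cinner x x = of_real ((norm (x::'a::complex_inner))\<^sup>2)"
proof (rule complex_eqI)
  show "Re (cinner x x) = Re (of_real ((norm x)\<^sup>2))"
    by (metis Re_complex_of_real inner_eq_Re_cinner power2_norm_eq_inner)
  have "cnj (cinner x x) = cinner x x" by (metis cinner_commute)
  then show "Im (cinner x x) = Im (of_real ((norm x)\<^sup>2))"
    by (simp add: complex_eq_iff)
qed

lemma norm_cinner_le: "cmod (cinner x y) \<le> norm x * norm (y::'a::complex_inner)"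
proof (cases "cinner x y = 0")
  case False
  define c where "c = cnj (cinner x y) / cmod (cinner x y)"
  have [simp]: "cmod c = 1" using False by (simp add: c_def norm_divide)
  have "cinner (c *\<^sub>C x) y = of_real (cmod (cinner x y))"
    using False by (simp add: c_def cinner_scaleC_left complex_norm_square[symmetric] mult.commute power2_eq_square)
  then have "cmod (cinner x y) = inner (c *\<^sub>C x) y"
    by (simp add: inner_eq_Re_cinner)
  also have "\<dots> \<le> norm (c *\<^sub>C x) * norm y"
    using norm_cauchy_schwarz by blast
  finally show ?thesis by (simp add: norm_scaleC)
qed simp

lemma bounded_bilinear_cinner: "bounded_bilinear (cinner :: 'a::complex_inner \<Rightarrow> 'a \<Rightarrow> complex)"
proof
  show "\<exists>K. \<forall>a b::'a. norm (cinner a b) \<le> norm a * norm b * K"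
    by (rule exI[of _ 1]) (simp add: norm_cinner_le)
qed (simp_all add: cinner_add_left cinner_add_right cinner_scaleR_left cinner_scaleR_right scaleR_conv_of_real)

interpretation cinner: bounded_bilinear "cinner :: 'a::complex_inner \<Rightarrow> 'a \<Rightarrow> complex"
  by (rule bounded_bilinear_cinner)

lemma cinner_ext: "(\<And>y. cinner x y = cinner x' y) \<Longrightarrow> x = (x'::'a::complex_inner)"
proof -
  assume "\<And>y. cinner x y = cinner x' y"
  then have "cinner (x - x') (x - x') = 0" by (simp add: cinner.diff_left)
  then show ?thesis by (simp add: cinner_self)
qed

lemma cinner_ext_dense:
  assumes "closure D = UNIV" and eq: "\<And>y. y \<in> D \<Longrightarrow> cinner x y = cinner x' (y::'a::complex_inner)"
  shows "x = x'"
proof (rule cinner_ext)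
  fix y
  have "continuous_on UNIV (\<lambda>y. cinner x y - cinner x' y)"
    by (intro continuous_intros cinner.continuous_on)
  then have "closed {y. cinner x y - cinner x' y = 0}"
    using continuous_closed_preimage_constant[of UNIV "\<lambda>y. cinner x y - cinner x' y" 0] by simp
  moreover have "D \<subseteq> {y. cinner x y - cinner x' y = 0}" using eq by auto
  ultimately have "closure D \<subseteq> {y. cinner x y - cinner x' y = 0}"
    using closure_minimal by blast
  then show "cinner x y = cinner x' y" using assms(1) by auto
qed

lemma cmod_sq_cinner: "complex_of_real ((cmod (cinner x y))\<^sup>2) = cinner x y * cinner y (x::'a::complex_inner)"
  by (metis cinner_commute complex_norm_square)

section \<open>Projections and the Riesz representation\<close>

text \<open>
  Almost nearest points are close together by the parallelogram law, so the intersections of \<open>S\<close>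
  with shrinking balls around \<open>x\<close> have a common point.  Nearest points yield both the Riesz
  representation and the separation argument of the commutation theorem.
\<close>

lemma closed_convex_nearest_point:
  fixes S :: "'a::{real_inner,complete_space} set"
  assumes S: "closed S" "convex S" "S \<noteq> {}"
  obtains p where "p \<in> S" "\<And>s. s \<in> S \<Longrightarrow> inner (x - p) (s - p) \<le> 0"
proof -
  define d where "d = infdist x S"
  define K where "K n = S \<inter> cball x (d + 1 / Suc n)" for n
  have dle: "d \<le> dist x s" if "s \<in> S" for s
    unfolding d_def using that by (rule infdist_le)
  have d0: "0 \<le> d" by (simp add: d_def infdist_nonneg)
  have ne: "K n \<noteq> {}" for n
  proof -
    obtain s where "s \<in> S" "dist x s < d + 1 / Suc n"
      using cINF_less_iff[of S "dist x" "d + 1 / Suc n"] S by (auto simp: d_def infdist_def)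
    then show ?thesis by (auto simp: K_def intro!: exI[of _ s])
  qed
  have par: "(dist y z)\<^sup>2 \<le> 2 * (dist x y)\<^sup>2 + 2 * (dist x z)\<^sup>2 - 4 * d\<^sup>2"
    if "y \<in> S" "z \<in> S" for y z
  proof -
    have "(1/2) *\<^sub>R y + (1/2) *\<^sub>R z \<in> S"
      using S(2) that by (simp add: convex_def)
    then have "d \<le> norm (x - ((1/2) *\<^sub>R y + (1/2) *\<^sub>R z))"
      using dle by (simp add: dist_norm)
    also have "x - ((1/2) *\<^sub>R y + (1/2) *\<^sub>R z) = (1/2) *\<^sub>R ((x - y) + (x - z))"
      by (simp add: algebra_simps flip: scaleR_add_left)
    finally have "2 * d \<le> norm ((x - y) + (x - z))" by simp
    then have "(2 * d)\<^sup>2 \<le> (norm ((x - y) + (x - z)))\<^sup>2"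
      using d0 by (intro power_mono) auto
    moreover have "(norm ((x - y) + (x - z)))\<^sup>2 + (norm ((x - y) - (x - z)))\<^sup>2
        = 2 * (norm (x - y))\<^sup>2 + 2 * (norm (x - z))\<^sup>2"
      unfolding power2_norm_eq_inner by (simp add: algebra_simps inner_commute)
    moreover have "norm ((x - y) - (x - z)) = dist y z"
      by (simp add: dist_norm norm_minus_commute)
    ultimately show ?thesis by (simp add: dist_norm power_mult_distrib)
  qed
  obtain p where p: "\<And>n. p \<in> K n"
  proof (rule decreasing_closed_nest[of K])
    show "closed (K n)" for n using S by (auto simp: K_def)
    show "K n \<noteq> {}" for n by (rule ne)
    show "K n \<subseteq> K m" if "m \<le> n" for m n
    proof -
      have "1 / (1 + real n) \<le> 1 / (1 + real m)" using that by (simp add: frac_le)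
      then show ?thesis by (auto simp: K_def)
    qed
    show "\<exists>n. \<forall>y\<in>K n. \<forall>z\<in>K n. dist y z < e" if e: "e > 0" for e :: real
    proof -
      have "(\<lambda>n. 4 * (d + 1 / Suc n)\<^sup>2 - 4 * d\<^sup>2) \<longlonglongrightarrow> 4 * (d + 0)\<^sup>2 - 4 * d\<^sup>2"
        by (intro tendsto_intros LIMSEQ_Suc lim_1_over_n)
      then have "\<forall>\<^sub>F n in sequentially. 4 * (d + 1 / Suc n)\<^sup>2 - 4 * d\<^sup>2 < e\<^sup>2"
        using e by (intro order_tendstoD(2)) auto
      then obtain n where n: "4 * (d + 1 / Suc n)\<^sup>2 - 4 * d\<^sup>2 < e\<^sup>2"
        by (auto simp: eventually_sequentially)
      have "dist y z < e" if "y \<in> K n" "z \<in> K n" for y z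
      proof -
        have "(dist x y)\<^sup>2 \<le> (d + 1 / Suc n)\<^sup>2" "(dist x z)\<^sup>2 \<le> (d + 1 / Suc n)\<^sup>2"
          using that by (auto simp: K_def intro!: power_mono)
        then have "(dist y z)\<^sup>2 < e\<^sup>2"
          using par[of y z] that n by (auto simp: K_def)
        then show ?thesis using e by (simp add: power2_less_imp_less)
      qed
      then show ?thesis by blast
    qed
  qed blast
  have pS: "p \<in> S" using p[of 0] by (simp add: K_def)
  have "dist x p \<le> d"
  proof (rule LIMSEQ_le_const)
    show "(\<lambda>n. d + 1 / Suc n) \<longlonglongrightarrow> d"
      using tendsto_add[OF tendsto_const[of d] LIMSEQ_Suc[OF lim_1_over_n]] by simp
    show "\<exists>N. \<forall>n\<ge>N. dist x p \<le> d + 1 / Suc n" using p by (auto simp: K_def)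
  qed
  then have opt: "norm (x - p) \<le> norm (x - s)" if "s \<in> S" for s
    using dle[OF that] by (simp add: dist_norm)
  have "inner (x - p) (s - p) \<le> 0" if s: "s \<in> S" for s
  proof (rule ccontr)
    assume "\<not> inner (x - p) (s - p) \<le> 0"
    then have pos: "inner (x - p) (s - p) > 0" by simp
    define a where "a = inner (x - p) (s - p)"
    define b where "b = inner (s - p) (s - p)"
    have b0: "b \<ge> 0" by (simp add: b_def)
    \<comment> \<open>The squared distance from \<open>x\<close> to \<open>p + t (s - p)\<close> changes by \<open>- 2 t a + t\<^sup>2 b\<close>; this \<open>t\<close> makes it negative.\<close>
    define t where "t = min 1 (a / (b + 1))"
    have t: "0 < t" "t \<le> 1" using pos b0 by (auto simp: t_def a_def)
    have tb: "t * (b + 1) \<le> a"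
      using b0 by (simp add: t_def min_le_iff_disj flip: pos_le_divide_eq)
    have "p + t *\<^sub>R (s - p) \<in> S"
    proof -
      have "(1 - t) *\<^sub>R p + t *\<^sub>R s \<in> S" using S(2) pS s t by (simp add: convex_alt)
      then show ?thesis by (simp add: algebra_simps)
    qed
    from opt[OF this] have "inner (x - p) (x - p) \<le> inner (x - p - t *\<^sub>R (s - p)) (x - p - t *\<^sub>R (s - p))"
      by (simp add: norm_le diff_diff_eq)
    also have "\<dots> = inner (x - p) (x - p) - 2 * t * a + t * (t * b)"
      unfolding a_def b_def by (simp add: inner_diff_left inner_diff_right inner_commute algebra_simps)
    finally have "t * (2 * a) \<le> t * (t * b)" by simp
    then have "2 * a \<le> t * b" using t by (simp add: mult_le_cancel_left_pos)
    then show False using tb t pos unfolding a_def[symmetric] by (simp add: algebra_simps)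
  qed
  then show ?thesis using that pS by blast
qed

lemma cinner_eq_0_if_inner_eq_0:
  assumes "inner u p = 0" "inner (\<i> *\<^sub>C u) p = 0"
  shows "cinner u (p::'a::complex_inner) = 0"
  using assms by (simp add: inner_eq_Re_cinner cinner_scaleC_left complex_eq_iff)

text \<open>
  The nearest point to the origin of the hyperplane where \<open>f\<close> is \<open>1\<close> is orthogonal to the kernel
  of \<open>f\<close>, so it is a multiple of the representing vector.
\<close>

lemma riesz_representation:
  fixes f :: "'a::chilbert_space \<Rightarrow> complex"
  assumes f: "bounded_linear f" and fC: "\<And>c x. f (c *\<^sub>C x) = c * f x"
  obtains w where "\<And>v. f v = cinner v w"
proof (cases "\<forall>v. f v = 0")
  case True
  then show ?thesis using that[of 0] by (simp add: cinner.zero_right)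
next
  case False
  interpret f: bounded_linear f by fact
  obtain v where v: "f v \<noteq> 0" using False by blast
  define K where "K = {v. f v = 1}"
  have Kne: "K \<noteq> {}" using fC[of "1 / f v" v] v by (auto simp: K_def)
  have "closed K"
    using continuous_closed_preimage_constant[of UNIV f 1] f.continuous_on[OF continuous_on_id, of UNIV]
    by (simp add: K_def)
  moreover have "convex K"
    by (auto simp: K_def convex_def f.add f.scaleR scaleR_conv_of_real simp flip: of_real_add)
  ultimately obtain p where p: "p \<in> K" "\<And>s. s \<in> K \<Longrightarrow> inner (0 - p) (s - p) \<le> 0"
    using closed_convex_nearest_point[of K 0] Kne by blast
  have fp: "f p = 1" using p by (simp add: K_def)
  have orth: "inner u p = 0" if "f u = 0" for u
  proof -
    have "p + u \<in> K" "p - u \<in> K" using that fp by (auto simp: K_def f.add f.diff)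
    from p(2)[OF this(1)] p(2)[OF this(2)] show ?thesis by (simp add: inner_commute)
  qed
  have corth: "cinner u p = 0" if "f u = 0" for u
    using orth[OF that] orth[of "\<i> *\<^sub>C u"] that by (intro cinner_eq_0_if_inner_eq_0) (simp_all add: fC)
  have p0: "p \<noteq> 0" using fp f.zero by auto
  have "f v = cinner v (inverse ((norm p)\<^sup>2) *\<^sub>R p)" for v
  proof -
    have "f (v - f v *\<^sub>C p) = 0" by (simp add: f.diff fC fp)
    from corth[OF this] have "cinner v p = f v * of_real ((norm p)\<^sup>2)"
      by (simp add: cinner.diff_left cinner_scaleC_left cinner_self)
    then show ?thesis using p0 by (simp add: cinner_scaleR_right)
  qed
  then show ?thesis using that by blast
qed

section \<open>Bounded operators\<close>

text \<open>
  Only upper bounds on operator norms enter the arguments, never the norms themselves.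
\<close>

definition bounded_by :: "real \<Rightarrow> 'a::complex_inner bop \<Rightarrow> bool" where
  "bounded_by c T \<longleftrightarrow> (\<forall>v. norm (T *\<^sub>V v) \<le> c * norm v)"

lemma bounded_byD: "bounded_by c T \<Longrightarrow> norm (T *\<^sub>V v) \<le> c * norm v"
  by (simp add: bounded_by_def)

lemma bop_eqI: "(\<And>v. S *\<^sub>V v = T *\<^sub>V v) \<Longrightarrow> S = T"
  by (metis bop_apply_inverse ext)

lemma bounded_linear_bop: "bounded_linear (bop_apply T)"
  using bop_apply[of T] by simp

lemma bop_scaleC: "T *\<^sub>V (c *\<^sub>C x) = c *\<^sub>C (T *\<^sub>V x)"
  using bop_apply[of T] by simp

lemmas bop_add = linear_add[OF bounded_linear.linear[OF bounded_linear_bop]]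
  and bop_diff = linear_diff[OF bounded_linear.linear[OF bounded_linear_bop]]
  and bop_minus = linear_neg[OF bounded_linear.linear[OF bounded_linear_bop]]
  and bop_zero [simp] = linear_0[OF bounded_linear.linear[OF bounded_linear_bop]]
  and bop_tendsto = bounded_linear.tendsto[OF bounded_linear_bop]

lemma bop_apply_simps [simp]:
  "0 *\<^sub>V v = 0" "1 *\<^sub>V v = v" "(S + T) *\<^sub>V v = S *\<^sub>V v + T *\<^sub>V v"
  "(S - T) *\<^sub>V v = S *\<^sub>V v - T *\<^sub>V v" "(- T) *\<^sub>V v = - (T *\<^sub>V v)"
  "(S * T) *\<^sub>V v = S *\<^sub>V T *\<^sub>V v" "(c *\<^sub>C T) *\<^sub>V v = c *\<^sub>C (T *\<^sub>V v)"
  by (transfer; simp)+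

lemma bop_apply_scaleR [simp]: "(r *\<^sub>R T) *\<^sub>V v = r *\<^sub>R (T *\<^sub>V v)"
  by (simp only: scaleR_bop_def bop_apply_simps) (rule scaleC_of_real)

lemma bop_apply_sum: "(\<Sum>i\<in>I. T i) *\<^sub>V v = (\<Sum>i\<in>I. T i *\<^sub>V v)"
  by (induction I rule: infinite_finite_induct) simp_all

lemma scaleC_times_bop: "(c *\<^sub>C S) * T = c *\<^sub>C (S * (T::'a::complex_inner bop))"
  "S * (c *\<^sub>C T) = c *\<^sub>C (S * T)"
  by (rule bop_eqI; simp add: bop_scaleC)+

lemma ex_bounded_by: obtains c where "c \<ge> 0" "bounded_by c T"
  using bounded_linear.nonneg_bounded[OF bounded_linear_bop, of T] by (auto simp: bounded_by_def mult.commute)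

lemma bounded_by_times:
  assumes "bounded_by a S" "bounded_by b T" "0 \<le> a"
  shows "bounded_by (a * b) (S * T)"
  unfolding bounded_by_def
proof
  fix v
  have "norm (S *\<^sub>V T *\<^sub>V v) \<le> a * norm (T *\<^sub>V v)" using assms by (simp add: bounded_by_def)
  also have "\<dots> \<le> a * (b * norm v)" using assms by (intro mult_left_mono) (auto simp: bounded_by_def)
  finally show "norm ((S * T) *\<^sub>V v) \<le> a * b * norm v" by (simp add: mult.assoc)
qed

lemma bounded_by_add:
  assumes "bounded_by a S" "bounded_by b T"
  shows "bounded_by (a + b) (S + T)"
  unfolding bounded_by_def
proof
  fix v
  show "norm ((S + T) *\<^sub>V v) \<le> (a + b) * norm v"
    using norm_triangle_ineq[of "S *\<^sub>V v" "T *\<^sub>V v"] bounded_byD[OF assms(1), of v]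
      bounded_byD[OF assms(2), of v] by (simp add: distrib_right)
qed

lemma bounded_by_scaleC: "bounded_by b T \<Longrightarrow> bounded_by (cmod c * b) (c *\<^sub>C T)"
  unfolding bounded_by_def by (auto simp: norm_scaleC mult.assoc intro!: mult_left_mono)

lemma bounded_by_mono: "bounded_by a T \<Longrightarrow> a \<le> b \<Longrightarrow> bounded_by b T"
  unfolding bounded_by_def by (meson mult_right_mono norm_ge_zero order_trans)

lemma bounded_by_one: "bounded_by 1 1"
  by (simp add: bounded_by_def)

lemma bounded_by_zero: "bounded_by 0 0"
  by (simp add: bounded_by_def)

lemma bounded_byI_form:
  assumes "\<And>v w. cmod (cinner (T *\<^sub>V v) w) \<le> c * norm v * norm w" "c \<ge> 0"
  shows "bounded_by c T"
  unfolding bounded_by_def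
proof
  fix v
  have "(norm (T *\<^sub>V v))\<^sup>2 = cmod (cinner (T *\<^sub>V v) (T *\<^sub>V v))" by (simp add: cinner_self norm_power)
  also have "\<dots> \<le> c * norm v * norm (T *\<^sub>V v)" by (rule assms)
  finally have "norm (T *\<^sub>V v) * norm (T *\<^sub>V v) \<le> (c * norm v) * norm (T *\<^sub>V v)"
    by (simp add: power2_eq_square)
  then show "norm (T *\<^sub>V v) \<le> c * norm v"
    using assms(2) by (cases "norm (T *\<^sub>V v) = 0") (auto simp: mult_le_cancel_right)
qed

lemma bop_of_form:
  fixes b :: "'a::chilbert_space \<Rightarrow> 'a \<Rightarrow> complex"
  assumes "\<And>u v w. b (u + v) w = b u w + b v w" "\<And>c v w. b (c *\<^sub>C v) w = c * b v w"
    and "\<And>u v w. b w (u + v) = b w u + b w v" "\<And>c v w. b w (c *\<^sub>C v) = cnj c * b w v"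
    and bd: "\<And>v w. cmod (b v w) \<le> c * norm v * norm w" and c: "c \<ge> 0"
  obtains T where "\<And>v w. cinner (T *\<^sub>V v) w = b v w" "bounded_by c T"
proof -
  have "\<exists>u. \<forall>w. b v w = cinner u w" for v
  proof -
    have "bounded_linear (\<lambda>w. cnj (b v w))"
    proof (rule bounded_linear_intro)
      show "cnj (b v (r *\<^sub>R x)) = r *\<^sub>R cnj (b v x)" for r x
        using assms(4)[of v "of_real r" x] by (simp add: scaleC_of_real scaleR_conv_of_real)
      show "norm (cnj (b v x)) \<le> norm x * (c * norm v)" for x
        using bd[of v x] by (simp add: mult.commute)
    qed (simp add: assms)
    then obtain u where "\<And>w. cnj (b v w) = cinner w u"
      using riesz_representation[of "\<lambda>w. cnj (b v w)"] assms(4) by auto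
    then have "b v w = cinner u w" for w
      by (metis cinner_commute complex_cnj_cnj)
    then show ?thesis by blast
  qed
  then obtain f where f: "\<And>v w. b v w = cinner (f v) w" by metis
  have fn: "norm (f v) \<le> c * norm v" for v
  proof (cases "f v = 0")
    case False
    have "(norm (f v))\<^sup>2 = cmod (b v (f v))" by (simp add: f cinner_self norm_power)
    also have "\<dots> \<le> c * norm v * norm (f v)" by (rule bd)
    finally show ?thesis using False by (simp add: power2_eq_square)
  qed (use c in simp)
  have fadd: "f (u + v) = f u + f v" for u v
    by (rule cinner_ext) (simp add: cinner_add_left assms flip: f)
  have fsc: "f (a *\<^sub>C v) = a *\<^sub>C f v" for a v
    by (rule cinner_ext) (simp add: cinner_scaleC_left assms flip: f)
  have "bounded_linear f"
  proof (rule bounded_linear_intro)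
    show "f (r *\<^sub>R x) = r *\<^sub>R f x" for r x using fsc[of "of_real r" x] by (simp add: scaleC_of_real)
    show "norm (f x) \<le> norm x * c" for x using fn by (simp add: mult.commute)
  qed (rule fadd)
  then have [simp]: "Bop f *\<^sub>V v = f v" for v
    by (simp add: Bop_inverse fsc)
  show ?thesis
    by (rule that[of "Bop f"]) (simp_all add: f bounded_by_def fn)
qed

lemma adj_exists:
  fixes T :: "'a::chilbert_space bop"
  shows "\<exists>S. \<forall>x y. cinner (T *\<^sub>V x) y = cinner x (S *\<^sub>V y)"
proof -
  obtain c where c: "c \<ge> 0" "bounded_by c T" by (rule ex_bounded_by)
  have *: "cmod (cinner v (T *\<^sub>V w)) \<le> c * norm v * norm w" for v w
  proof -
    have "cmod (cinner v (T *\<^sub>V w)) \<le> norm v * norm (T *\<^sub>V w)" by (rule norm_cinner_le)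
    also have "\<dots> \<le> norm v * (c * norm w)" using c by (intro mult_left_mono bounded_byD) auto
    finally show ?thesis by (simp add: mult_ac)
  qed
  obtain S where S: "\<And>v w. cinner (S *\<^sub>V v) w = cinner v (T *\<^sub>V w)"
    by (rule bop_of_form[of "\<lambda>v w. cinner v (T *\<^sub>V w)" c])
      (use c * in \<open>auto simp: cinner_add_left cinner_add_right cinner_scaleC_left cinner_scaleC_right bop_add bop_scaleC\<close>)
  then have "cinner (T *\<^sub>V x) y = cinner x (S *\<^sub>V y)" for x y
    by (subst (1 2) cinner_commute) simp
  then show ?thesis by blast
qed

lemma cinner_adj: "cinner (T *\<^sub>V x) y = cinner x (adj T *\<^sub>V (y::'a::chilbert_space))"
proof -
  have "\<exists>!S. \<forall>x y. cinner (T *\<^sub>V x) y = cinner x (S *\<^sub>V y)"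
  proof (rule ex_ex1I[OF adj_exists])
    fix S S' assume S: "\<forall>x y. cinner (T *\<^sub>V x) y = cinner x (S *\<^sub>V y)"
      and S': "\<forall>x y. cinner (T *\<^sub>V x) y = cinner x (S' *\<^sub>V y)"
    show "S = S'"
    proof (rule bop_eqI, rule cinner_ext)
      fix v y
      have "cinner y (S *\<^sub>V v) = cinner y (S' *\<^sub>V v)" using S S' by metis
      then show "cinner (S *\<^sub>V v) y = cinner (S' *\<^sub>V v) y"
        by (subst (1 2) cinner_commute) simp
    qed
  qed
  from theI'[OF this] show ?thesis unfolding adj_def by blast
qed

lemma cinner_adj': "cinner x (T *\<^sub>V y) = cinner (adj T *\<^sub>V x) (y::'a::chilbert_space)"
  by (subst (1 2) cinner_commute) (simp add: cinner_adj)

lemma adj_eqI: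
  assumes "\<And>x y. cinner (T *\<^sub>V x) y = cinner x (S *\<^sub>V (y::'a::chilbert_space))"
  shows "adj T = S"
proof (rule bop_eqI, rule cinner_ext)
  fix v y
  have "cinner y (adj T *\<^sub>V v) = cinner y (S *\<^sub>V v)" using cinner_adj[of T y v] assms[of y v] by simp
  then show "cinner (adj T *\<^sub>V v) y = cinner (S *\<^sub>V v) y"
    by (subst (1 2) cinner_commute) simp
qed

lemma adj_adj [simp]: "adj (adj T) = (T::'a::chilbert_space bop)"
  by (rule adj_eqI) (rule cinner_adj'[symmetric])

lemma adj_times: "adj (S * T) = adj T * adj (S::'a::chilbert_space bop)"
  by (rule adj_eqI) (simp add: cinner_adj)

lemma adj_add: "adj (S + T) = adj S + adj (T::'a::chilbert_space bop)"
  by (rule adj_eqI) (simp add: cinner_adj cinner_add_left cinner_add_right)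

lemma adj_diff: "adj (S - T) = adj S - adj (T::'a::chilbert_space bop)"
  by (rule adj_eqI) (simp add: cinner_adj cinner.diff_left cinner.diff_right)

lemma adj_scaleC: "adj (c *\<^sub>C T) = cnj c *\<^sub>C adj (T::'a::chilbert_space bop)"
  by (rule adj_eqI) (simp add: cinner_adj cinner_scaleC_left cinner_scaleC_right)

lemma adj_scaleR: "adj (r *\<^sub>R T) = r *\<^sub>R adj (T::'a::chilbert_space bop)"
  by (rule adj_eqI) (simp add: cinner_adj cinner_scaleR_left cinner_scaleR_right)

lemma adj_one [simp]: "adj 1 = (1::'a::chilbert_space bop)"
  by (rule adj_eqI) simp

lemma bounded_by_adj: "bounded_by c T \<Longrightarrow> c \<ge> 0 \<Longrightarrow> bounded_by c (adj (T::'a::chilbert_space bop))"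
proof (rule bounded_byI_form)
  fix v w assume T: "bounded_by c T" "c \<ge> 0"
  have "cmod (cinner (adj T *\<^sub>V v) w) \<le> norm v * norm (T *\<^sub>V w)"
    using norm_cinner_le[of v "T *\<^sub>V w"] by (simp add: cinner_adj')
  also have "\<dots> \<le> norm v * (c * norm w)" using T by (intro mult_left_mono bounded_byD) auto
  finally show "cmod (cinner (adj T *\<^sub>V v) w) \<le> c * norm v * norm w" by (simp add: mult_ac)
qed

section \<open>Extension from dense subspaces\<close>

text \<open>
  The data are indexed by a set of labels \<open>V\<close> with a linear map \<open>hat\<close> into the Hilbert space,
  because a tracial algebra sits in its \<open>L\<^sup>2\<close> space through such a map.  The bound makes \<open>f\<close>
  factor through \<open>hat\<close> as a Lipschitz map, which extends to the closure.
\<close>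

lemma extend_from_dense:
  fixes f :: "'i::complex_vector \<Rightarrow> 'b::chilbert_space" and hat :: "'i \<Rightarrow> 'a::chilbert_space"
  assumes V: "\<And>x y. x \<in> V \<Longrightarrow> y \<in> V \<Longrightarrow> x + y \<in> V" "\<And>c x. x \<in> V \<Longrightarrow> c *\<^sub>C x \<in> V"
    and hat: "\<And>x y. x \<in> V \<Longrightarrow> y \<in> V \<Longrightarrow> hat (x + y) = hat x + hat y"
      "\<And>c x. x \<in> V \<Longrightarrow> hat (c *\<^sub>C x) = c *\<^sub>C hat x"
    and dense: "closure (hat ` V) = UNIV"
    and f: "\<And>x y. x \<in> V \<Longrightarrow> y \<in> V \<Longrightarrow> f (x + y) = f x + f y"
      "\<And>c x. x \<in> V \<Longrightarrow> f (c *\<^sub>C x) = c *\<^sub>C f x"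
    and bd: "\<And>x. x \<in> V \<Longrightarrow> norm (f x) \<le> c * norm (hat x)" and c: "c \<ge> 0"
  obtains g where "bounded_linear g" "\<And>a v. g (a *\<^sub>C v) = a *\<^sub>C g v"
    "\<And>x. x \<in> V \<Longrightarrow> g (hat x) = f x" "\<And>v. norm (g v) \<le> c * norm v"
proof -
  have neg: "- y \<in> V \<and> hat (- y) = - hat y \<and> f (- y) = - f y" if "y \<in> V" for y
    using V(2)[OF that, of "-1"] hat(2)[OF that, of "-1"] f(2)[OF that, of "-1"]
    by (simp add: scaleC_minus_one)
  have diff: "x - y \<in> V" "hat (x - y) = hat x - hat y" "f (x - y) = f x - f y"
    if "x \<in> V" "y \<in> V" for x y
    using V(1)[of x "- y"] hat(1)[of x "- y"] f(1)[of x "- y"] neg[OF that(2)] that by simp_all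
  define f' where "f' v = f (inv_into V hat v)" for v
  have f': "f' (hat x) = f x" if "x \<in> V" for x
  proof -
    let ?y = "inv_into V hat (hat x)"
    have y: "?y \<in> V" "hat ?y = hat x" using that by (auto intro: inv_into_into f_inv_into_f)
    have "norm (f (?y - x)) \<le> c * norm (hat (?y - x))" using diff(1)[OF y(1) that] by (rule bd)
    then show ?thesis using diff(2,3)[OF y(1) that] y by (simp add: f'_def)
  qed
  have lip: "dist (f' v) (f' w) \<le> c * dist v w" if vw: "v \<in> hat ` V" "w \<in> hat ` V" for v w
  proof -
    obtain x y where xy: "x \<in> V" "v = hat x" "y \<in> V" "w = hat y" using vw by auto
    have "norm (f (x - y)) \<le> c * norm (hat (x - y))" using diff(1)[OF xy(1,3)] by (rule bd)
    then show ?thesis using diff(2,3)[OF xy(1,3)] xy by (simp add: f' dist_norm)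
  qed
  have "uniformly_continuous_on (hat ` V) f'"
    unfolding uniformly_continuous_on_def
  proof (intro allI impI)
    fix e :: real assume e: "e > 0"
    have "dist (f' x') (f' x) < e"
      if "x \<in> hat ` V" "x' \<in> hat ` V" "dist x' x < e / (c + 1)" for x x'
    proof -
      have "dist (f' x') (f' x) \<le> (c + 1) * dist x' x"
        using lip[of x' x] that zero_le_dist[of x' x] unfolding distrib_right by linarith
      also have "\<dots> < e" using that c by (simp add: pos_less_divide_eq mult.commute)
      finally show ?thesis .
    qed
    then show "\<exists>d>0. \<forall>x\<in>hat ` V. \<forall>x'\<in>hat ` V. dist x' x < d \<longrightarrow> dist (f' x') (f' x) < e"
      using e c by (intro exI[of _ "e / (c + 1)"]) auto
  qed
  then obtain g where "uniformly_continuous_on (closure (hat ` V)) g"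
    and g2: "\<And>x. x \<in> hat ` V \<Longrightarrow> f' x = g x"
    by (rule uniformly_continuous_on_extension_on_closure) blast
  then have g1: "uniformly_continuous_on UNIV g" by (simp only: dense)
  have gc: "isCont g x" for x
    using uniformly_continuous_imp_continuous[OF g1] by (simp add: continuous_on_eq_continuous_at)
  have gf: "g (hat x) = f x" if "x \<in> V" for x using g2[of "hat x"] f'[OF that] that by simp
  have seq: "\<exists>s. (\<forall>n. s n \<in> V) \<and> (\<lambda>n. hat (s n)) \<longlonglongrightarrow> v" for v
  proof -
    have "v \<in> closure (hat ` V)" using dense by simp
    then obtain u where u: "\<And>n. u n \<in> hat ` V" "u \<longlonglongrightarrow> v" by (auto simp: closure_sequential)
    then have "\<exists>s. \<forall>n. s n \<in> V \<and> u n = hat (s n)" by (intro choice) auto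
    then obtain s where s: "\<And>n. s n \<in> V \<and> u n = hat (s n)" by blast
    then have "u = (\<lambda>n. hat (s n))" by blast
    then show ?thesis using u(2) s by blast
  qed
  have gl: "(\<lambda>n. f (s n)) \<longlonglongrightarrow> g v" if "\<forall>n. s n \<in> V" "(\<lambda>n. hat (s n)) \<longlonglongrightarrow> v" for s v
    using isCont_tendsto_compose[OF gc that(2)] that(1) gf by simp
  have gadd: "g (v + w) = g v + g w" for v w
  proof -
    obtain s t where s: "\<forall>n. s n \<in> V" "(\<lambda>n. hat (s n)) \<longlonglongrightarrow> v"
      and t: "\<forall>n. t n \<in> V" "(\<lambda>n. hat (t n)) \<longlonglongrightarrow> w" using seq by metis
    have "(\<lambda>n. f (s n + t n)) \<longlonglongrightarrow> g (v + w)"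
      using s t by (intro gl) (auto simp: V hat intro: tendsto_add)
    moreover have "(\<lambda>n. f (s n + t n)) \<longlonglongrightarrow> g v + g w"
      using tendsto_add[OF gl[OF s] gl[OF t]] s t by (simp add: f)
    ultimately show ?thesis by (rule LIMSEQ_unique)
  qed
  have gsc: "g (a *\<^sub>C v) = a *\<^sub>C g v" for a v
  proof -
    obtain s where s: "\<forall>n. s n \<in> V" "(\<lambda>n. hat (s n)) \<longlonglongrightarrow> v" using seq by metis
    have "(\<lambda>n. f (a *\<^sub>C s n)) \<longlonglongrightarrow> g (a *\<^sub>C v)"
      using s by (intro gl) (auto simp: V hat intro: bounded_linear.tendsto[OF bounded_linear_scaleC])
    moreover have "(\<lambda>n. f (a *\<^sub>C s n)) \<longlonglongrightarrow> a *\<^sub>C g v"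
      using bounded_linear.tendsto[OF bounded_linear_scaleC gl[OF s], of a] s by (simp add: f)
    ultimately show ?thesis by (rule LIMSEQ_unique)
  qed
  have gn: "norm (g v) \<le> c * norm v" for v
  proof -
    obtain s where s: "\<forall>n. s n \<in> V" "(\<lambda>n. hat (s n)) \<longlonglongrightarrow> v" using seq by metis
    show ?thesis
      by (rule LIMSEQ_le[OF tendsto_norm[OF gl[OF s]] tendsto_mult_left[OF tendsto_norm[OF s(2)]]])
        (use s bd in auto)
  qed
  have "bounded_linear g"
  proof (rule bounded_linear_intro)
    show "g (r *\<^sub>R x) = r *\<^sub>R g x" for r x using gsc[of "of_real r" x] by (simp add: scaleC_of_real)
    show "norm (g x) \<le> norm x * c" for x using gn by (simp add: mult.commute)
  qed (rule gadd)
  then show ?thesis using that gsc gf gn by blast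
qed

lemma bop_from_dense:
  fixes f :: "'i::complex_vector \<Rightarrow> 'a::chilbert_space" and hat :: "'i \<Rightarrow> 'a"
  assumes "\<And>x y. x \<in> V \<Longrightarrow> y \<in> V \<Longrightarrow> x + y \<in> V" "\<And>c x. x \<in> V \<Longrightarrow> c *\<^sub>C x \<in> V"
    and "\<And>x y. x \<in> V \<Longrightarrow> y \<in> V \<Longrightarrow> hat (x + y) = hat x + hat y"
      "\<And>c x. x \<in> V \<Longrightarrow> hat (c *\<^sub>C x) = c *\<^sub>C hat x"
    and "closure (hat ` V) = UNIV"
    and "\<And>x y. x \<in> V \<Longrightarrow> y \<in> V \<Longrightarrow> f (x + y) = f x + f y"
      "\<And>c x. x \<in> V \<Longrightarrow> f (c *\<^sub>C x) = c *\<^sub>C f x"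
    and "\<And>x. x \<in> V \<Longrightarrow> norm (f x) \<le> c * norm (hat x)" and "c \<ge> 0"
  obtains T where "\<And>x. x \<in> V \<Longrightarrow> T *\<^sub>V hat x = f x" "bounded_by c T"
proof -
  obtain g where g: "bounded_linear g" "\<And>a v. g (a *\<^sub>C v) = a *\<^sub>C g v"
    "\<And>x. x \<in> V \<Longrightarrow> g (hat x) = f x" "\<And>v. norm (g v) \<le> c * norm v"
    by (rule extend_from_dense[of V hat f c, OF assms]) (assumption | rule that)+
  have [simp]: "Bop g *\<^sub>V v = g v" for v using g by (simp add: Bop_inverse)
  show ?thesis by (rule that[of "Bop g"]) (simp_all add: g bounded_by_def)
qed

text \<open>
  The form of the map associated with a hyperstate is only given on the vectors \<open>hat y\<close>, hence this
  version in which the arguments are labels of the vectors of a dense subspace.  That the form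
  depends on the vectors alone is a consequence of the bound.
\<close>

lemma bop_of_form_dense:
  fixes b :: "'i::complex_vector \<Rightarrow> 'i \<Rightarrow> complex" and hat :: "'i \<Rightarrow> 'a::chilbert_space"
  assumes V: "\<And>x y. x \<in> V \<Longrightarrow> y \<in> V \<Longrightarrow> x + y \<in> V" "\<And>c x. x \<in> V \<Longrightarrow> c *\<^sub>C x \<in> V"
    and hat: "\<And>x y. x \<in> V \<Longrightarrow> y \<in> V \<Longrightarrow> hat (x + y) = hat x + hat y"
      "\<And>c x. x \<in> V \<Longrightarrow> hat (c *\<^sub>C x) = c *\<^sub>C hat x"
    and dense: "closure (hat ` V) = UNIV"
    and b: "\<And>u v w. u \<in> V \<Longrightarrow> v \<in> V \<Longrightarrow> w \<in> V \<Longrightarrow> b (u + v) w = b u w + b v w"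
      "\<And>c v w. v \<in> V \<Longrightarrow> w \<in> V \<Longrightarrow> b (c *\<^sub>C v) w = c * b v w"
      "\<And>u v w. u \<in> V \<Longrightarrow> v \<in> V \<Longrightarrow> w \<in> V \<Longrightarrow> b w (u + v) = b w u + b w v"
      "\<And>c v w. v \<in> V \<Longrightarrow> w \<in> V \<Longrightarrow> b w (c *\<^sub>C v) = cnj c * b w v"
    and bd: "\<And>v w. v \<in> V \<Longrightarrow> w \<in> V \<Longrightarrow> cmod (b v w) \<le> c * norm (hat v) * norm (hat w)"
    and c: "c \<ge> 0"
  obtains T where "\<And>v w. v \<in> V \<Longrightarrow> w \<in> V \<Longrightarrow> cinner (T *\<^sub>V hat v) (hat w) = b v w" "bounded_by c T"
proof -
  have "\<exists>u. (\<forall>w\<in>V. b v w = cinner u (hat w)) \<and> norm u \<le> c * norm (hat v)" if v: "v \<in> V" for v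
  proof -
    have 1: "cnj (b v (x + y)) = cnj (b v x) + cnj (b v y)" if "x \<in> V" "y \<in> V" for x y
      using b(3)[OF that v] by simp
    have 2: "cnj (b v (c *\<^sub>C x)) = c *\<^sub>C cnj (b v x)" if "x \<in> V" for c x
      using b(4)[OF that v] by (simp add: scaleC_complex_def)
    have 3: "norm (cnj (b v x)) \<le> (c * norm (hat v)) * norm (hat x)" if "x \<in> V" for x
      using bd[OF v that] by simp
    have 4: "0 \<le> c * norm (hat v)" using c by simp
    obtain g where g: "bounded_linear g" "\<And>a x. g (a *\<^sub>C x) = a *\<^sub>C g x"
      "\<And>w. w \<in> V \<Longrightarrow> g (hat w) = cnj (b v w)" "\<And>x. norm (g x) \<le> (c * norm (hat v)) * norm x"
      by (rule extend_from_dense[of V hat "\<lambda>w. cnj (b v w)" "c * norm (hat v)", OF V hat dense 1 2 3 4])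
        (assumption | rule that)+
    have gC: "g (a *\<^sub>C x) = a * g x" for a x using g(2) by (simp add: scaleC_complex_def)
    obtain u where u: "\<And>x. g x = cinner x u" using riesz_representation[OF g(1) gC] by blast
    have "b v w = cinner u (hat w)" if "w \<in> V" for w
      using g(3)[OF that] u[of "hat w"] cinner_commute[of u "hat w"] by simp
    moreover have "norm u \<le> c * norm (hat v)"
    proof (cases "u = 0")
      case False
      have "(norm u)\<^sup>2 = cmod (g u)" by (simp add: u cinner_self norm_power)
      also have "\<dots> \<le> c * norm (hat v) * norm u" by (rule g)
      finally show ?thesis using False by (simp add: power2_eq_square)
    qed (use c in simp)
    ultimately show ?thesis by blast
  qed
  then obtain f where f: "\<And>v w. v \<in> V \<Longrightarrow> w \<in> V \<Longrightarrow> b v w = cinner (f v) (hat w)"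
    "\<And>v. v \<in> V \<Longrightarrow> norm (f v) \<le> c * norm (hat v)" by metis
  have fadd: "f (u + v) = f u + f v" if "u \<in> V" "v \<in> V" for u v
  proof (rule cinner_ext_dense[OF dense])
    fix y assume "y \<in> hat ` V"
    then obtain w where "w \<in> V" "y = hat w" by blast
    then show "cinner (f (u + v)) y = cinner (f u + f v) y"
      using that V(1) b(1) by (simp add: cinner_add_left f(1)[symmetric])
  qed
  have fsc: "f (a *\<^sub>C v) = a *\<^sub>C f v" if "v \<in> V" for a v
  proof (rule cinner_ext_dense[OF dense])
    fix y assume "y \<in> hat ` V"
    then obtain w where "w \<in> V" "y = hat w" by blast
    then show "cinner (f (a *\<^sub>C v)) y = cinner (a *\<^sub>C f v) y"
      using that V(2) b(2) by (simp add: cinner_scaleC_left f(1)[symmetric])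
  qed
  obtain T where "\<And>x. x \<in> V \<Longrightarrow> T *\<^sub>V hat x = f x" "bounded_by c T"
    by (rule bop_from_dense[of V hat f c, OF V hat dense fadd fsc f(2) c]) (assumption | rule that)+
  then show ?thesis using that[of T] f(1) by simp
qed

text \<open>
  If \<open>p\<close> is the point of the closure nearest to \<open>x\<close>, then \<open>x - p\<close> is orthogonal to \<open>V\<close>.
\<close>

lemma dense_if_orthogonal_complement_trivial:
  fixes V :: "'a::chilbert_space set"
  assumes V: "0 \<in> V" "\<And>x y. x \<in> V \<Longrightarrow> y \<in> V \<Longrightarrow> x + y \<in> V" "\<And>c x. x \<in> V \<Longrightarrow> c *\<^sub>C x \<in> V"
    and orth: "\<And>x. (\<And>v. v \<in> V \<Longrightarrow> cinner v x = 0) \<Longrightarrow> x = 0"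
  shows "closure V = UNIV"
proof -
  have sub: "subspace (closure V)"
    unfolding subspace_def
  proof (intro conjI ballI allI)
    show "0 \<in> closure V" using V(1) closure_subset by blast
    fix x assume "x \<in> closure V"
    then obtain s where s: "\<And>n. s n \<in> V" "s \<longlonglongrightarrow> x" by (auto simp: closure_sequential)
    show "x + y \<in> closure V" if y: "y \<in> closure V" for y
    proof -
      obtain t where "\<And>n. t n \<in> V" "t \<longlonglongrightarrow> y" using y by (auto simp: closure_sequential)
      then have "(\<forall>n. s n + t n \<in> V) \<and> (\<lambda>n. s n + t n) \<longlonglongrightarrow> x + y"
        using s V(2) by (auto intro: tendsto_add)
      then show ?thesis unfolding closure_sequential by (rule exI[of _ "\<lambda>n. s n + t n"])
    qed
    show "r *\<^sub>R x \<in> closure V" for r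
    proof -
      have "(\<forall>n. r *\<^sub>R s n \<in> V) \<and> (\<lambda>n. r *\<^sub>R s n) \<longlonglongrightarrow> r *\<^sub>R x"
        using s V(3)[of _ "of_real r"] by (auto simp: scaleC_of_real intro: tendsto_scaleR)
      then show ?thesis unfolding closure_sequential by (rule exI[of _ "\<lambda>n. r *\<^sub>R s n"])
    qed
  qed
  have "x \<in> closure V" for x
  proof -
    have ne: "closure V \<noteq> {}" using V(1) by auto
    obtain p where p: "p \<in> closure V" "\<And>s. s \<in> closure V \<Longrightarrow> inner (x - p) (s - p) \<le> 0"
      by (rule closed_convex_nearest_point[OF closed_closure subspace_imp_convex[OF sub] ne, of x]) (rule that)
    have i0: "inner v (x - p) = 0" if "v \<in> V" for v
    proof -
      have v: "v \<in> closure V" using that closure_subset by blast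
      have "p + v \<in> closure V" "p - v \<in> closure V"
        using sub p(1) v by (auto simp: subspace_add subspace_diff)
      from p(2)[OF this(1)] p(2)[OF this(2)] show ?thesis by (simp add: inner_commute)
    qed
    have "cinner v (x - p) = 0" if "v \<in> V" for v
      using i0[OF that] i0[OF V(3)[OF that, of \<i>]] by (rule cinner_eq_0_if_inner_eq_0)
    then have "x - p = 0" by (rule orth)
    then show ?thesis using p(1) by simp
  qed
  then show ?thesis by blast
qed

section \<open>Weak operator limits\<close>

definition wot_tendsto :: "('i \<Rightarrow> 'a::complex_inner bop) \<Rightarrow> 'a bop \<Rightarrow> 'i filter \<Rightarrow> bool" where
  "wot_tendsto X T F \<longleftrightarrow> (\<forall>v w. ((\<lambda>i. cinner (X i *\<^sub>V v) w) \<longlongrightarrow> cinner (T *\<^sub>V v) w) F)"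

text \<open>
  Compactness of bounded balls in the weak operator topology: the matrix coefficients of the
  operators live in a product of compact discs, Tychonoff's theorem gives a cluster point there, and
  the limiting coefficients are again a bounded sesquilinear form.  It is phrased as the existence of
  a finer filter along which the family converges, which serves as a substitute for subnets.
\<close>

lemma bounded_ball_wot_compact:
  fixes X :: "'i \<Rightarrow> 'a::chilbert_space bop"
  assumes F: "F \<noteq> bot" and X: "\<And>i. bounded_by c (X i)" and c: "c \<ge> 0"
  obtains G T where "G \<le> F" "G \<noteq> bot" "wot_tendsto X T G" "bounded_by c T"
proof -
  define B :: "'a \<times> 'a \<Rightarrow> complex set" where "B p = cball 0 (c * norm (fst p) * norm (snd p))" for p
  define g :: "'i \<Rightarrow> 'a \<times> 'a \<Rightarrow> complex" where "g i p = cinner (X i *\<^sub>V fst p) (snd p)" for i p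
  have gB: "g i \<in> PiE UNIV B" for i
  proof -
    have "cmod (cinner (X i *\<^sub>V v) w) \<le> c * norm v * norm w" for v w
      by (intro order_trans[OF norm_cinner_le] mult_right_mono bounded_byD[OF X] norm_ge_zero)
    then show ?thesis by (auto simp: g_def B_def)
  qed
  have "compactin (product_topology (\<lambda>_. euclidean) UNIV) (PiE UNIV B)"
    by (subst compactin_PiE) (auto simp: B_def)
  then have "compact (PiE UNIV B)"
    by (simp add: euclidean_product_topology)
  moreover have "filtermap g F \<noteq> bot" using F by (simp add: filtermap_bot_iff)
  moreover have "eventually (\<lambda>f. f \<in> PiE UNIV B) (filtermap g F)"
    using gB by (simp add: eventually_filtermap)
  ultimately obtain z where z: "inf (nhds z) (filtermap g F) \<noteq> bot"
    unfolding compact_filter by blast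
  define G where "G = inf (filtercomap g (nhds z)) F"
  have G: "G \<le> F" by (simp add: G_def)
  have Gb: "G \<noteq> bot"
  proof
    assume "G = bot"
    then have "eventually (\<lambda>_. False) G" by simp
    then obtain Q R where QR: "eventually Q (filtercomap g (nhds z))" "eventually R F"
      "\<And>x. Q x \<Longrightarrow> R x \<Longrightarrow> False"
      unfolding G_def eventually_inf by blast
    then obtain S where S: "eventually S (nhds z)" "\<And>x. S (g x) \<Longrightarrow> Q x"
      unfolding eventually_filtercomap by blast
    have "eventually (\<lambda>f. \<not> S f) (filtermap g F)"
      unfolding eventually_filtermap by (rule eventually_mono[OF QR(2)]) (use S QR in blast)
    with S(1) have "eventually (\<lambda>_. False) (inf (nhds z) (filtermap g F))"
      unfolding eventually_inf by blast
    then show False using z by (simp add: eventually_False)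
  qed
  have "filterlim g (nhds z) G"
    unfolding filterlim_iff_le_filtercomap G_def by simp
  then have gz: "eventually (\<lambda>i. g i \<in> S) G" if "open S" "z \<in> S" for S
    using that topological_tendstoD by blast
  have lim: "((\<lambda>i. g i p) \<longlongrightarrow> z p) G" for p
  proof (rule topological_tendstoI)
    fix S :: "complex set" assume S: "open S" "z p \<in> S"
    have "open ((\<lambda>f :: 'a \<times> 'a \<Rightarrow> complex. f p) -` S)"
      using continuous_on_open_vimage[OF open_UNIV, of "\<lambda>f :: 'a \<times> 'a \<Rightarrow> complex. f p"] S(1) by simp
    from gz[OF this] show "eventually (\<lambda>i. g i p \<in> S) G" using S(2) by simp
  qed
  define b where "b v w = z (v, w)" for v w
  have lb: "((\<lambda>i. cinner (X i *\<^sub>V v) w) \<longlongrightarrow> b v w) G" for v w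
    using lim[of "(v, w)"] by (simp add: g_def b_def)
  have b1: "b (u + v) w = b u w + b v w" for u v w
    using tendsto_unique[OF Gb lb[of "u + v" w]] tendsto_add[OF lb[of u w] lb[of v w]]
    by (simp add: bop_add cinner_add_left)
  have b2: "b (a *\<^sub>C v) w = a * b v w" for a v w
    using tendsto_unique[OF Gb lb[of "a *\<^sub>C v" w]] tendsto_mult_left[OF lb[of v w], of a]
    by (simp add: bop_scaleC cinner_scaleC_left)
  have b3: "b w (u + v) = b w u + b w v" for u v w
    using tendsto_unique[OF Gb lb[of w "u + v"]] tendsto_add[OF lb[of w u] lb[of w v]]
    by (simp add: cinner_add_right)
  have b4: "b w (a *\<^sub>C v) = cnj a * b w v" for a v w
    using tendsto_unique[OF Gb lb[of w "a *\<^sub>C v"]] tendsto_mult_left[OF lb[of w v], of "cnj a"]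
    by (simp add: cinner_scaleC_right)
  have b5: "cmod (b v w) \<le> c * norm v * norm w" for v w
  proof (rule tendsto_upperbound[OF tendsto_norm[OF lb] _ Gb])
    show "\<forall>\<^sub>F i in G. cmod (cinner (X i *\<^sub>V v) w) \<le> c * norm v * norm w"
      using gB by (auto simp: PiE_iff g_def B_def)
  qed
  obtain T where T: "\<And>v w. cinner (T *\<^sub>V v) w = b v w" "bounded_by c T"
    by (rule bop_of_form[OF b1 b2 b3 b4 b5 c]) (rule that)
  show ?thesis
    by (rule that[OF G Gb _ T(2)]) (simp add: wot_tendsto_def T(1) lb)
qed

lemma wot_tendsto_unique:
  assumes "F \<noteq> bot" "wot_tendsto X S F" "wot_tendsto X T F"
  shows "S = T"
proof (rule bop_eqI, rule cinner_ext)
  show "cinner (S *\<^sub>V v) w = cinner (T *\<^sub>V v) w" for v w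
    using tendsto_unique[OF assms(1)] assms(2,3) unfolding wot_tendsto_def by blast
qed

lemma wot_tendsto_sandwich:
  fixes S :: "'a::chilbert_space bop"
  assumes "wot_tendsto X T F"
  shows "wot_tendsto (\<lambda>i. S * X i * R) (S * T * R) F"
  using assms by (simp add: wot_tendsto_def cinner_adj[of S])

lemma wot_tendsto_times:
  fixes S :: "'a::chilbert_space bop"
  assumes "wot_tendsto X T F"
  shows "wot_tendsto (\<lambda>i. S * X i) (S * T) F" "wot_tendsto (\<lambda>i. X i * S) (T * S) F"
  using assms by (simp_all add: wot_tendsto_def cinner_adj[of S])

lemma wot_limit_in_commutant:
  fixes X :: "'i \<Rightarrow> 'a::chilbert_space bop"
  assumes "F \<noteq> bot" "wot_tendsto X T F" "\<And>i. X i \<in> commutant S"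
  shows "T \<in> commutant S"
proof -
  have "T * s = s * T" if "s \<in> S" for s
  proof (rule wot_tendsto_unique[OF assms(1)])
    show "wot_tendsto (\<lambda>i. X i * s) (T * s) F" "wot_tendsto (\<lambda>i. X i * s) (s * T) F"
      using wot_tendsto_times[OF assms(2), of s] assms(3) that by (simp_all add: commutant_def)
  qed
  then show ?thesis by (simp add: commutant_def)
qed

text \<open>
  For uniformly bounded operators, matrix coefficients against a dense set of vectors approximate
  all matrix coefficients uniformly in the operator.
\<close>

lemma wot_tendstoI_dense:
  assumes D: "closure D = UNIV" and bd: "\<And>i. bounded_by c (X i)" "bounded_by c T" and c: "c \<ge> 0"
    and lim: "\<And>v w. v \<in> D \<Longrightarrow> w \<in> D \<Longrightarrow> ((\<lambda>i. cinner (X i *\<^sub>V v) w) \<longlongrightarrow> cinner (T *\<^sub>V v) w) F"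
  shows "wot_tendsto X T F"
  unfolding wot_tendsto_def
proof (intro allI tendstoI)
  fix v w :: 'a and e :: real assume e: "e > 0"
  define r where "r = norm v + norm w + 1"
  have r: "r > 0" by (simp add: r_def add_nonneg_pos)
  \<comment> \<open>The second bound makes \<open>2 c r d\<close> at most \<open>e / 3\<close>, the first keeps the norm of the approximating vector below \<open>r\<close>.\<close>
  define d where "d = min 1 (e / (6 * (c * r + 1)))"
  have d: "d > 0" "d \<le> 1" using e c r by (auto simp: d_def intro!: divide_pos_pos add_nonneg_pos mult_nonneg_nonneg)
  have dr: "c * r * d \<le> e / 6"
  proof -
    have "d * (6 * (c * r + 1)) \<le> e"
      using c r by (simp add: d_def min_le_iff_disj add_nonneg_pos flip: pos_le_divide_eq)
    then show ?thesis using d by (simp add: algebra_simps)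
  qed
  have "v \<in> closure D" "w \<in> closure D" using D by auto
  then obtain v' w' where v': "v' \<in> D" "dist v' v < d" and w': "w' \<in> D" "dist w' w < d"
    using d(1) by (meson closure_approachable)
  have nw: "norm w \<le> r" by (simp add: r_def)
  have "norm v' \<le> norm v + norm (v' - v)" using norm_triangle_sub[of v' v] by simp
  then have nv: "norm v' \<le> r" using v'(2) d(2) norm_ge_zero[of w] unfolding r_def dist_norm by linarith
  have close: "cmod (cinner (Y *\<^sub>V v) w - cinner (Y *\<^sub>V v') w') \<le> e / 3" if Y: "bounded_by c Y" for Y
  proof -
    have "cinner (Y *\<^sub>V v) w - cinner (Y *\<^sub>V v') w' = cinner (Y *\<^sub>V (v - v')) w + cinner (Y *\<^sub>V v') (w - w')"
      by (simp add: bop_diff cinner.diff_left cinner.diff_right)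
    also have "cmod \<dots> \<le> cmod (cinner (Y *\<^sub>V (v - v')) w) + cmod (cinner (Y *\<^sub>V v') (w - w'))"
      by (rule norm_triangle_ineq)
    also have "\<dots> \<le> (c * norm (v - v')) * norm w + (c * norm v') * norm (w - w')"
      by (intro add_mono order_trans[OF norm_cinner_le] mult_right_mono bounded_byD[OF Y] norm_ge_zero)
    also have "\<dots> \<le> (c * d) * r + (c * r) * d"
      using v' w' nv nw c d r by (intro add_mono mult_mono) (auto simp: dist_norm norm_minus_commute)
    also have "\<dots> \<le> e / 3" using dr by (simp add: algebra_simps)
    finally show ?thesis .
  qed
  have "\<forall>\<^sub>F i in F. dist (cinner (X i *\<^sub>V v') w') (cinner (T *\<^sub>V v') w') < e / 3"
    using lim[OF v'(1) w'(1)] e by (intro tendstoD) auto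
  then show "\<forall>\<^sub>F i in F. dist (cinner (X i *\<^sub>V v) w) (cinner (T *\<^sub>V v) w) < e"
  proof eventually_elim
    case (elim i)
    let ?a = "cinner (X i *\<^sub>V v) w" and ?b = "cinner (T *\<^sub>V v) w"
      and ?a' = "cinner (X i *\<^sub>V v') w'" and ?b' = "cinner (T *\<^sub>V v') w'"
    have "dist ?a ?b \<le> cmod (?a - ?a') + cmod (?a' - ?b') + cmod (?b - ?b')"
      unfolding dist_norm using norm_triangle_ineq4[of "?a - ?a' + (?a' - ?b')" "?b - ?b'"]
        norm_triangle_ineq[of "?a - ?a'" "?a' - ?b'"] by simp
    then show ?case using close[OF bd(1)[of i]] close[OF bd(2)] elim by (simp add: dist_norm)
  qed
qed

section \<open>Positive forms and positive operators\<close>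

text \<open>
  Positive sesquilinear forms occur both as forms \<open>\<langle>T v, w\<rangle>\<close> of positive operators and as forms
  \<open>\<omega>(R\<^sup>* S)\<close> of states, and the second kind lives on a space of operators without inner product.
\<close>

locale positive_form =
  fixes b :: "'v::complex_vector \<Rightarrow> 'v \<Rightarrow> complex"
  assumes add_left: "b (u + v) w = b u w + b v w"
    and scaleC_left: "b (c *\<^sub>C v) w = c * b v w"
    and add_right: "b w (u + v) = b w u + b w v"
    and scaleC_right: "b w (c *\<^sub>C v) = cnj c * b w v"
    and nonneg: "b v v \<in> \<real>\<^sub>\<ge>\<^sub>0"
begin

lemma hermitian: "b w v = cnj (b v w)"
proof -
  have re: "Im (b x x) = 0" for x using nonneg[of x] by (simp add: complex_nonneg_Reals_iff)
  have "Im (b v w) + Im (b w v) = 0"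
    using re[of "v + w"] re[of v] re[of w] by (simp add: add_left add_right)
  moreover have "Re (b w v) - Re (b v w) = 0"
    using re[of "v + \<i> *\<^sub>C w"] re[of v] re[of w]
    by (simp add: add_left add_right scaleC_left scaleC_right)
  ultimately show ?thesis by (simp add: complex_eq_iff)
qed

text \<open>
  Expand the form at \<open>v - t z w\<close> with \<open>z = b v w\<close> and \<open>t\<close> real: a nonnegative quadratic polynomial
  in \<open>t\<close> whose value at \<open>t = 1 / b w w\<close> is the claim.  If \<open>b w w = 0\<close> the polynomial is affine, so
  its slope vanishes.
\<close>

lemma cauchy_schwarz: "(cmod (b v w))\<^sup>2 \<le> Re (b v v) * Re (b w w)"
proof -
  define z where "z = b v w"
  define s where "s = (cmod z)\<^sup>2"
  define A where "A = Re (b v v)"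
  define W where "W = Re (b w w)"
  have W0: "W \<ge> 0" and A0: "A \<ge> 0" using nonneg by (auto simp: W_def A_def complex_nonneg_Reals_iff)
  have zz: "z * cnj z = of_real s" by (simp add: s_def complex_norm_square[symmetric])
  have ww: "b w w = of_real W" using nonneg[of w] by (auto simp: W_def complex_nonneg_Reals_iff complex_eq_iff)
  have q: "0 \<le> A - 2 * t * s + t\<^sup>2 * s * W" for t :: real
  proof -
    let ?u = "v + (- (of_real t * z)) *\<^sub>C w"
    have "b ?u ?u = b v v - of_real t * (cnj z * z) - of_real t * (z * cnj z) + of_real (t\<^sup>2) * (z * cnj z) * b w w"
      by (simp add: add_left add_right scaleC_left scaleC_right hermitian[of w v] z_def[symmetric]
          algebra_simps power2_eq_square)
    also have "\<dots> = b v v - of_real t * of_real s - of_real t * of_real s + of_real (t\<^sup>2) * of_real s * of_real W"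
      by (simp only: ww zz mult.commute[of "cnj z" z])
    finally have "Re (b ?u ?u) = A - 2 * t * s + t\<^sup>2 * s * W"
      by (simp add: A_def)
    then show ?thesis using nonneg[of ?u] by (simp add: complex_nonneg_Reals_iff)
  qed
  have "s \<le> A * W"
  proof (cases "W = 0")
    case True
    have "s = 0"
    proof (rule ccontr)
      assume "s \<noteq> 0"
      then show False using q[of "(A + 1) / (2 * s)"] True A0 by (simp add: field_simps)
    qed
    then show ?thesis using True by simp
  next
    case False
    then have "W > 0" using W0 by simp
    then show ?thesis using q[of "1 / W"] by (simp add: field_simps power2_eq_square)
  qed
  then show ?thesis by (simp add: s_def z_def A_def W_def)
qed

end

lemma positive_op_form: "positive_op T \<Longrightarrow> positive_form (\<lambda>v w. cinner (T *\<^sub>V v) w)"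
  by unfold_locales
    (simp_all add: positive_op_def bop_add bop_scaleC cinner_add_left cinner_add_right
      cinner_scaleC_left cinner_scaleC_right)

lemma positive_op_Re: "positive_op T \<Longrightarrow> 0 \<le> Re (cinner (T *\<^sub>V v) v)"
  and positive_op_of_real: "positive_op T \<Longrightarrow> cinner (T *\<^sub>V v) v = of_real (Re (cinner (T *\<^sub>V v) v))"
  by (auto simp: positive_op_def complex_nonneg_Reals_iff complex_eq_iff)

lemma positive_opI:
  assumes "\<And>v. cinner (T *\<^sub>V v) v = of_real (f v)" "\<And>v. f v \<ge> 0"
  shows "positive_op T"
  using assms by (simp add: positive_op_def)

lemma positive_op_adj: "positive_op T \<Longrightarrow> adj T = (T::'a::chilbert_space bop)"
proof (rule adj_eqI)
  fix x y assume "positive_op T"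
  then interpret positive_form "\<lambda>v w. cinner (T *\<^sub>V v) w" by (rule positive_op_form)
  show "cinner (T *\<^sub>V x) y = cinner x (T *\<^sub>V y)"
    using hermitian[of x y] cinner_commute[of x "T *\<^sub>V y"] by simp
qed

lemma cinner_adj_times: "cinner ((adj T * T) *\<^sub>V v) v = of_real ((norm (T *\<^sub>V (v::'a::chilbert_space)))\<^sup>2)"
  by (simp add: cinner_self flip: cinner_adj')

lemma positive_op_adj_times: "positive_op (adj T * (T::'a::chilbert_space bop))"
  by (rule positive_opI[OF cinner_adj_times]) simp

lemma selfadj_cinner_real:
  assumes "adj T = (T::'a::chilbert_space bop)"
  shows "cinner (T *\<^sub>V v) v = of_real (Re (cinner (T *\<^sub>V v) v))"
proof -
  have "cinner (T *\<^sub>V v) v = cnj (cinner (T *\<^sub>V v) v)"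
    using cinner_adj[of T v v] cinner_commute[of v "T *\<^sub>V v"] assms by simp
  then show ?thesis by (simp add: complex_eq_iff)
qed

lemma positive_one_minus:
  assumes "adj T = (T::'a::chilbert_space bop)" "bounded_by 1 T"
  shows "positive_op (1 - T)"
proof (rule positive_opI)
  fix v
  show "cinner ((1 - T) *\<^sub>V v) v = of_real ((norm v)\<^sup>2 - Re (cinner (T *\<^sub>V v) v))"
    using selfadj_cinner_real[OF assms(1), of v] by (simp add: cinner.diff_left cinner_self)
  have "Re (cinner (T *\<^sub>V v) v) \<le> norm (T *\<^sub>V v) * norm v"
    using complex_Re_le_cmod norm_cinner_le order_trans by blast
  also have "\<dots> \<le> norm v * norm v"
    using bounded_byD[OF assms(2), of v] by (intro mult_right_mono) auto
  finally show "0 \<le> (norm v)\<^sup>2 - Re (cinner (T *\<^sub>V v) v)" by (simp add: power2_eq_square)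
qed

text \<open>
  The quadratic form of a positive operator controls its norm, by the Cauchy--Schwarz inequality
  for that form.
\<close>

lemma positive_op_bounded_by:
  assumes T: "positive_op T" and c: "c \<ge> 0" "\<And>v. Re (cinner (T *\<^sub>V v) v) \<le> c * (norm v)\<^sup>2"
  shows "bounded_by c T"
proof (rule bounded_byI_form[OF _ c(1)])
  fix v w
  interpret positive_form "\<lambda>v w. cinner (T *\<^sub>V v) w" using T by (rule positive_op_form)
  have "(cmod (cinner (T *\<^sub>V v) w))\<^sup>2 \<le> Re (cinner (T *\<^sub>V v) v) * Re (cinner (T *\<^sub>V w) w)"
    by (rule cauchy_schwarz)
  also have "\<dots> \<le> (c * (norm v)\<^sup>2) * (c * (norm w)\<^sup>2)"
    using c positive_op_Re[OF T] by (intro mult_mono) auto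
  also have "\<dots> = (c * norm v * norm w)\<^sup>2" by (simp add: power2_eq_square)
  finally show "cmod (cinner (T *\<^sub>V v) w) \<le> c * norm v * norm w"
    by (rule power2_le_imp_le) (use c(1) in simp)
qed

lemma positive_op_null:
  assumes T: "positive_op T" and "cinner (T *\<^sub>V v) v = 0"
  shows "T *\<^sub>V v = 0"
proof -
  interpret positive_form "\<lambda>v w. cinner (T *\<^sub>V v) w" using T by (rule positive_op_form)
  have "cinner (T *\<^sub>V v) w = 0" for w using cauchy_schwarz[of v w] assms(2) by simp
  from this[of "T *\<^sub>V v"] show ?thesis by (simp add: cinner_self)
qed

lemma bop_commute_apply: "S * T = T * S \<Longrightarrow> S *\<^sub>V T *\<^sub>V v = T *\<^sub>V S *\<^sub>V v"
  by (simp flip: bop_apply_simps(6))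

section \<open>Square roots, absolute values and the polar decomposition\<close>

lemma scaleR_times_bop:
  "(r *\<^sub>R S) * T = r *\<^sub>R (S * (T::'a::complex_inner bop))" "S * (r *\<^sub>R T) = r *\<^sub>R (S * T)"
  by (simp_all add: scaleR_bop_def scaleC_times_bop)

lemma bounded_by_scaleR: "bounded_by b T \<Longrightarrow> bounded_by (\<bar>r\<bar> * b) (r *\<^sub>R T)"
  unfolding scaleR_bop_def using bounded_by_scaleC[of b T "of_real r"] by simp

text \<open>
  The classical iteration for \<open>1 - \<surd>(1 - D)\<close>, with limit \<open>B\<close> determined by \<open>2 B = D + B\<^sup>2\<close>.
\<close>

primrec sqrt_iter :: "'a::complex_inner bop \<Rightarrow> nat \<Rightarrow> 'a bop" where
  "sqrt_iter D 0 = 0"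
| "sqrt_iter D (Suc n) = (1/2) *\<^sub>R (D + sqrt_iter D n * sqrt_iter D n)"

text \<open>
  The same iteration for the scalar \<open>D = 1\<close>; it increases to \<open>1\<close>.
\<close>

primrec sqrt_bound :: "nat \<Rightarrow> real" where
  "sqrt_bound 0 = 0"
| "sqrt_bound (Suc n) = (1 + sqrt_bound n * sqrt_bound n) / 2"

lemma sqrt_iter_commute:
  assumes "S * D = D * S"
  shows "S * sqrt_iter D n = sqrt_iter D n * S"
proof (induction n)
  case (Suc n)
  have "S * (sqrt_iter D n * sqrt_iter D n) = sqrt_iter D n * sqrt_iter D n * S"
    by (simp only: mult.assoc[symmetric] Suc) (simp only: mult.assoc Suc)
  then show ?case
    by (simp add: scaleR_times_bop distrib_left distrib_right assms)
qed simp

lemma sqrt_iter_adj: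
  "adj D = D \<Longrightarrow> adj (sqrt_iter D n) = sqrt_iter (D::'a::chilbert_space bop) n"
proof (induction n)
  case 0
  show ?case by (simp add: adj_eqI cinner.zero_left cinner.zero_right)
next
  case (Suc n)
  then show ?case by (simp add: adj_scaleR adj_add adj_times)
qed

lemma sqrt_bound_01: "0 \<le> sqrt_bound n \<and> sqrt_bound n \<le> 1"
proof (induction n)
  case (Suc n)
  then show ?case using mult_mono[of "sqrt_bound n" 1 "sqrt_bound n" 1] by simp
qed simp

lemma sqrt_bound_step:
  "sqrt_bound (Suc (Suc n)) - sqrt_bound (Suc n) =
     (1/2) * ((sqrt_bound (Suc n) - sqrt_bound n) * (sqrt_bound (Suc n) + sqrt_bound n))"
proof -
  define a where "a = sqrt_bound (Suc n)"
  define b where "b = sqrt_bound n"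
  have "sqrt_bound (Suc (Suc n)) = (1 + a * a) / 2" "a = (1 + b * b) / 2"
    by (simp_all add: a_def b_def)
  then have "sqrt_bound (Suc (Suc n)) - a = (1/2) * ((a - b) * (a + b))"
    by (simp add: algebra_simps add_divide_distrib diff_divide_distrib)
  then show ?thesis by (simp only: a_def b_def)
qed

lemma sqrt_iter_bounded: "bounded_by 1 D \<Longrightarrow> bounded_by (sqrt_bound n) (sqrt_iter D n)"
proof (induction n)
  case (Suc n)
  have "bounded_by (\<bar>1/2\<bar> * (1 + sqrt_bound n * sqrt_bound n)) (sqrt_iter D (Suc n))"
    unfolding sqrt_iter.simps
    using Suc sqrt_bound_01[of n] by (intro bounded_by_scaleR bounded_by_add bounded_by_times) auto
  then show ?case by simp
qed (simp add: bounded_by_zero)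

text \<open>
  The iterates are polynomials in \<open>D\<close>, so they commute and the difference of two squares factors.
  Hence each step is dominated by the same step of the scalar iteration with \<open>D = 1\<close>, which is
  increasing.
\<close>

lemma sqrt_iter_step_bounded:
  "bounded_by 1 D \<Longrightarrow> bounded_by (sqrt_bound (Suc n) - sqrt_bound n) (sqrt_iter D (Suc n) - sqrt_iter D n)
    \<and> sqrt_bound n \<le> sqrt_bound (Suc n)"
proof (induction n)
  case 0
  then show ?case using bounded_by_scaleR[of 1 D "1/2"] by simp
next
  case (Suc n)
  define X where "X = sqrt_iter D (Suc n)"
  define Y where "Y = sqrt_iter D n"
  define a where "a = sqrt_bound (Suc n)"
  define b where "b = sqrt_bound n"
  have "Y * D = D * Y" unfolding Y_def by (rule sqrt_iter_commute[symmetric]) simp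
  then have YX: "Y * X = X * Y" unfolding X_def by (rule sqrt_iter_commute)
  have X: "X = (1/2) *\<^sub>R (D + Y * Y)" by (simp add: X_def Y_def)
  have "sqrt_iter D (Suc (Suc n)) - X = (1/2) *\<^sub>R (D + X * X) - (1/2) *\<^sub>R (D + Y * Y)"
    unfolding X[symmetric] by (simp add: X_def)
  also have "\<dots> = (1/2) *\<^sub>R (X * X - Y * Y)"
    by (simp add: scaleR_diff_right[symmetric])
  also have "X * X - Y * Y = (X - Y) * (X + Y)"
    by (simp add: distrib_left left_diff_distrib YX)
  finally have eq: "sqrt_iter D (Suc (Suc n)) - X = (1/2) *\<^sub>R ((X - Y) * (X + Y))" .
  have IH: "bounded_by (a - b) (X - Y)" "b \<le> a"
    using Suc by (simp_all add: X_def Y_def a_def b_def del: sqrt_iter.simps sqrt_bound.simps)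
  have "bounded_by (a + b) (X + Y)"
    unfolding a_def b_def X_def Y_def using Suc.prems by (intro bounded_by_add sqrt_iter_bounded)
  then have bd: "bounded_by (\<bar>1/2\<bar> * ((a - b) * (a + b))) (sqrt_iter D (Suc (Suc n)) - X)"
    unfolding eq using IH by (intro bounded_by_scaleR bounded_by_times) auto
  have eq2: "sqrt_bound (Suc (Suc n)) - a = \<bar>1/2\<bar> * ((a - b) * (a + b))"
    using sqrt_bound_step[of n] by (simp add: a_def b_def del: sqrt_bound.simps)
  have "0 \<le> (a - b) * (a + b)"
    using IH sqrt_bound_01[of n] sqrt_bound_01[of "Suc n"] unfolding a_def b_def
    by (intro mult_nonneg_nonneg) (auto simp del: sqrt_bound.simps)
  then have "0 \<le> sqrt_bound (Suc (Suc n)) - a" unfolding eq2 by simp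
  then have "a \<le> sqrt_bound (Suc (Suc n))" by linarith
  then show ?case
    unfolding X_def[symmetric] a_def[symmetric] using bd[folded eq2] by blast
qed

lemma sqrt_iter_diff_bounded:
  assumes "bounded_by 1 D" "m \<le> n"
  shows "bounded_by (sqrt_bound n - sqrt_bound m) (sqrt_iter D n - sqrt_iter D m)"
  using assms(2)
proof (induction n rule: dec_induct)
  case base
  show ?case by (simp add: bounded_by_zero)
next
  case (step n)
  have "bounded_by ((sqrt_bound (Suc n) - sqrt_bound n) + (sqrt_bound n - sqrt_bound m))
      ((sqrt_iter D (Suc n) - sqrt_iter D n) + (sqrt_iter D n - sqrt_iter D m))"
    using sqrt_iter_step_bounded[OF assms(1), of n] step by (intro bounded_by_add) auto
  then show ?case by (simp del: sqrt_iter.simps sqrt_bound.simps)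
qed

text \<open>
  The scalar majorant converges, so the iterates form a Cauchy sequence at every vector.  Weak
  compactness supplies an operator, and it must be the strong limit.  The fixed point equation says
  that \<open>(1 - B)\<^sup>2 = 1 - D\<close>.
\<close>

lemma sqrt_iter_converges:
  fixes D :: "'a::chilbert_space bop"
  assumes D: "bounded_by 1 D" "adj D = D"
  obtains B where "bounded_by 1 B" "adj B = B" "2 *\<^sub>R B = D + B * B"
    "\<And>S. S * D = D * S \<Longrightarrow> S * B = B * S"
proof -
  let ?X = "sqrt_iter D"
  have X1: "bounded_by 1 (?X n)" for n
    using sqrt_iter_bounded[OF D(1)] sqrt_bound_01 bounded_by_mono by blast
  obtain G B where G: "G \<le> sequentially" "G \<noteq> bot" "wot_tendsto ?X B G" "bounded_by 1 B"
    by (rule bounded_ball_wot_compact[OF sequentially_bot X1]) (simp, rule that)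
  have "incseq sqrt_bound"
    using sqrt_iter_step_bounded[OF bounded_by_one] by (intro incseq_SucI) blast
  then obtain l where l: "sqrt_bound \<longlonglongrightarrow> l"
    by (rule incseq_convergent[of _ 1]) (use sqrt_bound_01 that in auto)
  have strong: "(\<lambda>n. ?X n *\<^sub>V v) \<longlonglongrightarrow> B *\<^sub>V v" for v
  proof -
    have "Cauchy (\<lambda>n. ?X n *\<^sub>V v)"
    proof (rule metric_CauchyI)
      fix e :: real assume e: "e > 0"
      define d where "d = e / (norm v + 1)"
      have d: "d > 0" using e by (simp add: d_def add_nonneg_pos)
      obtain N where N: "\<And>m n. m \<ge> N \<Longrightarrow> n \<ge> N \<Longrightarrow> dist (sqrt_bound m) (sqrt_bound n) < d"
        using metric_CauchyD[OF LIMSEQ_imp_Cauchy[OF l] d] by blast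
      have le: "dist (?X m *\<^sub>V v) (?X n *\<^sub>V v) < e" if "N \<le> m" "m \<le> n" for m n
      proof -
        have "norm ((?X n - ?X m) *\<^sub>V v) \<le> (sqrt_bound n - sqrt_bound m) * norm v"
          by (rule bounded_byD[OF sqrt_iter_diff_bounded[OF D(1) that(2)]])
        also have "\<dots> \<le> d * norm v"
          using N[of n m] that by (intro mult_right_mono) (auto simp: dist_real_def)
        also have "\<dots> < d * (norm v + 1)" using d by simp
        also have "\<dots> = e"
        proof -
          have "norm v + 1 \<noteq> 0" using norm_ge_zero[of v] by linarith
          then show ?thesis by (simp add: d_def)
        qed
        finally show ?thesis by (simp add: dist_norm norm_minus_commute)
      qed
      have "dist (?X m *\<^sub>V v) (?X n *\<^sub>V v) < e" if "m \<ge> N" "n \<ge> N" for m n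
        using le[of m n] le[of n m] that by (cases "m \<le> n") (auto simp: dist_commute)
      then show "\<exists>M. \<forall>m\<ge>M. \<forall>n\<ge>M. dist (?X m *\<^sub>V v) (?X n *\<^sub>V v) < e" by blast
    qed
    then obtain u where u: "(\<lambda>n. ?X n *\<^sub>V v) \<longlonglongrightarrow> u"
      using Cauchy_convergent convergent_def by blast
    have "u = B *\<^sub>V v"
    proof (rule cinner_ext, rule tendsto_unique[OF G(2)])
      fix w
      show "((\<lambda>n. cinner (?X n *\<^sub>V v) w) \<longlongrightarrow> cinner u w) G"
        by (rule tendsto_mono[OF G(1)]) (intro cinner.tendsto u tendsto_const)
      show "((\<lambda>n. cinner (?X n *\<^sub>V v) w) \<longlongrightarrow> cinner (B *\<^sub>V v) w) G"
        using G(3) by (simp add: wot_tendsto_def)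
    qed
    then show ?thesis using u by simp
  qed
  have sq: "(\<lambda>n. ?X n *\<^sub>V ?X n *\<^sub>V v) \<longlonglongrightarrow> B *\<^sub>V B *\<^sub>V v" for v
  proof -
    have "(\<lambda>n. ?X n *\<^sub>V (?X n *\<^sub>V v - B *\<^sub>V v)) \<longlonglongrightarrow> 0"
    proof (rule Lim_null_comparison)
      show "\<forall>\<^sub>F n in sequentially. norm (?X n *\<^sub>V (?X n *\<^sub>V v - B *\<^sub>V v)) \<le> norm (?X n *\<^sub>V v - B *\<^sub>V v)"
        using bounded_byD[OF X1] by simp
      show "(\<lambda>n. norm (?X n *\<^sub>V v - B *\<^sub>V v)) \<longlonglongrightarrow> 0"
        using strong[of v] by (simp add: LIM_zero tendsto_norm_zero)
    qed
    from tendsto_add[OF this strong[of "B *\<^sub>V v"]] show ?thesis by (simp add: bop_diff)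
  qed
  have eq: "2 *\<^sub>R B = D + B * B"
  proof (rule bop_eqI)
    fix v
    have "(\<lambda>n. 2 *\<^sub>R (?X (Suc n) *\<^sub>V v)) \<longlonglongrightarrow> 2 *\<^sub>R (B *\<^sub>V v)"
      by (intro tendsto_scaleR tendsto_const LIMSEQ_Suc strong)
    then have "(\<lambda>n. D *\<^sub>V v + ?X n *\<^sub>V ?X n *\<^sub>V v) \<longlonglongrightarrow> 2 *\<^sub>R (B *\<^sub>V v)" by simp
    moreover have "(\<lambda>n. D *\<^sub>V v + ?X n *\<^sub>V ?X n *\<^sub>V v) \<longlonglongrightarrow> D *\<^sub>V v + B *\<^sub>V B *\<^sub>V v"
      by (intro tendsto_add tendsto_const sq)
    ultimately show "(2 *\<^sub>R B) *\<^sub>V v = (D + B * B) *\<^sub>V v" 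
      using LIMSEQ_unique[of _ "2 *\<^sub>R (B *\<^sub>V v)"] by auto
  qed
  have adjB: "adj B = B"
  proof (rule adj_eqI)
    fix x y
    have "(\<lambda>n. cinner (?X n *\<^sub>V x) y) \<longlonglongrightarrow> cinner (B *\<^sub>V x) y"
      by (intro cinner.tendsto strong tendsto_const)
    moreover have "(\<lambda>n. cinner x (?X n *\<^sub>V y)) \<longlonglongrightarrow> cinner x (B *\<^sub>V y)"
      by (intro cinner.tendsto strong tendsto_const)
    ultimately show "cinner (B *\<^sub>V x) y = cinner x (B *\<^sub>V y)"
      using LIMSEQ_unique[of _ "cinner (B *\<^sub>V x) y"] by (simp add: cinner_adj[of "?X _"] sqrt_iter_adj[OF D(2)])
  qed
  have comm: "S * B = B * S" if "S * D = D * S" for S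
  proof (rule bop_eqI)
    fix v
    have "(\<lambda>n. S *\<^sub>V ?X n *\<^sub>V v) \<longlonglongrightarrow> S *\<^sub>V B *\<^sub>V v" by (intro bop_tendsto strong)
    moreover have "S *\<^sub>V ?X n *\<^sub>V v = ?X n *\<^sub>V S *\<^sub>V v" for n
      by (rule bop_commute_apply[OF sqrt_iter_commute[OF that]])
    ultimately show "(S * B) *\<^sub>V v = (B * S) *\<^sub>V v"
      using LIMSEQ_unique[of _ "S *\<^sub>V B *\<^sub>V v", OF _ strong[of "S *\<^sub>V v"]] by simp
  qed
  show ?thesis by (rule that[OF G(4) adjB eq comm])
qed

text \<open>
  Rescale to \<open>0 \<le> A / c \<le> 1\<close> and apply the iteration to \<open>D = 1 - A / c\<close>.  The commutation clause
  is what later places the square root inside a von Neumann algebra.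
\<close>

lemma positive_sqrt_exists:
  fixes A :: "'a::chilbert_space bop"
  assumes A: "positive_op A"
  obtains R where "positive_op R" "R * R = A" "\<And>S. S * A = A * S \<Longrightarrow> S * R = R * S"
proof -
  obtain c0 where c0: "c0 \<ge> 0" "bounded_by c0 A" by (rule ex_bounded_by)
  define c where "c = c0 + 1"
  have c: "c > 0" "bounded_by c A" using c0 bounded_by_mono[of c0 A c] by (auto simp: c_def)
  define D where "D = 1 - (1/c) *\<^sub>R A"
  have adjA: "adj A = A" using A by (rule positive_op_adj)
  have A1: "bounded_by 1 ((1/c) *\<^sub>R A)" using bounded_by_scaleR[OF c(2), of "1/c"] c(1) by simp
  have Dpos: "positive_op D"
    unfolding D_def by (rule positive_one_minus[OF _ A1]) (simp add: adj_scaleR adjA)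
  have adjD: "adj D = D" using Dpos by (rule positive_op_adj)
  have "bounded_by 1 D"
  proof (rule positive_op_bounded_by[OF Dpos])
    show "Re (cinner (D *\<^sub>V v) v) \<le> 1 * (norm v)\<^sup>2" for v
      using positive_op_Re[OF A, of v] c(1)
      by (simp add: D_def cinner.diff_left cinner_scaleR_left cinner_self)
  qed simp
  then obtain B where B: "bounded_by 1 B" "adj B = B" "2 *\<^sub>R B = D + B * B"
    "\<And>S. S * D = D * S \<Longrightarrow> S * B = B * S"
    using adjD by (rule sqrt_iter_converges) (rule that)
  define R where "R = sqrt c *\<^sub>R (1 - B)"
  have "positive_op (1 - B)" using B by (intro positive_one_minus)
  then have Rpos: "positive_op R"
    unfolding positive_op_def R_def using c(1)
    by (auto simp: cinner_scaleR_left complex_nonneg_Reals_iff)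
  have "(1 - B) * (1 - B) = 1 - 2 *\<^sub>R B + B * B"
    by (simp add: algebra_simps scaleR_2)
  also have "\<dots> = (1/c) *\<^sub>R A" by (simp add: B(3)) (simp add: D_def)
  finally have RR: "R * R = A" using c(1) by (simp add: R_def scaleR_times_bop)
  have "S * R = R * S" if "S * A = A * S" for S
  proof -
    have "S * D = D * S" by (simp add: D_def algebra_simps scaleR_times_bop that)
    then have "S * B = B * S" by (rule B(4))
    then show ?thesis by (simp add: R_def scaleR_times_bop algebra_simps)
  qed
  then show ?thesis using that[OF Rpos RR] by blast
qed

text \<open>
  Both roots commute with the root \<open>R\<close> that commutes with everything commuting with \<open>B * B\<close>, so
  \<open>(R + S) (R - S) = 0\<close>.  With \<open>w = (R - S) v\<close> this makes the nonnegative numbers \<open>\<langle>R w, w\<rangle>\<close> and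
  \<open>\<langle>S w, w\<rangle>\<close> vanish, hence \<open>R w = S w = 0\<close> and \<open>\<parallel>w\<parallel>\<^sup>2 = \<langle>(R - S) w, v\<rangle> = 0\<close>.
\<close>

lemma positive_sqrt_unique:
  fixes B C :: "'a::chilbert_space bop"
  assumes B: "positive_op B" and C: "positive_op C" and eq: "B * B = C * C"
  shows "B = C"
proof -
  have BB: "positive_op (B * B)" using positive_op_adj_times[of B] positive_op_adj[OF B] by simp
  obtain R where R: "positive_op R" "R * R = B * B" "\<And>S. S * (B * B) = (B * B) * S \<Longrightarrow> S * R = R * S"
    by (rule positive_sqrt_exists[OF BB]) (rule that)
  have main: "R = S" if S: "positive_op S" "S * S = B * B" for S
  proof (rule bop_eqI)
    fix v
    have SR: "S * R = R * S" by (rule R(3)) (simp add: mult.assoc flip: S(2))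
    define w where "w = (R - S) *\<^sub>V v"
    have "(R + S) * (R - S) = 0" by (simp add: algebra_simps SR R(2) S(2))
    then have "((R + S) * (R - S)) *\<^sub>V v = 0" by (simp only: bop_apply_simps(1))
    then have "((R + S) * (R - S)) *\<^sub>V v = 0" by (simp only: bop_apply_simps(1))
    then have "(R + S) *\<^sub>V w = 0" by (simp only: bop_apply_simps(6) w_def)
    then have "cinner (R *\<^sub>V w) w + cinner (S *\<^sub>V w) w = 0"
      using cinner_add_left[of "R *\<^sub>V w" "S *\<^sub>V w" w] by (simp add: cinner.zero_left)
    moreover have "Re (cinner (R *\<^sub>V w) w) \<ge> 0" "Re (cinner (S *\<^sub>V w) w) \<ge> 0"
      using R(1) S(1) by (simp_all add: positive_op_Re)
    ultimately have "Re (cinner (R *\<^sub>V w) w) = 0" "Re (cinner (S *\<^sub>V w) w) = 0"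
      by (simp_all add: complex_eq_iff)
    then have "cinner (R *\<^sub>V w) w = 0" "cinner (S *\<^sub>V w) w = 0"
      using positive_op_of_real[OF R(1), of w] positive_op_of_real[OF S(1), of w] by simp_all
    then have "(R - S) *\<^sub>V w = 0"
      using positive_op_null[OF R(1), of w] positive_op_null[OF S(1), of w] by simp
    then have 0: "cinner ((R - S) *\<^sub>V w) v = 0" by (simp only: cinner.zero_left)
    have "adj (R - S) = R - S" using R(1) S(1) by (simp add: adj_diff positive_op_adj)
    then have "cinner w w = 0"
      using cinner_adj[of "R - S" w v] 0 by (simp only: w_def[symmetric])
    then show "R *\<^sub>V v = S *\<^sub>V v" by (simp add: cinner_self w_def)
  qed
  show ?thesis using main[OF B refl] main[OF C eq[symmetric]] by simp
qed

lemma abs_op_props: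
  fixes A :: "'a::chilbert_space bop"
  shows positive_abs_op: "positive_op (abs_op A)"
    and abs_op_square: "abs_op A * abs_op A = adj A * A"
proof -
  obtain R where R: "positive_op R" "R * R = adj A * A"
    by (rule positive_sqrt_exists[OF positive_op_adj_times[of A]]) (rule that)
  then have "\<exists>!B. positive_op B \<and> B * B = adj A * A"
    by (intro ex1I[of _ R]) (simp_all add: positive_sqrt_unique)
  from theI'[OF this] show "positive_op (abs_op A)" "abs_op A * abs_op A = adj A * A"
    unfolding abs_op_def by auto
qed

lemma abs_op_positive: "positive_op A \<Longrightarrow> abs_op A = (A::'a::chilbert_space bop)"
  using positive_sqrt_unique[OF positive_abs_op, of A A] abs_op_square[of A] positive_op_adj[of A] by simp

lemma sqrt_commute:
  fixes R :: "'a::chilbert_space bop"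
  assumes R: "positive_op R" and S: "S * (R * R) = (R * R) * S"
  shows "S * R = R * S"
proof -
  have RR: "positive_op (R * R)" using positive_op_adj_times[of R] positive_op_adj[OF R] by simp
  obtain R' where R': "positive_op R'" "R' * R' = R * R" "\<And>S. S * (R * R) = (R * R) * S \<Longrightarrow> S * R' = R' * S"
    by (rule positive_sqrt_exists[OF RR]) (rule that)
  have eq: "R' = R" by (rule positive_sqrt_unique[OF R'(1) R R'(2)])
  show ?thesis using R'(3)[OF S] unfolding eq .
qed

lemma norm_abs_op: "norm (abs_op C *\<^sub>V v) = norm (C *\<^sub>V (v::'a::chilbert_space))"
proof -
  have "adj (abs_op C) * abs_op C = adj C * C"
    by (simp add: positive_op_adj[OF positive_abs_op] abs_op_square)
  then have "complex_of_real ((norm (abs_op C *\<^sub>V v))\<^sup>2) = of_real ((norm (C *\<^sub>V v))\<^sup>2)"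
    using cinner_adj_times[of "abs_op C" v] cinner_adj_times[of C v] by simp
  then show ?thesis unfolding of_real_eq_iff by simp
qed

text \<open>
  Since \<open>s = |C|\<close> satisfies \<open>\<parallel>s v\<parallel> = \<parallel>C v\<parallel>\<close>, the assignment \<open>s v + k \<mapsto> C v\<close>, for \<open>k\<close> in the kernel of
  \<open>s\<close>, is a well defined contraction on a dense subspace.  An operator commuting with \<open>C\<close> and its
  adjoint commutes with \<open>s\<close> and therefore with the extension \<open>U\<close>; this puts \<open>U\<close> into every von
  Neumann algebra containing \<open>C\<close>.
\<close>

lemma polar_decomposition:
  fixes C :: "'a::chilbert_space bop"
  obtains U where "bounded_by 1 U" "C = U * abs_op C" "abs_op C = adj U * C"
    "\<And>T. T * C = C * T \<Longrightarrow> T * adj C = adj C * T \<Longrightarrow> T * U = U * T"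
proof -
  define s where "s = abs_op C"
  have adjs: "adj s = s" unfolding s_def by (rule positive_op_adj[OF positive_abs_op])
  have ns: "norm (s *\<^sub>V v) = norm (C *\<^sub>V v)" for v by (simp add: s_def norm_abs_op)
  define D where "D = {s *\<^sub>V v + k | v k. s *\<^sub>V k = 0}"
  have D_add: "x + y \<in> D" if xD: "x \<in> D" "y \<in> D" for x y
  proof -
    obtain v k v' k' where "x = s *\<^sub>V v + k" "s *\<^sub>V k = 0" "y = s *\<^sub>V v' + k'" "s *\<^sub>V k' = 0"
      using xD by (auto simp: D_def)
    then have "x + y = s *\<^sub>V (v + v') + (k + k')" "s *\<^sub>V (k + k') = 0" by (simp_all add: bop_add)
    then show ?thesis unfolding D_def by blast
  qed
  have D_sc: "c *\<^sub>C x \<in> D" if xD: "x \<in> D" for c x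
  proof -
    obtain v k where "x = s *\<^sub>V v + k" "s *\<^sub>V k = 0" using xD by (auto simp: D_def)
    then have "c *\<^sub>C x = s *\<^sub>V (c *\<^sub>C v) + c *\<^sub>C k" "s *\<^sub>V (c *\<^sub>C k) = 0"
      by (simp_all add: bop_scaleC scaleC_add_right)
    then show ?thesis unfolding D_def by blast
  qed
  have ranD: "s *\<^sub>V v \<in> D" for v unfolding D_def by (simp, intro exI[of _ v] exI[of _ 0]) simp
  have kerD: "k \<in> D" if "s *\<^sub>V k = 0" for k
    unfolding D_def using that by (simp, intro exI[of _ 0] exI[of _ k]) simp
  have dense: "closure D = UNIV"
  proof (rule dense_if_orthogonal_complement_trivial)
    show "0 \<in> D" by (rule kerD) simp
    fix x assume o: "\<And>v. v \<in> D \<Longrightarrow> cinner v x = 0"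
    have "cinner (s *\<^sub>V s *\<^sub>V x) x = 0" by (rule o[OF ranD])
    then have "cinner (s *\<^sub>V x) (s *\<^sub>V x) = 0" using cinner_adj[of s "s *\<^sub>V x" x] adjs by simp
    then have "s *\<^sub>V x = 0" by (simp add: cinner_self)
    then have "cinner x x = 0" by (intro o kerD)
    then show "x = 0" by (simp add: cinner_self)
  qed (use D_add D_sc in auto)
  have orth: "cinner (s *\<^sub>V v) k = 0" if "s *\<^sub>V k = 0" for v k
    using cinner_adj[of s v k] adjs that by (simp add: cinner.zero_right)
  have pyth: "norm (s *\<^sub>V v) \<le> norm (s *\<^sub>V v + k)" if "s *\<^sub>V k = 0" for v k
  proof -
    have "inner (s *\<^sub>V v) k = 0" using orth[OF that, of v] by (simp add: inner_eq_Re_cinner)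
    then have "(norm (s *\<^sub>V v + k))\<^sup>2 = (norm (s *\<^sub>V v))\<^sup>2 + (norm k)\<^sup>2"
      by (simp add: power2_norm_eq_inner inner_add_left inner_add_right inner_commute)
    then have "(norm (s *\<^sub>V v))\<^sup>2 \<le> (norm (s *\<^sub>V v + k))\<^sup>2" by simp
    then show ?thesis by (rule power2_le_imp_le) simp
  qed
  \<comment> \<open>The choice of \<open>v\<close> does not matter, because its ambiguity lies in the kernel of \<open>s\<close> and so of \<open>C\<close>.\<close>
  define f where "f x = C *\<^sub>V (SOME v. s *\<^sub>V (x - s *\<^sub>V v) = 0)" for x
  have f: "f (s *\<^sub>V v + k) = C *\<^sub>V v" if "s *\<^sub>V k = 0" for v k
  proof -
    let ?x = "s *\<^sub>V v + k"
    define w where "w = (SOME w. s *\<^sub>V (?x - s *\<^sub>V w) = 0)"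
    have "s *\<^sub>V (?x - s *\<^sub>V w) = 0" unfolding w_def by (rule someI[of _ v]) (simp add: that)
    then have "s *\<^sub>V (k + s *\<^sub>V (v - w)) = 0" by (simp add: bop_add bop_diff algebra_simps)
    then have k2: "s *\<^sub>V s *\<^sub>V (v - w) = 0" using that by (simp add: bop_add)
    have "norm (s *\<^sub>V (v - w)) \<le> norm (s *\<^sub>V (v - w) + - (s *\<^sub>V (v - w)))"
      by (rule pyth) (simp add: bop_minus k2)
    then have "norm (C *\<^sub>V (v - w)) = 0" by (simp flip: ns)
    then have "C *\<^sub>V v = C *\<^sub>V w" by (simp add: bop_diff)
    moreover have "f ?x = C *\<^sub>V w" by (simp only: f_def w_def)
    ultimately show ?thesis by simp
  qed
  obtain U where U: "\<And>x. x \<in> D \<Longrightarrow> U *\<^sub>V x = f x" "bounded_by 1 U"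
  proof (rule bop_from_dense[of D "\<lambda>x. x" f 1])
    show "closure ((\<lambda>x. x) ` D) = UNIV" using dense by simp
    show "f (x + y) = f x + f y" if xD: "x \<in> D" "y \<in> D" for x y
    proof -
      obtain v k v' k' where *: "x = s *\<^sub>V v + k" "s *\<^sub>V k = 0" "y = s *\<^sub>V v' + k'" "s *\<^sub>V k' = 0"
        using xD by (auto simp: D_def)
      then have "x + y = s *\<^sub>V (v + v') + (k + k')" "s *\<^sub>V (k + k') = 0" by (simp_all add: bop_add)
      then have "f (x + y) = C *\<^sub>V (v + v')" by (simp only: f)
      then show ?thesis using f[OF *(2), of v] f[OF *(4), of v'] * by (simp add: bop_add)
    qed
    show "f (c *\<^sub>C x) = c *\<^sub>C f x" if xD: "x \<in> D" for c x
    proof -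
      obtain v k where *: "x = s *\<^sub>V v + k" "s *\<^sub>V k = 0" using xD by (auto simp: D_def)
      then have "c *\<^sub>C x = s *\<^sub>V (c *\<^sub>C v) + c *\<^sub>C k" "s *\<^sub>V (c *\<^sub>C k) = 0"
        by (simp_all add: bop_scaleC scaleC_add_right)
      then have "f (c *\<^sub>C x) = C *\<^sub>V (c *\<^sub>C v)" by (simp only: f)
      then show ?thesis using f[OF *(2), of v] * by (simp add: bop_scaleC)
    qed
    show "norm (f x) \<le> 1 * norm x" if xD: "x \<in> D" for x
    proof -
      obtain v k where *: "x = s *\<^sub>V v + k" "s *\<^sub>V k = 0" using xD by (auto simp: D_def)
      then show ?thesis using f[OF *(2), of v] pyth[OF *(2), of v] by (simp flip: ns)
    qed
  qed (use D_add D_sc in auto)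
  have Us: "U *\<^sub>V s *\<^sub>V v = C *\<^sub>V v" for v
    using U(1)[OF ranD] f[of 0 v] by simp
  have Uk: "U *\<^sub>V k = 0" if "s *\<^sub>V k = 0" for k
    using U(1)[OF kerD[OF that]] f[OF that, of 0] by simp
  have ss: "s * s = adj C * C" by (simp add: s_def abs_op_square)
  have CC: "cinner (C *\<^sub>V v) (C *\<^sub>V w) = cinner (s *\<^sub>V v) (s *\<^sub>V w)" for v w
    using cinner_adj'[of "C *\<^sub>V v" C w] cinner_adj'[of "s *\<^sub>V v" s w]
      arg_cong[OF ss, of "\<lambda>X. X *\<^sub>V v"] adjs by simp
  have "C = U * abs_op C" by (rule bop_eqI) (simp add: Us flip: s_def)
  moreover have "abs_op C = adj U * C"
  proof (rule bop_eqI, rule cinner_ext_dense[OF dense])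
    fix v y assume "y \<in> D"
    then obtain w k where y: "y = s *\<^sub>V w + k" "s *\<^sub>V k = 0" by (auto simp: D_def)
    have "cinner ((adj U * C) *\<^sub>V v) y = cinner (C *\<^sub>V v) (U *\<^sub>V y)" by (simp add: cinner_adj)
    also have "U *\<^sub>V y = C *\<^sub>V w" by (simp add: y bop_add Us Uk)
    also have "cinner (C *\<^sub>V v) (C *\<^sub>V w) = cinner (s *\<^sub>V v) y"
      by (simp add: CC y cinner_add_right orth)
    finally show "cinner (abs_op C *\<^sub>V v) y = cinner ((adj U * C) *\<^sub>V v) y" by (simp add: s_def)
  qed
  moreover have "T * U = U * T" if T: "T * C = C * T" "T * adj C = adj C * T" for T
  proof -
    have "T * (adj C * C) = adj C * (T * C)" by (simp only: mult.assoc[symmetric] T(2))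
    also have "\<dots> = (adj C * C) * T" by (simp only: mult.assoc T(1))
    finally have "T * (s * s) = (s * s) * T" by (simp only: ss)
    then have "T * s = s * T" unfolding s_def by (rule sqrt_commute[OF positive_abs_op])
    then have Ts: "T *\<^sub>V s *\<^sub>V v = s *\<^sub>V T *\<^sub>V v" for v by (rule bop_commute_apply)
    have TC: "T *\<^sub>V C *\<^sub>V v = C *\<^sub>V T *\<^sub>V v" for v using T(1) by (rule bop_commute_apply)
    have eqD: "T *\<^sub>V U *\<^sub>V x = U *\<^sub>V T *\<^sub>V x" if xD: "x \<in> D" for x
    proof -
      obtain v k where *: "x = s *\<^sub>V v + k" "s *\<^sub>V k = 0" using xD by (auto simp: D_def)
      have "s *\<^sub>V T *\<^sub>V k = 0" using Ts[of k] * by simp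
      then show ?thesis by (simp add: * bop_add Us Uk Ts TC)
    qed
    show ?thesis
    proof (rule bop_eqI)
      fix x
      obtain y where y: "\<And>n. y n \<in> D" "y \<longlonglongrightarrow> x"
        using dense closure_sequential[of x D] by auto
      have "(\<lambda>n. T *\<^sub>V U *\<^sub>V y n) \<longlonglongrightarrow> T *\<^sub>V U *\<^sub>V x" "(\<lambda>n. U *\<^sub>V T *\<^sub>V y n) \<longlonglongrightarrow> U *\<^sub>V T *\<^sub>V x"
        by (intro bop_tendsto y)+
      then show "(T * U) *\<^sub>V x = (U * T) *\<^sub>V x" 
        using LIMSEQ_unique[of _ "T *\<^sub>V U *\<^sub>V x"] eqD[OF y(1)] by simp
    qed
  qed
  ultimately show ?thesis using that[OF U(2)] by blast
qed

section \<open>Orthonormal bases\<close>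

lemma onb_exists: "\<exists>E :: 'a::complex_inner set. is_onb E"
proof -
  define on :: "'a set \<Rightarrow> bool" where
    "on E \<longleftrightarrow> (\<forall>e\<in>E. \<forall>f\<in>E. cinner e f = (if e = f then 1 else 0))" for E
  have "\<exists>M\<in>Collect on. \<forall>X\<in>Collect on. M \<subseteq> X \<longrightarrow> X = M"
  proof (rule subset_Zorn')
    fix C assume C: "subset.chain (Collect on) C"
    have "cinner e f = (if e = f then 1 else 0)" if ef: "e \<in> \<Union>C" "f \<in> \<Union>C" for e f
    proof -
      obtain X Y where XY: "X \<in> C" "e \<in> X" "Y \<in> C" "f \<in> Y" using ef by blast
      then have "X \<subseteq> Y \<or> Y \<subseteq> X" "on X" "on Y" using C unfolding subset.chain_def by blast+
      then show ?thesis using XY unfolding on_def by blast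
    qed
    then show "\<Union>C \<in> Collect on" by (simp add: on_def)
  qed
  then obtain M where M: "on M" "\<And>X. on X \<Longrightarrow> M \<subseteq> X \<Longrightarrow> X = M" by blast
  have "x = 0" if x: "\<forall>e\<in>M. cinner x e = 0" for x
  proof (rule ccontr)
    assume x0: "x \<noteq> 0"
    define u where "u = inverse (norm x) *\<^sub>R x"
    have uu: "cinner u u = 1" using x0 by (simp add: u_def cinner_self)
    have ue: "cinner u e = 0" "cinner e u = 0" if "e \<in> M" for e
    proof -
      show "cinner u e = 0" using x that by (simp add: u_def cinner_scaleR_left)
      then show "cinner e u = 0" using cinner_commute[of e u] by simp
    qed
    have "u \<notin> M" using ue uu by force
    have "on (insert u M)" using M(1) uu ue \<open>u \<notin> M\<close> by (auto simp: on_def)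
    then have "insert u M = M" using M(2) by blast
    then show False using \<open>u \<notin> M\<close> by blast
  qed
  then have "is_onb M" using M(1) unfolding is_onb_def on_def by blast
  then show ?thesis by (rule exI[of _ M])
qed

lemma is_onb_some_onb: "is_onb some_onb"
  unfolding some_onb_def by (rule someI_ex[of is_onb, OF onb_exists])

lemma onb_expansion_finite:
  fixes F :: "'a::complex_inner set"
  assumes E: "is_onb E" and F: "finite F" "F \<subseteq> E"
  defines "q \<equiv> \<lambda>y. \<Sum>e\<in>F. cinner y e *\<^sub>C e"
  shows "norm (q y) \<le> norm y" "e \<in> F \<Longrightarrow> q e = e"
proof -
  have on: "cinner e f = (if e = f then 1 else 0)" if "e \<in> E" "f \<in> E" for e f
    using E that by (auto simp: is_onb_def)
  have qe: "cinner (q y) f = cinner y f" if f: "f \<in> F" for f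
  proof -
    have "cinner (q y) f = (\<Sum>e\<in>F. cinner y e * cinner e f)"
      by (simp add: q_def cinner.sum_left cinner_scaleC_left)
    also have "\<dots> = (\<Sum>e\<in>F. if e = f then cinner y e else 0)"
      using F f by (intro sum.cong) (auto simp: on subset_iff)
    finally show ?thesis using F f by simp
  qed
  have "cinner (q y) (q y) = (\<Sum>e\<in>F. cnj (cinner y e) * cinner (q y) e)"
    by (subst (2) q_def) (simp add: cinner.sum_right cinner_scaleC_right)
  also have "\<dots> = (\<Sum>e\<in>F. cnj (cinner y e) * cinner y e)" by (simp add: qe)
  also have "\<dots> = cinner y (q y)" by (simp add: q_def cinner.sum_right cinner_scaleC_right)
  finally have "complex_of_real ((norm (q y))\<^sup>2) = cinner y (q y)" by (simp only: cinner_self)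
  then have "(norm (q y))\<^sup>2 = cmod (cinner y (q y))" by (metis norm_of_real abs_power2)
  also have "\<dots> \<le> norm y * norm (q y)" by (rule norm_cinner_le)
  finally show "norm (q y) \<le> norm y"
    by (cases "q y = 0") (simp_all add: power2_eq_square)
  assume e: "e \<in> F"
  have "q e = (\<Sum>f\<in>F. if f = e then e else 0)"
    unfolding q_def using F e by (intro sum.cong) (auto simp: on subset_iff)
  then show "q e = e" using F e by simp
qed

text \<open>
  The vectors reproduced by all large finite partial expansions form a dense subspace, and the
  partial expansions are contractions.
\<close>

lemma onb_expansion:
  fixes E :: "'a::chilbert_space set"
  assumes E: "is_onb E"
  shows "((\<lambda>e. cinner x e *\<^sub>C e) has_sum x) E"
proof -
  define q where "q F y = (\<Sum>e\<in>F. cinner y e *\<^sub>C e)" for F and y :: 'a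
  define V where "V = {y. \<exists>F0. finite F0 \<and> F0 \<subseteq> E \<and> (\<forall>F. finite F \<and> F0 \<subseteq> F \<and> F \<subseteq> E \<longrightarrow> q F y = y)}"
  have qadd: "q F (y + z) = q F y + q F z" for F y z
    by (simp add: q_def cinner_add_left scaleC_add_left sum.distrib)
  have qsc: "q F (c *\<^sub>C y) = c *\<^sub>C q F y" for F c y
    by (simp add: q_def cinner_scaleC_left scaleC_sum_right scaleC_scaleC)
  have qdiff: "q F (y - z) = q F y - q F z" for F y z
    using qadd[of F y "- z"] qsc[of F "-1" z] by (simp add: scaleC_minus_one)
  have EV: "e \<in> V" if "e \<in> E" for e
    unfolding V_def mem_Collect_eq
    by (rule exI[of _ "{e}"]) (use that onb_expansion_finite(2)[OF E] in \<open>auto simp: q_def\<close>)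
  have dense: "closure V = UNIV"
  proof (rule dense_if_orthogonal_complement_trivial)
    show "0 \<in> V" unfolding V_def by (auto simp: q_def cinner.zero_left intro: exI[of _ "{}"])
    show "y + z \<in> V" if yz: "y \<in> V" "z \<in> V" for y z
    proof -
      obtain F1 F2 where "finite F1" "F1 \<subseteq> E" "\<forall>F. finite F \<and> F1 \<subseteq> F \<and> F \<subseteq> E \<longrightarrow> q F y = y"
        "finite F2" "F2 \<subseteq> E" "\<forall>F. finite F \<and> F2 \<subseteq> F \<and> F \<subseteq> E \<longrightarrow> q F z = z"
        using yz unfolding V_def by blast
      then show ?thesis unfolding V_def by (intro CollectI exI[of _ "F1 \<union> F2"]) (simp add: qadd)
    qed
    show "c *\<^sub>C y \<in> V" if yV: "y \<in> V" for c y
    proof -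
      obtain F0 where "finite F0" "F0 \<subseteq> E" "\<forall>F. finite F \<and> F0 \<subseteq> F \<and> F \<subseteq> E \<longrightarrow> q F y = y"
        using yV unfolding V_def by blast
      then show ?thesis unfolding V_def by (intro CollectI exI[of _ F0]) (simp add: qsc)
    qed
    fix x assume o: "\<And>v. v \<in> V \<Longrightarrow> cinner v x = 0"
    have "cinner x e = 0" if "e \<in> E" for e
      using o[OF EV[OF that]] cinner_commute[of x e] by simp
    then show "x = 0" using E by (simp add: is_onb_def)
  qed
  show ?thesis
    unfolding has_sum_def q_def[symmetric]
  proof (rule tendstoI)
    fix e :: real assume e: "e > 0"
    have "x \<in> closure V" using dense by simp
    then obtain y where y: "y \<in> V" "dist y x < e / 2"
      using e by (meson closure_approachable half_gt_zero)
    obtain F0 where F0: "finite F0" "F0 \<subseteq> E" "\<forall>F. finite F \<and> F0 \<subseteq> F \<and> F \<subseteq> E \<longrightarrow> q F y = y"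
      using y(1) unfolding V_def by blast
    have "dist (q F x) x < e" if F: "finite F" "F0 \<subseteq> F" "F \<subseteq> E" for F
    proof -
      have "norm (q F (x - y)) \<le> norm (x - y)"
        unfolding q_def by (rule onb_expansion_finite(1)[OF E F(1,3)])
      moreover have eq: "q F x - x = q F (x - y) + (y - x)"
        using F0(3) F by (simp add: qdiff)
      ultimately have "norm (q F x - x) \<le> norm (x - y) + norm (y - x)"
        unfolding eq using norm_triangle_ineq[of "q F (x - y)" "y - x"] by linarith
      then show ?thesis using y(2) by (simp add: dist_norm norm_minus_commute)
    qed
    then show "\<forall>\<^sub>F F in finite_subsets_at_top E. dist (q F x) x < e"
      unfolding eventually_finite_subsets_at_top using F0(1,2) by blast
  qed
qed

lemma parseval:
  fixes E :: "'a::chilbert_space set"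
  assumes "is_onb E"
  shows "((\<lambda>e. cinner x e * cinner e y) has_sum cinner x y) E"
  using has_sum_bounded_linear[OF cinner.bounded_linear_left[of y] onb_expansion[OF assms, of x]]
  by (simp add: cinner_scaleC_left)

lemma parseval_norm:
  fixes E :: "'a::chilbert_space set"
  assumes "is_onb E"
  shows "((\<lambda>e. (cmod (cinner x e))\<^sup>2) has_sum (norm x)\<^sup>2) E"
proof -
  have "((\<lambda>e. complex_of_real ((cmod (cinner x e))\<^sup>2)) has_sum of_real ((norm x)\<^sup>2)) E"
    using parseval[OF assms, of x x] by (simp only: cmod_sq_cinner cinner_self)
  then show ?thesis by (simp only: has_sum_of_real_iff)
qed

section \<open>Pairings of square summable families\<close>

lemma pairing_le:
  assumes T: "bounded_by c T" and c: "c \<ge> 0"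
  shows "cmod (cinner (T *\<^sub>V v) w) \<le> c * ((norm v)\<^sup>2 + (norm w)\<^sup>2) / 2"
proof -
  have "cmod (cinner (T *\<^sub>V v) w) \<le> (c * norm v) * norm w"
    by (intro order_trans[OF norm_cinner_le] mult_right_mono bounded_byD[OF T] norm_ge_zero)
  also have "\<dots> = c * (norm v * norm w)" by simp
  also have "\<dots> \<le> c * (((norm v)\<^sup>2 + (norm w)\<^sup>2) / 2)"
    using sum_squares_bound[of "norm v" "norm w"] c by (intro mult_left_mono) auto
  finally show ?thesis by simp
qed

context
  fixes f g :: "'i \<Rightarrow> 'a::chilbert_space" and E :: "'i set" and Sf Sg :: real
  assumes f: "((\<lambda>e. (norm (f e))\<^sup>2) has_sum Sf) E" and g: "((\<lambda>e. (norm (g e))\<^sup>2) has_sum Sg) E"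
begin

lemma pairing_dominating: "((\<lambda>e. c * ((norm (f e))\<^sup>2 + (norm (g e))\<^sup>2) / 2) has_sum (c * (Sf + Sg) / 2)) E"
  using has_sum_cmult_right[OF has_sum_add[OF f g], of "c / 2"] by simp

lemma pairing_abs_summable:
  assumes "bounded_by c T" "c \<ge> 0"
  shows "(\<lambda>e. norm (cinner (T *\<^sub>V f e) (g e))) summable_on E"
  by (rule summable_on_comparison_test[OF has_sum_imp_summable[OF pairing_dominating[of c]]])
    (use pairing_le[OF assms] in auto)

lemma pairing_bound:
  assumes "bounded_by c T" "c \<ge> 0"
  shows "cmod (\<Sum>\<^sub>\<infinity>e\<in>E. cinner (T *\<^sub>V f e) (g e)) \<le> c * (Sf + Sg) / 2"
  by (rule norm_infsum_le[OF has_sum_infsum[OF abs_summable_summable[OF pairing_abs_summable[OF assms]]]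
      pairing_dominating]) (rule pairing_le[OF assms])

text \<open>
  All but finitely many terms are dominated, uniformly in the operator, by the tail of a convergent
  series, and each single term converges.  This is the source of every normality statement below.
\<close>

lemma pairing_wot_continuous:
  assumes X: "\<forall>\<^sub>F i in F. bounded_by c (X i)" "bounded_by c T" "c \<ge> 0" and lim: "wot_tendsto X T F"
  shows "((\<lambda>i. \<Sum>\<^sub>\<infinity>e\<in>E. cinner (X i *\<^sub>V f e) (g e)) \<longlongrightarrow> (\<Sum>\<^sub>\<infinity>e\<in>E. cinner (T *\<^sub>V f e) (g e))) F"
proof (rule tendstoI)
  fix r :: real assume r: "r > 0"
  define h where "h e = c * ((norm (f e))\<^sup>2 + (norm (g e))\<^sup>2) / 2" for e
  define S where "S = c * (Sf + Sg) / 2"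
  have h: "(h has_sum S) E" unfolding h_def S_def by (rule pairing_dominating)
  have h0: "h e \<ge> 0" for e using X(3) by (simp add: h_def)
  obtain K where K: "finite K" "K \<subseteq> E" "dist (sum h K) S \<le> r / 4"
    using has_sum_finite_approximation[OF h, of "r / 4"] r by auto
  have tail: "cmod ((\<Sum>\<^sub>\<infinity>e\<in>E. cinner (Y *\<^sub>V f e) (g e)) - (\<Sum>e\<in>K. cinner (Y *\<^sub>V f e) (g e))) \<le> r / 4"
    if Y: "bounded_by c Y" for Y
  proof -
    let ?k = "\<lambda>e. cinner (Y *\<^sub>V f e) (g e)"
    have k: "?k summable_on E" by (rule abs_summable_summable[OF pairing_abs_summable[OF Y X(3)]])
    have "(?k has_sum (infsum ?k E - sum ?k K)) (E - K)"
      using has_sum_Diff[OF has_sum_infsum[OF k] has_sum_finite[OF K(1)] K(2)] .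
    moreover have "(h has_sum (S - sum h K)) (E - K)"
      using has_sum_Diff[OF h has_sum_finite[OF K(1)] K(2)] .
    ultimately have "cmod (infsum ?k E - sum ?k K) \<le> S - sum h K"
      by (rule norm_infsum_le) (use pairing_le[OF Y X(3)] in \<open>simp add: h_def\<close>)
    also have "\<dots> \<le> r / 4" using K(3) unfolding dist_real_def by linarith
    finally show ?thesis .
  qed
  have "((\<lambda>i. \<Sum>e\<in>K. cinner (X i *\<^sub>V f e) (g e)) \<longlongrightarrow> (\<Sum>e\<in>K. cinner (T *\<^sub>V f e) (g e))) F"
    using lim by (intro tendsto_sum) (simp add: wot_tendsto_def)
  then have "\<forall>\<^sub>F i in F. dist (\<Sum>e\<in>K. cinner (X i *\<^sub>V f e) (g e)) (\<Sum>e\<in>K. cinner (T *\<^sub>V f e) (g e)) < r / 4"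
    using r by (intro tendstoD) auto
  with X(1) show "\<forall>\<^sub>F i in F. dist (\<Sum>\<^sub>\<infinity>e\<in>E. cinner (X i *\<^sub>V f e) (g e)) (\<Sum>\<^sub>\<infinity>e\<in>E. cinner (T *\<^sub>V f e) (g e)) < r"
  proof eventually_elim
    case (elim i)
    let ?a = "\<Sum>\<^sub>\<infinity>e\<in>E. cinner (X i *\<^sub>V f e) (g e)" and ?b = "\<Sum>\<^sub>\<infinity>e\<in>E. cinner (T *\<^sub>V f e) (g e)"
    let ?a' = "\<Sum>e\<in>K. cinner (X i *\<^sub>V f e) (g e)" and ?b' = "\<Sum>e\<in>K. cinner (T *\<^sub>V f e) (g e)"
    have "cmod (?a - ?b) \<le> cmod (?a - ?a') + cmod (?a' - ?b') + cmod (?b - ?b')"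
      using norm_triangle_ineq4[of "?a - ?a' + (?a' - ?b')" "?b - ?b'"]
        norm_triangle_ineq[of "?a - ?a'" "?a' - ?b'"] by simp
    then show ?case using tail[OF elim(1)] tail[OF X(2)] elim(2) r unfolding dist_norm by linarith
  qed
qed

end

section \<open>Hilbert--Schmidt operators\<close>

definition hilbert_schmidt :: "'a::chilbert_space bop \<Rightarrow> bool" where
  "hilbert_schmidt B \<longleftrightarrow> (\<lambda>e. (norm (B *\<^sub>V e))\<^sup>2) summable_on some_onb"

lemma hilbert_schmidt_matrix:
  fixes B :: "'a::chilbert_space bop"
  assumes "hilbert_schmidt B"
  shows "(\<lambda>p. (cmod (cinner (B *\<^sub>V fst p) (snd p)))\<^sup>2) summable_on some_onb \<times> some_onb"
  using parseval_norm[OF is_onb_some_onb] assms unfolding hilbert_schmidt_def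
  by (intro summable_on_SigmaI[where g = "\<lambda>e. (norm (B *\<^sub>V e))\<^sup>2"]) auto

lemma cinner_swap_adj: "cinner (B *\<^sub>V e) g = cnj (cinner (adj B *\<^sub>V g) (e::'a::chilbert_space))"
  by (subst cinner_commute) (simp add: cinner_adj' flip: cinner_adj)

lemma hilbert_schmidt_adj:
  fixes B :: "'a::chilbert_space bop"
  assumes "hilbert_schmidt B"
  shows "hilbert_schmidt (adj B)"
proof -
  obtain S where S: "((\<lambda>p. (cmod (cinner (B *\<^sub>V fst p) (snd p)))\<^sup>2) has_sum S) (some_onb \<times> some_onb)"
    using hilbert_schmidt_matrix[OF assms] by (auto simp: summable_on_def)
  have "((\<lambda>p. (cmod (cinner (B *\<^sub>V snd p) (fst p)))\<^sup>2) has_sum S) (some_onb \<times> some_onb)"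
    using S by (subst (asm) has_sum_swap) (simp add: case_prod_unfold)
  then have "((\<lambda>g. (norm (adj B *\<^sub>V g))\<^sup>2) has_sum S) some_onb"
  proof (rule has_sum_SigmaD)
    fix g :: 'a
    show "((\<lambda>e. (cmod (cinner (B *\<^sub>V snd (g, e)) (fst (g, e))))\<^sup>2) has_sum (norm (adj B *\<^sub>V g))\<^sup>2) some_onb"
      using parseval_norm[OF is_onb_some_onb, of "adj B *\<^sub>V g"] by (simp add: cinner_swap_adj[of B])
  qed
  then show ?thesis unfolding hilbert_schmidt_def by (rule has_sum_imp_summable)
qed

lemma hilbert_schmidt_times_left:
  assumes "hilbert_schmidt B"
  shows "hilbert_schmidt (T * B)"
proof -
  obtain c where c: "c \<ge> 0" "bounded_by c T" by (rule ex_bounded_by)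
  show ?thesis unfolding hilbert_schmidt_def
  proof (rule summable_on_comparison_test)
    show "(\<lambda>e. c\<^sup>2 * (norm (B *\<^sub>V e))\<^sup>2) summable_on some_onb"
      using assms unfolding hilbert_schmidt_def by (rule summable_on_cmult_right)
    show "(norm ((T * B) *\<^sub>V e))\<^sup>2 \<le> c\<^sup>2 * (norm (B *\<^sub>V e))\<^sup>2" for e
      using power_mono[OF bounded_byD[OF c(2), of "B *\<^sub>V e"], of 2] by (simp add: power_mult_distrib)
  qed simp
qed

lemma hilbert_schmidt_times_right:
  fixes B :: "'a::chilbert_space bop"
  assumes "hilbert_schmidt B"
  shows "hilbert_schmidt (B * T)"
  using hilbert_schmidt_adj[OF hilbert_schmidt_times_left[OF hilbert_schmidt_adj[OF assms], of "adj T"]]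
  by (simp add: adj_times)

text \<open>
  Both sums are iterated sums of the same absolutely convergent double series of matrix entries.
\<close>

lemma hilbert_schmidt_pairing_adj:
  fixes S R :: "'a::chilbert_space bop"
  assumes S: "hilbert_schmidt S" and R: "hilbert_schmidt R"
  obtains z where "((\<lambda>e. cinner (S *\<^sub>V e) (R *\<^sub>V e)) has_sum z) some_onb"
    "((\<lambda>e. cinner (adj R *\<^sub>V e) (adj S *\<^sub>V e)) has_sum z) some_onb"
proof -
  let ?E = "some_onb :: 'a set"
  let ?F = "\<lambda>p. cinner (S *\<^sub>V fst p) (snd p) * cinner (snd p) (R *\<^sub>V fst p)"
  have sm: "(\<lambda>p. (cmod (cinner (S *\<^sub>V fst p) (snd p)))\<^sup>2 + (cmod (cinner (R *\<^sub>V fst p) (snd p)))\<^sup>2)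
      summable_on ?E \<times> ?E"
    by (rule summable_on_add[OF hilbert_schmidt_matrix[OF S] hilbert_schmidt_matrix[OF R]])
  have "(\<lambda>p. norm (?F p)) summable_on ?E \<times> ?E"
  proof (rule summable_on_comparison_test[OF sm])
    fix p :: "'a \<times> 'a"
    define a where "a = cmod (cinner (S *\<^sub>V fst p) (snd p))"
    define b where "b = cmod (cinner (R *\<^sub>V fst p) (snd p))"
    have b': "cmod (cinner (snd p) (R *\<^sub>V fst p)) = b"
      unfolding b_def by (subst cinner_commute) simp
    have ab: "0 \<le> a" "0 \<le> b" by (simp_all add: a_def b_def)
    have "a * b \<le> a\<^sup>2 + b\<^sup>2"
      using sum_squares_bound[of a b] mult_nonneg_nonneg[OF ab] by linarith
    then show "norm (?F p) \<le> (cmod (cinner (S *\<^sub>V fst p) (snd p)))\<^sup>2 + (cmod (cinner (R *\<^sub>V fst p) (snd p)))\<^sup>2"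
      unfolding norm_mult b' a_def[symmetric] b_def[symmetric] .
  qed simp
  then have "?F summable_on ?E \<times> ?E" by (rule abs_summable_summable)
  then obtain z where z: "(?F has_sum z) (?E \<times> ?E)" by (auto simp: summable_on_def)
  have 1: "((\<lambda>e. cinner (S *\<^sub>V e) (R *\<^sub>V e)) has_sum z) ?E"
    by (rule has_sum_SigmaD[OF z]) (use parseval[OF is_onb_some_onb] in simp)
  have "((\<lambda>p. cinner (S *\<^sub>V snd p) (fst p) * cinner (fst p) (R *\<^sub>V snd p)) has_sum z) (?E \<times> ?E)"
    using z by (subst (asm) has_sum_swap) (simp add: case_prod_unfold)
  then have 2: "((\<lambda>g. cinner (adj R *\<^sub>V g) (adj S *\<^sub>V g)) has_sum z) ?E"
  proof (rule has_sum_SigmaD)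
    fix g :: 'a
    have "cinner (S *\<^sub>V e) g * cinner g (R *\<^sub>V e) = cinner (adj R *\<^sub>V g) e * cinner e (adj S *\<^sub>V g)" for e
      by (simp add: cinner_adj[of S] cinner_adj'[of g R])
    then show "((\<lambda>e. cinner (S *\<^sub>V snd (g, e)) (fst (g, e)) * cinner (fst (g, e)) (R *\<^sub>V snd (g, e))) has_sum
        cinner (adj R *\<^sub>V g) (adj S *\<^sub>V g)) ?E"
      using parseval[OF is_onb_some_onb, of "adj R *\<^sub>V g" "adj S *\<^sub>V g"] by simp
  qed
  show ?thesis by (rule that[OF 1 2])
qed

section \<open>The trace\<close>

text \<open>
  A form of cyclicity of the trace that is general enough for all uses: a product containing the
  trace class operator \<open>B * B\<close> is rewritten as a pairing of Hilbert--Schmidt columns in which the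
  outer factors appear only through \<open>Y * X\<close>.
\<close>

lemma trace_sandwich:
  fixes B :: "'a::chilbert_space bop"
  assumes B: "hilbert_schmidt B" "adj B = B"
  shows "((\<lambda>e. cinner ((X * (B * B) * Y) *\<^sub>V e) e) has_sum
     (\<Sum>\<^sub>\<infinity>e\<in>some_onb. cinner ((Y * X) *\<^sub>V B *\<^sub>V e) (B *\<^sub>V e))) some_onb"
proof -
  obtain z where z: "((\<lambda>e. cinner ((B * Y) *\<^sub>V e) ((B * adj X) *\<^sub>V e)) has_sum z) some_onb"
    "((\<lambda>e. cinner (adj (B * adj X) *\<^sub>V e) (adj (B * Y) *\<^sub>V e)) has_sum z) some_onb"
    by (rule hilbert_schmidt_pairing_adj[OF hilbert_schmidt_times_right[OF B(1)] hilbert_schmidt_times_right[OF B(1)]])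
      (rule that)
  have "cinner ((B * Y) *\<^sub>V e) ((B * adj X) *\<^sub>V e) = cinner ((X * (B * B) * Y) *\<^sub>V e) e" for e
    by (simp add: cinner_adj[of X] cinner_adj[of B "B *\<^sub>V Y *\<^sub>V e"] B(2))
  moreover have "cinner (adj (B * adj X) *\<^sub>V e) (adj (B * Y) *\<^sub>V e) = cinner ((Y * X) *\<^sub>V B *\<^sub>V e) (B *\<^sub>V e)" for e
    by (simp add: adj_times B(2) cinner_adj[of Y])
  ultimately show ?thesis using z by (simp add: infsumI)
qed

lemma trace_class_factorization:
  fixes A :: "'a::chilbert_space bop"
  assumes "trace_class A"
  obtains R where "positive_op R" "adj R = R" "R * R = abs_op A" "hilbert_schmidt R"
    "((\<lambda>e. (norm (R *\<^sub>V e))\<^sup>2) has_sum trace_norm A) some_onb"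
proof -
  obtain R where R: "positive_op R" "R * R = abs_op A"
    by (rule positive_sqrt_exists[OF positive_abs_op[of A]]) (rule that)
  have adjR: "adj R = R" using R(1) by (rule positive_op_adj)
  have eq: "cinner (abs_op A *\<^sub>V e) e = complex_of_real ((norm (R *\<^sub>V e))\<^sup>2)" for e
    using cinner_adj_times[of R e] by (simp add: adjR flip: R(2))
  have "((\<lambda>e. complex_of_real ((norm (R *\<^sub>V e))\<^sup>2)) has_sum trace (abs_op A)) some_onb"
    using has_sum_infsum[OF assms[unfolded trace_class_def]] unfolding trace_def eq .
  then have hs: "((\<lambda>e. (norm (R *\<^sub>V e))\<^sup>2) has_sum trace_norm A) some_onb"
    using has_sum_Re unfolding trace_norm_def by fastforce
  show ?thesis
    by (rule that[OF R(1) adjR R(2) _ hs]) (use hs in \<open>auto simp: hilbert_schmidt_def summable_on_def\<close>)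
qed

text \<open>
  With the polar decomposition \<open>A = U |A|\<close> and \<open>|A| = R\<^sup>2\<close>, the functional \<open>T \<mapsto> trace (A * T)\<close> becomes a
  pairing of square summable families, to which the estimates above apply.
\<close>

lemma trace_class_trace_times:
  fixes A :: "'a::chilbert_space bop"
  assumes "trace_class A"
  obtains U R where "bounded_by 1 U" "((\<lambda>e. (norm (R *\<^sub>V e))\<^sup>2) has_sum trace_norm A) some_onb"
    "\<And>T. trace (A * T) = (\<Sum>\<^sub>\<infinity>e\<in>some_onb. cinner ((T * U) *\<^sub>V R *\<^sub>V e) (R *\<^sub>V e))"
proof -
  obtain R where R: "positive_op R" "adj R = R" "R * R = abs_op A" "hilbert_schmidt R"
    "((\<lambda>e. (norm (R *\<^sub>V e))\<^sup>2) has_sum trace_norm A) some_onb"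
    by (rule trace_class_factorization[OF assms]) (rule that)
  obtain U where U: "bounded_by 1 U" "A = U * abs_op A"
    by (rule polar_decomposition[of A]) (rule that)
  have "trace (A * T) = (\<Sum>\<^sub>\<infinity>e\<in>some_onb. cinner ((T * U) *\<^sub>V R *\<^sub>V e) (R *\<^sub>V e))" for T
  proof -
    have "A * T = U * (R * R) * T" using U(2) R(3) by simp
    then show ?thesis
      unfolding trace_def using infsumI[OF trace_sandwich[OF R(4,2), of U T]] by simp
  qed
  then show ?thesis using that[OF U(1) R(5)] by blast
qed

lemma trace_times_bound:
  fixes A :: "'a::chilbert_space bop"
  assumes "trace_class A" and T: "bounded_by c T" "c \<ge> 0"
  shows "cmod (trace (A * T)) \<le> c * trace_norm A"
proof -
  obtain U R where U: "bounded_by 1 U" and R: "((\<lambda>e. (norm (R *\<^sub>V e))\<^sup>2) has_sum trace_norm A) some_onb"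
    and tr: "\<And>T. trace (A * T) = (\<Sum>\<^sub>\<infinity>e\<in>some_onb. cinner ((T * U) *\<^sub>V R *\<^sub>V e) (R *\<^sub>V e))"
    by (rule trace_class_trace_times[OF assms(1)]) (rule that)
  have "bounded_by c (T * U)" using bounded_by_times[OF T(1) U T(2)] by simp
  from pairing_bound[OF R R this T(2)] show ?thesis by (simp add: tr)
qed

lemma trace_times_wot_continuous:
  fixes A :: "'a::chilbert_space bop"
  assumes "trace_class A" and X: "\<forall>\<^sub>F i in F. bounded_by c (X i)" "bounded_by c T" "c \<ge> 0"
    and lim: "wot_tendsto X T F"
  shows "((\<lambda>i. trace (A * X i)) \<longlongrightarrow> trace (A * T)) F"
proof -
  obtain U R where U: "bounded_by 1 U" and R: "((\<lambda>e. (norm (R *\<^sub>V e))\<^sup>2) has_sum trace_norm A) some_onb"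
    and tr: "\<And>T. trace (A * T) = (\<Sum>\<^sub>\<infinity>e\<in>some_onb. cinner ((T * U) *\<^sub>V R *\<^sub>V e) (R *\<^sub>V e))"
    by (rule trace_class_trace_times[OF assms(1)]) (rule that)
  have bd: "bounded_by c (Y * U)" if "bounded_by c Y" for Y
    using bounded_by_times[OF that U X(3)] by simp
  have "\<forall>\<^sub>F i in F. bounded_by c (X i * U)" using X(1) by (rule eventually_mono) (rule bd)
  from pairing_wot_continuous[OF R R this bd[OF X(2)] X(3) wot_tendsto_times(2)[OF lim]]
  show ?thesis by (simp only: tr)
qed

lemma positive_trace_class_has_sum:
  fixes A :: "'a::chilbert_space bop"
  assumes A: "positive_op A" "trace_class A"
  shows "((\<lambda>e. cinner ((X * A * Y) *\<^sub>V e) e) has_sum trace (A * (Y * X))) some_onb"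
proof -
  obtain B where B: "positive_op B" "adj B = B" "B * B = abs_op A" "hilbert_schmidt B"
    "((\<lambda>e. (norm (B *\<^sub>V e))\<^sup>2) has_sum trace_norm A) some_onb"
    by (rule trace_class_factorization[OF A(2)]) (rule that)
  have BB: "B * B = A" using B(3) abs_op_positive[OF A(1)] by simp
  have "trace (A * (Y * X)) = (\<Sum>\<^sub>\<infinity>e\<in>some_onb. cinner ((Y * X) *\<^sub>V B *\<^sub>V e) (B *\<^sub>V e))"
    unfolding trace_def using infsumI[OF trace_sandwich[OF B(4,2), of 1 "Y * X"]] by (simp add: BB)
  then show ?thesis using trace_sandwich[OF B(4,2), of X Y] by (simp only: BB)
qed

lemma has_sum_diff:
  fixes f g :: "'i \<Rightarrow> complex"
  assumes "(f has_sum a) E" "(g has_sum b) E"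
  shows "((\<lambda>e. f e - g e) has_sum (a - b)) E"
  using has_sum_add[OF assms(1) has_sum_uminusI[OF assms(2)]] by simp

lemma positive_trace_diff:
  fixes A :: "'a::chilbert_space bop"
  assumes A: "positive_op A" "trace_class A"
  shows "trace (A * (S - T)) = trace (A * S) - trace (A * T)"
proof -
  have "((\<lambda>e. cinner ((1 * A * S) *\<^sub>V e) e - cinner ((1 * A * T) *\<^sub>V e) e) has_sum
      (trace (A * (S * 1)) - trace (A * (T * 1)))) some_onb"
    by (rule has_sum_diff[OF positive_trace_class_has_sum[OF A] positive_trace_class_has_sum[OF A]])
  then show ?thesis by (subst trace_def) (simp add: bop_diff cinner.diff_left infsumI)
qed

text \<open>
  With a left factor \<open>V\<close> and a right factor \<open>T\<close>, because the instance with \<open>V\<close> from the polar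
  decomposition gives the trace norm of the commutator and the instance with \<open>T\<close> its dual pairing.
\<close>

lemma trace_commutator_times:
  fixes A :: "'a::chilbert_space bop"
  assumes A: "positive_op A" "trace_class A"
  shows "((\<lambda>e. cinner ((V * (X * A - A * X) * T) *\<^sub>V e) e) has_sum trace (A * ((T * V) * X - X * (T * V)))) some_onb"
proof -
  have "((\<lambda>e. cinner (((V * X) * A * T) *\<^sub>V e) e - cinner ((V * A * (X * T)) *\<^sub>V e) e) has_sum
      (trace (A * (T * (V * X))) - trace (A * ((X * T) * V)))) some_onb"
    by (rule has_sum_diff[OF positive_trace_class_has_sum[OF A] positive_trace_class_has_sum[OF A]])
  then show ?thesis
    by (simp add: positive_trace_diff[OF A] mult.assoc bop_diff cinner.diff_left)
qed

lemma trace_commutator: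
  fixes A :: "'a::chilbert_space bop"
  assumes A: "positive_op A" "trace_class A"
  shows "trace ((X * A - A * X) * T) = trace (A * (T * X - X * T))"
  using infsumI[OF trace_commutator_times[OF A, of 1 X T]] by (simp add: trace_def)

text \<open>
  The contraction \<open>V\<close> is the adjoint of the partial isometry in the polar decomposition of the
  commutator \<open>C\<close>, so that \<open>|C| = V C\<close>: the supremum defining the trace norm by duality is attained.
\<close>

lemma trace_norm_commutator:
  fixes A :: "'a::chilbert_space bop"
  assumes A: "positive_op A" "trace_class A"
  obtains V where "bounded_by 1 V" "trace_class (X * A - A * X)"
    "complex_of_real (trace_norm (X * A - A * X)) = trace (A * (V * X - X * V))"
proof -
  let ?C = "X * A - A * X"
  obtain U where U: "bounded_by 1 U" "abs_op ?C = adj U * ?C"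
    by (rule polar_decomposition[of ?C]) (rule that)
  have "((\<lambda>e. cinner (abs_op ?C *\<^sub>V e) e) has_sum trace (A * (adj U * X - X * adj U))) some_onb"
    using trace_commutator_times[OF A, of "adj U" X 1] by (simp add: U(2))
  then have tc: "trace_class ?C" and tr: "trace (abs_op ?C) = trace (A * (adj U * X - X * adj U))"
    by (auto simp: trace_class_def trace_def[of "abs_op ?C"] infsumI has_sum_imp_summable)
  obtain R where R: "((\<lambda>e. (norm (R *\<^sub>V e))\<^sup>2) has_sum trace_norm ?C) some_onb" "R * R = abs_op ?C" "adj R = R"
    by (rule trace_class_factorization[OF tc]) (rule that)
  have "((\<lambda>e. complex_of_real ((norm (R *\<^sub>V e))\<^sup>2)) has_sum of_real (trace_norm ?C)) some_onb"
    using R(1) by (simp only: has_sum_of_real_iff)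
  moreover have "cinner (abs_op ?C *\<^sub>V e) e = complex_of_real ((norm (R *\<^sub>V e))\<^sup>2)" for e
    using cinner_adj_times[of R e] by (simp add: R(3) flip: R(2))
  ultimately have "trace (abs_op ?C) = of_real (trace_norm ?C)" by (simp add: trace_def infsumI)
  then show ?thesis using that[OF bounded_by_adj[OF U(1)] tc] tr by simp
qed

section \<open>Normal functionals and density operators\<close>

text \<open>
  Continuity in the weak operator topology on bounded sets.  Normal functionals have this property,
  and it is the form of normality that passes from a hyperstate to its map and to the powers of that map.
  Convergence of filters on the type of operators itself covers nets of every index type.
\<close>

definition wot_normal_on :: "'a::complex_inner bop set \<Rightarrow> ('a bop \<Rightarrow> complex) \<Rightarrow> bool" where
  "wot_normal_on S \<omega> \<longleftrightarrow> (\<forall>F c T. c \<ge> 0 \<longrightarrow> bounded_by c T \<longrightarrow> T \<in> S \<longrightarrow>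
     (\<forall>\<^sub>F X in F. bounded_by c X \<and> X \<in> S) \<longrightarrow> wot_tendsto (\<lambda>X. X) T F \<longrightarrow> (\<omega> \<longlongrightarrow> \<omega> T) F)"

lemma wot_normal_onD:
  assumes "wot_normal_on S \<omega>" and c: "c \<ge> 0" "bounded_by c T" "T \<in> S"
    and X: "\<forall>\<^sub>F i in G. bounded_by c (X i) \<and> X i \<in> S" "wot_tendsto X T G"
  shows "((\<lambda>i. \<omega> (X i)) \<longlongrightarrow> \<omega> T) G"
proof -
  have "\<forall>\<^sub>F Y in filtermap X G. bounded_by c Y \<and> Y \<in> S" using X(1) by (simp add: eventually_filtermap)
  moreover have "wot_tendsto (\<lambda>Y. Y) T (filtermap X G)"
    using X(2) by (simp add: wot_tendsto_def filterlim_filtermap)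
  ultimately have "(\<omega> \<longlongrightarrow> \<omega> T) (filtermap X G)"
    using assms(1) c unfolding wot_normal_on_def by blast
  then show ?thesis by (simp add: filterlim_filtermap)
qed

lemma trace_class_zero: "trace_class (0::'a::chilbert_space bop)"
proof -
  have "positive_op (0::'a bop)" by (simp add: positive_op_def cinner.zero_left)
  then show ?thesis by (simp add: trace_class_def abs_op_positive cinner.zero_left)
qed

lemma topspace_ultraweak_topology: "topspace (ultraweak_topology :: 'a::chilbert_space bop topology) = UNIV"
proof -
  have "UNIV = {T :: 'a bop. trace (0 * T) \<in> UNIV}" by simp
  then have "(UNIV :: 'a bop set) \<in> {{T. trace (A * T) \<in> U} | A U. trace_class A \<and> open U}"
    using trace_class_zero by blast
  then show ?thesis
    unfolding ultraweak_topology_def topology_generated_by_topspace by blast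
qed

text \<open>
  On bounded sets weak operator convergence implies ultraweak convergence; it suffices to check the
  sets that generate the ultraweak topology.
\<close>

lemma eventually_in_ultraweak_open:
  fixes T :: "'a::chilbert_space bop"
  assumes W: "openin ultraweak_topology W" "T \<in> W"
    and F: "c \<ge> 0" "bounded_by c T" "\<forall>\<^sub>F X in F. bounded_by c X" "wot_tendsto (\<lambda>X. X) T F"
  shows "\<forall>\<^sub>F X in F. X \<in> W"
proof -
  have "generate_topology_on {{T :: 'a bop. trace (A * T) \<in> U} | A U. trace_class A \<and> open U} W"
    using W(1) unfolding ultraweak_topology_def openin_topology_generated_by_iff .
  then have "T \<in> W \<longrightarrow> (\<forall>\<^sub>F X in F. X \<in> W)"
  proof induction
    case Empty
    show ?case by simp
  next
    case (Int a b)
    then show ?case by (auto intro: eventually_conj)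
  next
    case (UN K)
    show ?case
    proof
      assume "T \<in> \<Union>K"
      then obtain k where k: "k \<in> K" "T \<in> k" by blast
      then have "\<forall>\<^sub>F X in F. X \<in> k" using UN by blast
      then show "\<forall>\<^sub>F X in F. X \<in> \<Union>K" by (rule eventually_mono) (use k in blast)
    qed
  next
    case (Basis s)
    then obtain A U where s: "s = {T. trace (A * T) \<in> U}" "trace_class A" "open U" by blast
    have "((\<lambda>X. trace (A * X)) \<longlongrightarrow> trace (A * T)) F"
      by (rule trace_times_wot_continuous[OF s(2) F(3,2,1,4)])
    then show ?case using s by (auto dest: topological_tendstoD)
  qed
  then show ?thesis using W(2) by blast
qed

lemma normal_on_imp_wot_normal_on:
  fixes \<omega> :: "'a::chilbert_space bop \<Rightarrow> complex"
  assumes "normal_on S \<omega>"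
  shows "wot_normal_on S \<omega>"
  unfolding wot_normal_on_def
proof (intro allI impI topological_tendstoI)
  fix F c T and U :: "complex set"
  assume c: "c \<ge> 0" "bounded_by c T" and T: "T \<in> S" and X: "\<forall>\<^sub>F X in F. bounded_by c X \<and> X \<in> S"
    and lim: "wot_tendsto (\<lambda>X. X) T F" and U: "open U" "\<omega> T \<in> U"
  have "openin (subtopology ultraweak_topology S) {X \<in> topspace (subtopology ultraweak_topology S). \<omega> X \<in> U}"
    using assms U(1) unfolding normal_on_def by (intro openin_continuous_map_preimage) auto
  then have "openin (subtopology ultraweak_topology S) {X \<in> S. \<omega> X \<in> U}"
    by (simp add: topspace_ultraweak_topology)
  then obtain W where W: "openin ultraweak_topology W" "{X \<in> S. \<omega> X \<in> U} = W \<inter> S"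
    unfolding openin_subtopology by blast
  have "\<forall>\<^sub>F X in F. X \<in> W"
    using W U(2) T X lim c
    by (intro eventually_in_ultraweak_open[of W T c F]) (auto elim: eventually_mono)
  with X show "\<forall>\<^sub>F X in F. \<omega> X \<in> U"
    by eventually_elim (use W(2) in blast)
qed

definition rank_one :: "'a::complex_inner \<Rightarrow> 'a \<Rightarrow> 'a bop" where
  "rank_one v w = Bop (\<lambda>x. cinner x w *\<^sub>C v)"

lemma rank_one_apply [simp]: "rank_one v w *\<^sub>V x = cinner x w *\<^sub>C (v::'a::complex_inner)"
proof -
  have "bounded_linear (\<lambda>x. cinner x w *\<^sub>C v)"
  proof (rule bounded_linear_intro)
    show "cinner (x + y) w *\<^sub>C v = cinner x w *\<^sub>C v + cinner y w *\<^sub>C v" for x y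
      by (simp add: cinner_add_left scaleC_add_left)
    show "cinner (r *\<^sub>R x) w *\<^sub>C v = r *\<^sub>R (cinner x w *\<^sub>C v)" for r x
      by (simp only: cinner_scaleR_left scaleC_scaleC[symmetric] scaleC_of_real)
    show "norm (cinner x w *\<^sub>C v) \<le> norm x * (norm w * norm v)" for x
      using mult_right_mono[OF norm_cinner_le[of x w] norm_ge_zero[of v]]
      by (simp add: norm_scaleC mult.assoc)
  qed
  then show ?thesis
    unfolding rank_one_def by (subst Bop_inverse) (simp_all add: cinner_scaleC_left scaleC_scaleC)
qed

lemma rank_one_bounded: "bounded_by (norm v * norm w) (rank_one v w)"
  unfolding bounded_by_def
proof
  fix x
  show "norm (rank_one v w *\<^sub>V x) \<le> norm v * norm w * norm x"
    using mult_right_mono[OF norm_cinner_le[of x w] norm_ge_zero[of v]]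
    by (simp add: norm_scaleC mult_ac)
qed

lemma positive_rank_one: "positive_op (rank_one v v)"
proof (rule positive_opI)
  fix x
  show "cinner (rank_one v v *\<^sub>V x) x = of_real ((cmod (cinner x v))\<^sup>2)"
    by (simp only: rank_one_apply cinner_scaleC_left cmod_sq_cinner)
qed simp

text \<open>
  The operator inequality \<open>Y\<^sup>* T\<^sup>* T Y \<le> c\<^sup>2 Y\<^sup>* Y\<close>.
\<close>

lemma positive_op_defect:
  fixes T :: "'a::chilbert_space bop"
  assumes "bounded_by c T"
  shows "positive_op (complex_of_real (c\<^sup>2) *\<^sub>C (adj Y * Y) - adj (T * Y) * (T * Y))"
proof (rule positive_opI)
  fix v
  show "cinner ((complex_of_real (c\<^sup>2) *\<^sub>C (adj Y * Y) - adj (T * Y) * (T * Y)) *\<^sub>V v) v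
      = of_real (c\<^sup>2 * (norm (Y *\<^sub>V v))\<^sup>2 - (norm (T *\<^sub>V Y *\<^sub>V v))\<^sup>2)"
    using cinner_adj_times[of Y v] cinner_adj_times[of "T * Y" v]
    by (simp only: bop_apply_simps(4,7) cinner.diff_left cinner_scaleC_left) simp
  show "0 \<le> c\<^sup>2 * (norm (Y *\<^sub>V v))\<^sup>2 - (norm (T *\<^sub>V Y *\<^sub>V v))\<^sup>2"
    using power_mono[OF bounded_byD[OF assms, of "Y *\<^sub>V v"], of 2] by (simp add: power_mult_distrib)
qed

lemma state_mono:
  assumes "state_on S \<omega>" "T - R \<in> S" "R \<in> S" "positive_op (T - R)"
  shows "Re (\<omega> R) \<le> Re (\<omega> T)"
proof -
  have "\<omega> ((T - R) + R) = \<omega> (T - R) + \<omega> R" 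
    using assms(1-3) unfolding state_on_def by blast
  moreover have "Re (\<omega> (T - R)) \<ge> 0" using assms by (simp add: state_on_def complex_nonneg_Reals_iff)
  ultimately show ?thesis by simp
qed

lemma state_positive_form:
  fixes \<omega> :: "'a::chilbert_space bop \<Rightarrow> complex"
  assumes "state_on UNIV \<omega>"
  shows "positive_form (\<lambda>S R. \<omega> (adj R * S))"
proof -
  have "\<omega> (adj v * v) \<in> \<real>\<^sub>\<ge>\<^sub>0" for v
    using assms positive_op_adj_times[of v] unfolding state_on_def by blast
  then show ?thesis
    using assms unfolding state_on_def
    by unfold_locales (simp_all add: distrib_left distrib_right scaleC_times_bop adj_add adj_scaleC)
qed

lemma state_defect:
  fixes \<omega> :: "'a::chilbert_space bop \<Rightarrow> complex"
  assumes "state_on UNIV \<omega>" "bounded_by c T"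
  shows "Re (\<omega> (adj (T * Y) * (T * Y))) \<le> c\<^sup>2 * Re (\<omega> (adj Y * Y))"
proof -
  have "Re (\<omega> (adj (T * Y) * (T * Y))) \<le> Re (\<omega> (complex_of_real (c\<^sup>2) *\<^sub>C (adj Y * Y)))"
    by (rule state_mono[OF assms(1) _ _ positive_op_defect[OF assms(2)]]) auto
  also have "\<omega> (complex_of_real (c\<^sup>2) *\<^sub>C (adj Y * Y)) = complex_of_real (c\<^sup>2) * \<omega> (adj Y * Y)"
    using assms(1) unfolding state_on_def by blast
  finally show ?thesis by simp
qed

lemma state_cauchy_schwarz:
  fixes \<omega> :: "'a::chilbert_space bop \<Rightarrow> complex"
  assumes "state_on UNIV \<omega>" "bounded_by c T" "c \<ge> 0"
  shows "cmod (\<omega> (adj Z * T * Y)) \<le> c * sqrt (Re (\<omega> (adj Y * Y))) * sqrt (Re (\<omega> (adj Z * Z)))"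
proof -
  interpret positive_form "\<lambda>S R. \<omega> (adj R * S)" using assms(1) by (rule state_positive_form)
  have nn: "Re (\<omega> (adj S * S)) \<ge> 0" for S using nonneg[of S] by (simp add: complex_nonneg_Reals_iff)
  have "(cmod (\<omega> (adj Z * T * Y)))\<^sup>2 \<le> Re (\<omega> (adj (T * Y) * (T * Y))) * Re (\<omega> (adj Z * Z))"
    using cauchy_schwarz[of Z "T * Y"] by (simp add: mult.assoc)
  also have "\<dots> \<le> (c\<^sup>2 * Re (\<omega> (adj Y * Y))) * Re (\<omega> (adj Z * Z))"
    by (intro mult_right_mono state_defect assms nn)
  also have "\<dots> = (c * sqrt (Re (\<omega> (adj Y * Y))) * sqrt (Re (\<omega> (adj Z * Z))))\<^sup>2"
    using nn by (simp add: power_mult_distrib)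
  finally show ?thesis by (rule power2_le_imp_le) (use assms(3) nn in simp)
qed

lemma state_bounded:
  fixes \<omega> :: "'a::chilbert_space bop \<Rightarrow> complex"
  assumes "state_on UNIV \<omega>" "bounded_by c T" "c \<ge> 0"
  shows "cmod (\<omega> T) \<le> c"
proof -
  have "\<omega> 1 = 1" using assms(1) by (simp add: state_on_def)
  then show ?thesis using state_cauchy_schwarz[OF assms, of 1 1] by simp
qed

text \<open>
  The density operator is read off from the values of the state on rank one operators.  Its trace
  against \<open>T\<close> is the limit of the values of the state at \<open>T p\<close>, where \<open>p\<close> runs through the projections
  onto the spans of finite subsets of the basis; normality identifies the limit.
\<close>

lemma normal_state_density:
  fixes \<omega> :: "'a::chilbert_space bop \<Rightarrow> complex"
  assumes st: "state_on UNIV \<omega>" and normal: "wot_normal_on UNIV \<omega>"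
  obtains A where "positive_op A" "trace_class A" "\<And>T. \<omega> T = trace (A * T)"
proof -
  have add: "\<omega> (S + T) = \<omega> S + \<omega> T" and sc: "\<omega> (c *\<^sub>C T) = c * \<omega> T"
    and pos: "positive_op T \<Longrightarrow> \<omega> T \<in> \<real>\<^sub>\<ge>\<^sub>0" for S T c
    using st unfolding state_on_def by auto
  have om0: "\<omega> 0 = 0" using sc[of 0 0] by simp
  have osum: "\<omega> (sum f F) = (\<Sum>i\<in>F. \<omega> (f i))" for f :: "'a \<Rightarrow> 'a bop" and F
    by (induction F rule: infinite_finite_induct) (simp_all add: add om0)
  define b where "b v w = \<omega> (rank_one v w)" for v w
  have b1: "b (u + v) w = b u w + b v w" for u v w
    unfolding b_def add[symmetric] by (rule arg_cong[of _ _ \<omega>], rule bop_eqI) (simp add: scaleC_add_right)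
  have b2: "b (c *\<^sub>C v) w = c * b v w" for c v w
    unfolding b_def sc[symmetric]
    by (rule arg_cong[of _ _ \<omega>], rule bop_eqI) (simp add: scaleC_scaleC mult.commute)
  have b3: "b w (u + v) = b w u + b w v" for u v w
    unfolding b_def add[symmetric]
    by (rule arg_cong[of _ _ \<omega>], rule bop_eqI) (simp add: scaleC_add_left cinner_add_right)
  have b4: "b w (c *\<^sub>C v) = cnj c * b w v" for c v w
    unfolding b_def sc[symmetric]
    by (rule arg_cong[of _ _ \<omega>], rule bop_eqI) (simp add: scaleC_scaleC cinner_scaleC_right)
  have b5: "cmod (b v w) \<le> 1 * norm v * norm w" for v w
    unfolding b_def using state_bounded[OF st rank_one_bounded[of v w]] by simp
  obtain A where A: "\<And>v w. cinner (A *\<^sub>V v) w = b v w"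
    by (rule bop_of_form[OF b1 b2 b3 b4 b5]) (simp, rule that)
  have Apos: "positive_op A"
    unfolding positive_op_def A b_def using pos positive_rank_one by blast
  let ?E = "some_onb :: 'a set"
  define p where "p F = (\<Sum>e\<in>F. rank_one e (e::'a))" for F
  have papp: "p F *\<^sub>V x = (\<Sum>e\<in>F. cinner x e *\<^sub>C e)" for F x
    by (simp add: p_def bop_apply_sum)
  have pb: "bounded_by 1 (p F)" if "finite F" "F \<subseteq> ?E" for F
    unfolding bounded_by_def papp using onb_expansion_finite(1)[OF is_onb_some_onb that] by simp
  have psum: "(\<Sum>e\<in>F. cinner ((A * T) *\<^sub>V e) e) = \<omega> (T * p F)" for T F
  proof -
    have "T * rank_one e e = rank_one (T *\<^sub>V e) e" for e by (rule bop_eqI) (simp add: bop_scaleC)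
    then show ?thesis by (simp add: p_def sum_distrib_left osum A b_def)
  qed
  have hs: "((\<lambda>e. cinner ((A * T) *\<^sub>V e) e) has_sum \<omega> T) ?E" for T
    unfolding has_sum_def psum
  proof -
    obtain c where c: "c \<ge> 0" "bounded_by c T" by (rule ex_bounded_by)
    show "((\<lambda>F. \<omega> (T * p F)) \<longlongrightarrow> \<omega> T) (finite_subsets_at_top ?E)"
    proof (rule wot_normal_onD[OF normal c UNIV_I])
      show "\<forall>\<^sub>F F in finite_subsets_at_top ?E. bounded_by c (T * p F) \<and> T * p F \<in> UNIV"
        unfolding eventually_finite_subsets_at_top
        using bounded_by_times[OF c(2) pb c(1)] by (intro exI[of _ "{}"]) auto
      show "wot_tendsto (\<lambda>F. T * p F) T (finite_subsets_at_top ?E)"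
        unfolding wot_tendsto_def
      proof (intro allI)
        fix v w
        have "((\<lambda>F. p F *\<^sub>V v) \<longlongrightarrow> v) (finite_subsets_at_top ?E)"
          using onb_expansion[OF is_onb_some_onb, of v] unfolding papp has_sum_def .
        then have "((\<lambda>F. cinner (T *\<^sub>V p F *\<^sub>V v) w) \<longlongrightarrow> cinner (T *\<^sub>V v) w) (finite_subsets_at_top ?E)"
          by (intro cinner.tendsto bop_tendsto tendsto_const)
        then show "((\<lambda>F. cinner ((T * p F) *\<^sub>V v) w) \<longlongrightarrow> cinner (T *\<^sub>V v) w) (finite_subsets_at_top ?E)"
          by simp
      qed
    qed
  qed
  have "trace_class A"
    unfolding trace_class_def abs_op_positive[OF Apos] using hs[of 1] by (auto intro: has_sum_imp_summable)
  moreover have "\<omega> T = trace (A * T)" for T unfolding trace_def using infsumI[OF hs[of T]] by simp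
  ultimately show ?thesis using that[OF Apos] by blast
qed

lemma trace_rank_one: "trace (A * rank_one v w) = cinner (A *\<^sub>V v) (w::'a::chilbert_space)"
proof -
  have "((\<lambda>e. cinner (A *\<^sub>V v) e * cinner e w) has_sum cinner (A *\<^sub>V v) w) some_onb"
    by (rule parseval[OF is_onb_some_onb])
  then show ?thesis
    by (simp add: trace_def bop_scaleC cinner_scaleC_left mult.commute infsumI)
qed

lemma density_unique:
  fixes A B :: "'a::chilbert_space bop"
  assumes "\<And>T. trace (A * T) = trace (B * T)"
  shows "A = B"
  by (rule bop_eqI, rule cinner_ext) (simp add: assms flip: trace_rank_one)

section \<open>Averaging a contraction with the identity\<close>

lemma binomial_power_of_average:
  fixes P Q :: "'v::real_vector \<Rightarrow> 'v"
  assumes Q: "linear Q" and P: "\<And>x. P x = (1/2) *\<^sub>R (Q x + x)"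
  shows "(P ^^ n) x = (\<Sum>k\<le>n. (real (n choose k) / 2 ^ n) *\<^sub>R (Q ^^ k) x)"
proof (induction n)
  case 0
  show ?case by simp
next
  case (Suc n)
  let ?a = "\<lambda>k. (Q ^^ k) x"
  have 1: "(\<Sum>k\<le>n. real (n choose k) *\<^sub>R ?a k) = ?a 0 + (\<Sum>k\<le>n. real (n choose Suc k) *\<^sub>R ?a (Suc k))"
  proof -
    have "(\<Sum>k\<le>n. real (n choose k) *\<^sub>R ?a k) = (\<Sum>k\<le>Suc n. real (n choose k) *\<^sub>R ?a k)" by simp
    also have "\<dots> = ?a 0 + (\<Sum>k\<le>n. real (n choose Suc k) *\<^sub>R ?a (Suc k))"
      by (subst sum.atMost_Suc_shift) simp
    finally show ?thesis .
  qed
  have 2: "(\<Sum>k\<le>Suc n. real (Suc n choose k) *\<^sub>R ?a k) =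
      (\<Sum>k\<le>n. real (n choose k) *\<^sub>R ?a (Suc k)) + (\<Sum>k\<le>n. real (n choose k) *\<^sub>R ?a k)"
    unfolding 1 by (subst sum.atMost_Suc_shift) (simp add: scaleR_add_left sum.distrib algebra_simps)
  have S: "(\<Sum>k\<le>m. (real (m choose k) / 2 ^ m) *\<^sub>R ?a k) = (1 / 2 ^ m) *\<^sub>R (\<Sum>k\<le>m. real (m choose k) *\<^sub>R ?a k)" for m
    by (simp add: scaleR_sum_right)
  have "(P ^^ Suc n) x = (1/2) *\<^sub>R (Q ((P ^^ n) x) + (P ^^ n) x)" by (simp add: P)
  also have "(P ^^ n) x = (1 / 2 ^ n) *\<^sub>R (\<Sum>k\<le>n. real (n choose k) *\<^sub>R ?a k)" by (simp only: Suc S)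
  also have "Q \<dots> = (1 / 2 ^ n) *\<^sub>R (\<Sum>k\<le>n. real (n choose k) *\<^sub>R ?a (Suc k))"
    by (simp add: linear_scale[OF Q] linear_sum[OF Q])
  also have "(1/2) *\<^sub>R (\<dots> + (1 / 2 ^ n) *\<^sub>R (\<Sum>k\<le>n. real (n choose k) *\<^sub>R ?a k))
      = (1 / 2 ^ Suc n) *\<^sub>R (\<Sum>k\<le>Suc n. real (Suc n choose k) *\<^sub>R ?a k)"
    unfolding 2 by (simp add: scaleR_add_right)
  finally show ?case by (simp only: S)
qed

text \<open>
  The variance of a binomial distribution, taken from the Bernstein polynomials at \<open>1/2\<close>.
\<close>

lemma binomial_variance:
  "(\<Sum>k\<le>N. real (N choose k) / 2 ^ N * (2 * real k - real N)\<^sup>2) = real N"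
proof -
  let ?B = "\<lambda>k. Bernstein N k (1/2)"
  have B: "?B k = real (N choose k) / 2 ^ N" if "k \<le> N" for k
  proof -
    have "(1/2::real) ^ k * (1/2) ^ (N - k) = (1/2) ^ N" using that by (simp flip: power_add)
    moreover have "(1::real) - 1/2 = 1/2" by simp
    ultimately have "?B k = real (N choose k) * (1/2) ^ N" unfolding Bernstein_def by (simp only: mult.assoc)
    then show ?thesis by (simp only: power_one_over) simp
  qed
  have gen: "b * (2 * x - m)\<^sup>2 = 4 * (x * (x - 1) * b) + (4 - 4 * m) * (x * b) + m\<^sup>2 * b" for b x m :: real
    by (simp add: power2_eq_square algebra_simps)
  have "(\<Sum>k\<le>N. real (N choose k) / 2 ^ N * (2 * real k - real N)\<^sup>2)
      = (\<Sum>k\<le>N. 4 * (real k * (real k - 1) * ?B k) + (4 - 4 * real N) * (real k * ?B k) + (real N)\<^sup>2 * ?B k)"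
    by (intro sum.cong refl) (simp only: B atMost_iff gen)
  also have "\<dots> = 4 * (real N * (real N - 1) * (1/2)\<^sup>2) + (4 - 4 * real N) * (real N * (1/2)) + (real N)\<^sup>2 * 1"
    by (simp only: sum.distrib sum_distrib_left[symmetric] sum_kk_Bernstein sum_k_Bernstein sum_Bernstein)
  also have "\<dots> = real N"
  proof -
    have "4 * (m * (m - 1) * (1/2)\<^sup>2) + (4 - 4 * m) * (m * (1/2)) + m\<^sup>2 * 1 = m" for m :: real
      by (simp add: power2_eq_square field_simps)
    then show ?thesis .
  qed
  finally show ?thesis .
qed

text \<open>
  The Cauchy--Schwarz inequality against the variance, in the pointwise form
  \<open>|t| \<le> t\<^sup>2 / (2 s) + s / 2\<close> with \<open>s = \<surd>N\<close>.
\<close>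

lemma binomial_mean_deviation:
  assumes "N > 0"
  shows "(\<Sum>k\<le>N. real (N choose k) / 2 ^ N * \<bar>2 * real k - real N\<bar>) \<le> sqrt N"
proof -
  define s where "s = sqrt N"
  have s: "s > 0" "s * s = N" using assms by (simp_all add: s_def)
  have le: "\<bar>t\<bar> \<le> t\<^sup>2 / (2 * s) + s / 2" for t :: real
  proof -
    have "2 * s * \<bar>t\<bar> \<le> t\<^sup>2 + s * s"
      using sum_squares_bound[of "\<bar>t\<bar>" s] by (simp add: power2_eq_square algebra_simps)
    then show ?thesis using s(1) by (simp add: field_simps power2_eq_square)
  qed
  have one: "(\<Sum>k\<le>N. real (N choose k) / 2 ^ N) = 1"
    using choose_row_sum[of N] by (simp add: sum_divide_distrib[symmetric] flip: of_nat_sum)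
  have "(\<Sum>k\<le>N. real (N choose k) / 2 ^ N * \<bar>2 * real k - real N\<bar>)
      \<le> (\<Sum>k\<le>N. real (N choose k) / 2 ^ N * ((2 * real k - real N)\<^sup>2 / (2 * s) + s / 2))"
    by (intro sum_mono mult_left_mono le) simp
  also have "\<dots> = (\<Sum>k\<le>N. real (N choose k) / 2 ^ N * (2 * real k - real N)\<^sup>2) / (2 * s)
      + (\<Sum>k\<le>N. real (N choose k) / 2 ^ N) * (s / 2)"
    by (simp add: distrib_left sum.distrib sum_distrib_right sum_divide_distrib)
  also have "\<dots> = real N / (2 * s) + s / 2" unfolding binomial_variance one by simp
  also have "real N / (2 * s) = s / 2" unfolding s(2)[symmetric] using s(1) by simp
  also have "s / 2 + s / 2 = s" by simp
  finally show ?thesis by (simp add: s_def)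
qed

text \<open>
  Expanding \<open>((Q + 1) / 2)\<^bsup>n+1\<^esup> - ((Q + 1) / 2)\<^bsup>n\<^esup>\<close> in powers of \<open>Q\<close>, the coefficient of \<open>Q\<^sup>k\<close> with
  \<open>N = n + 1\<close> is \<open>2\<^bsup>-N\<^esup> (N choose k) (2 k - N) / N\<close>.  The absolute values add up to the mean
  deviation of a binomial distribution divided by \<open>N\<close>, which is at most \<open>1 / \<surd>N\<close>.  Only the bound on
  the powers of \<open>Q\<close> enters, so the estimate is uniform in \<open>T\<close>.
\<close>

lemma average_power_step:
  fixes P Q :: "'a::complex_inner bop \<Rightarrow> 'a bop"
  assumes Q: "linear Q" "\<And>T. bounded_by c T \<Longrightarrow> bounded_by c (Q T)" and c: "c \<ge> 0"
    and P: "\<And>T. P T = (1/2) *\<^sub>R (Q T + T)" and T: "bounded_by c T"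
  shows "bounded_by (c / sqrt (Suc n)) ((P ^^ Suc n) T - (P ^^ n) T)"
proof -
  let ?N = "Suc n"
  let ?d = "\<lambda>k. real (?N choose k) / 2 ^ ?N * ((2 * real k - real ?N) / real ?N)"
  have Qk: "bounded_by c ((Q ^^ k) T)" for k
    by (induction k) (use T Q(2) in simp_all)
  have coef: "real (?N choose k) / 2 ^ ?N - real (n choose k) / 2 ^ n = ?d k" if "k \<le> ?N" for k
  proof -
    have "(?N - k) * (?N choose k) = ?N * (n choose k)"
      using binomial_absorb_comp[of ?N k] by simp
    then have "(real ?N - real k) * real (?N choose k) = real ?N * real (n choose k)"
      using that by (metis of_nat_diff of_nat_mult)
    then have D: "real (n choose k) = (real ?N - real k) * real (?N choose k) / real ?N"
      by (simp add: eq_divide_eq mult.commute)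
    have "a / (2 * p) - ((m - x) * a / m) / p = a / (2 * p) * ((2 * x - m) / m)"
      if "m \<noteq> 0" "p \<noteq> 0" for a p m x :: real
      using that by (simp add: field_simps)
    from this[of "real ?N" "2 ^ n" "real (?N choose k)" "real k"] show ?thesis
      unfolding D by (simp only: power_Suc) simp
  qed
  have "(P ^^ n) T = (\<Sum>k\<le>?N. (real (n choose k) / 2 ^ n) *\<^sub>R (Q ^^ k) T)"
    by (simp add: binomial_power_of_average[OF Q(1) P])
  then have "(P ^^ ?N) T - (P ^^ n) T = (\<Sum>k\<le>?N. (real (?N choose k) / 2 ^ ?N - real (n choose k) / 2 ^ n) *\<^sub>R (Q ^^ k) T)"
    by (simp only: binomial_power_of_average[OF Q(1) P] sum_subtractf[symmetric] scaleR_left_diff_distrib)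
  also have "\<dots> = (\<Sum>k\<le>?N. ?d k *\<^sub>R (Q ^^ k) T)"
    by (intro sum.cong refl) (simp only: coef atMost_iff)
  finally have eq: "(P ^^ ?N) T - (P ^^ n) T = (\<Sum>k\<le>?N. ?d k *\<^sub>R (Q ^^ k) T)" .
  have "bounded_by (\<Sum>k\<in>K. \<bar>?d k\<bar> * c) (\<Sum>k\<in>K. ?d k *\<^sub>R (Q ^^ k) T)" if "finite K" for K
    using that
    by (induction K) (simp_all only: sum.empty sum.insert bounded_by_zero not_False_eq_True,
        intro bounded_by_add bounded_by_scaleR Qk)
  from this[of "{..?N}"] have bd: "bounded_by (\<Sum>k\<le>?N. \<bar>?d k\<bar> * c) ((P ^^ ?N) T - (P ^^ n) T)"
    unfolding eq by simp
  have "(\<Sum>k\<le>?N. \<bar>?d k\<bar> * c) = c / real ?N * (\<Sum>k\<le>?N. real (?N choose k) / 2 ^ ?N * \<bar>2 * real k - real ?N\<bar>)"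
  proof -
    have ab: "\<bar>a * (b / m)\<bar> * c = c / m * (a * \<bar>b\<bar>)" if "a \<ge> 0" "m > 0" for a b m :: real
      using that by (simp add: abs_mult)
    show ?thesis unfolding sum_distrib_left by (intro sum.cong refl ab) auto
  qed
  also have "\<dots> \<le> c / real ?N * sqrt ?N"
    using c by (intro mult_left_mono binomial_mean_deviation) auto
  also have "\<dots> = c / sqrt ?N"
    using real_div_sqrt[of "real ?N"] by (simp add: field_simps)
  finally show ?thesis using bd bounded_by_mono by blast
qed

section \<open>The standard representation of a tracial von Neumann algebra\<close>

lemma commutantD: "T \<in> commutant S \<Longrightarrow> s \<in> S \<Longrightarrow> T * s = s * T"
  by (simp add: commutant_def)

lemma commutant_times: "S \<in> commutant N \<Longrightarrow> T \<in> commutant N \<Longrightarrow> S * T \<in> commutant N"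
  unfolding commutant_def mem_Collect_eq by (metis mult.assoc)

lemma commutant_add: "S \<in> commutant N \<Longrightarrow> T \<in> commutant N \<Longrightarrow> S + T \<in> commutant N"
  by (simp add: commutant_def distrib_left distrib_right)

lemma commutant_diff: "S \<in> commutant N \<Longrightarrow> T \<in> commutant N \<Longrightarrow> S - T \<in> commutant N"
  by (simp add: commutant_def left_diff_distrib right_diff_distrib)

lemma commutant_scaleC: "S \<in> commutant N \<Longrightarrow> c *\<^sub>C S \<in> commutant N"
  by (simp add: commutant_def scaleC_times_bop)

lemma commutant_one: "1 \<in> commutant N"
  by (simp add: commutant_def)

locale tracial_L2 =
  fixes M :: "'k::chilbert_space bop set" and \<tau> :: "'k bop \<Rightarrow> complex"
    and hat :: "'k bop \<Rightarrow> 'h::chilbert_space"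
  assumes tracial: "tracial_von_neumann_algebra M \<tau>" and L2: "is_L2 M \<tau> hat"
begin

abbreviation L :: "'k bop \<Rightarrow> 'h bop" where "L \<equiv> lmult M hat"

lemma bicommutant: "commutant (commutant M) = M"
  using tracial by (simp add: tracial_von_neumann_algebra_def finite_von_neumann_algebra_def von_neumann_algebra_def)

lemma adj_in: "x \<in> M \<Longrightarrow> adj x \<in> M"
  using tracial by (simp add: tracial_von_neumann_algebra_def finite_von_neumann_algebra_def von_neumann_algebra_def)

lemma one_in: "1 \<in> M"
  and times_in: "x \<in> M \<Longrightarrow> y \<in> M \<Longrightarrow> x * y \<in> M"
  and add_in: "x \<in> M \<Longrightarrow> y \<in> M \<Longrightarrow> x + y \<in> M"
  and diff_in: "x \<in> M \<Longrightarrow> y \<in> M \<Longrightarrow> x - y \<in> M"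
  and scaleC_in: "x \<in> M \<Longrightarrow> c *\<^sub>C x \<in> M"
  using commutant_one[of "commutant M"] commutant_times[of x "commutant M" y]
    commutant_add[of x "commutant M" y] commutant_diff[of x "commutant M" y]
    commutant_scaleC[of x "commutant M" c]
  unfolding bicommutant by simp_all

lemma state: "state_on M \<tau>"
  and trace_commute: "x \<in> M \<Longrightarrow> y \<in> M \<Longrightarrow> \<tau> (x * y) = \<tau> (y * x)"
  using tracial by (simp_all add: tracial_von_neumann_algebra_def)

lemma normal: "wot_normal_on M \<tau>"
  by (rule normal_on_imp_wot_normal_on) (use tracial in \<open>simp add: tracial_von_neumann_algebra_def\<close>)

lemma hat_add: "x \<in> M \<Longrightarrow> y \<in> M \<Longrightarrow> hat (x + y) = hat x + hat y"
  and hat_scaleC: "x \<in> M \<Longrightarrow> hat (c *\<^sub>C x) = c *\<^sub>C hat x"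
  and cinner_hat: "x \<in> M \<Longrightarrow> y \<in> M \<Longrightarrow> cinner (hat x) (hat y) = \<tau> (adj y * x)"
  and dense: "closure (hat ` M) = UNIV"
  using L2 by (simp_all add: is_L2_def)

lemma tau_scaleC: "x \<in> M \<Longrightarrow> \<tau> (c *\<^sub>C x) = c * \<tau> x"
  using state by (simp add: state_on_def)

lemma norm_hat: "x \<in> M \<Longrightarrow> (norm (hat x))\<^sup>2 = Re (\<tau> (adj x * x))"
  using cinner_hat[of x x] cinner_self[of "hat x"] by (metis Re_complex_of_real)

lemma norm_hat_one: "norm (hat 1) = 1"
proof -
  have "(norm (hat 1))\<^sup>2 = 1" using norm_hat[OF one_in] state by (simp add: state_on_def)
  then show ?thesis using norm_ge_zero[of "hat 1"] by (simp add: power2_eq_1_iff)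
qed

lemma norm_hat_times:
  assumes x: "x \<in> M" "bounded_by c x" "c \<ge> 0" and y: "y \<in> M"
  shows "norm (hat (x * y)) \<le> c * norm (hat y)"
proof -
  have "Re (\<tau> (adj (x * y) * (x * y))) \<le> Re (\<tau> (complex_of_real (c\<^sup>2) *\<^sub>C (adj y * y)))"
    by (rule state_mono[OF state _ _ positive_op_defect[OF x(2)]])
      (intro diff_in scaleC_in times_in adj_in x y)+
  then have "(norm (hat (x * y)))\<^sup>2 \<le> c\<^sup>2 * (norm (hat y))\<^sup>2"
    using x y by (simp only: norm_hat times_in adj_in tau_scaleC) simp
  then have "(norm (hat (x * y)))\<^sup>2 \<le> (c * norm (hat y))\<^sup>2" by (simp only: power_mult_distrib)
  then show ?thesis by (rule power2_le_imp_le) (use x(3) in simp)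
qed

lemma bop_eqI_hat:
  fixes S T :: "'h bop"
  assumes "\<And>y z. y \<in> M \<Longrightarrow> z \<in> M \<Longrightarrow> cinner (S *\<^sub>V hat y) (hat z) = cinner (T *\<^sub>V hat y) (hat z)"
  shows "S = T"
proof -
  have 1: "S *\<^sub>V hat y = T *\<^sub>V hat y" if "y \<in> M" for y
    by (rule cinner_ext_dense[OF dense]) (use assms that in auto)
  have "adj S = adj T"
  proof (rule bop_eqI, rule cinner_ext_dense[OF dense])
    fix w v assume "v \<in> hat ` M"
    then obtain y where y: "y \<in> M" "v = hat y" by blast
    show "cinner (adj S *\<^sub>V w) v = cinner (adj T *\<^sub>V w) v"
      unfolding y cinner_adj'[symmetric] 1[OF y(1)] ..
  qed
  then have "adj (adj S) = adj (adj T)" by simp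
  then show ?thesis by simp
qed

lemma L_hat:
  assumes x: "x \<in> M" and y: "y \<in> M"
  shows "L x *\<^sub>V hat y = hat (x * y)"
proof -
  obtain c where c: "c \<ge> 0" "bounded_by c x" by (rule ex_bounded_by)
  have 1: "hat (x * (u + v)) = hat (x * u) + hat (x * v)" if "u \<in> M" "v \<in> M" for u v
    using that x by (simp add: distrib_left hat_add times_in)
  have 2: "hat (x * (a *\<^sub>C v)) = a *\<^sub>C hat (x * v)" if "v \<in> M" for a v
    using that x by (simp add: scaleC_times_bop hat_scaleC times_in)
  obtain T where T: "\<And>v. v \<in> M \<Longrightarrow> T *\<^sub>V hat v = hat (x * v)"
    by (rule bop_from_dense[of M hat "\<lambda>v. hat (x * v)" c, OF add_in scaleC_in hat_add hat_scaleC dense 1 2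
          norm_hat_times[OF x c(2,1)] c(1)]) (assumption | rule that)+
  have "L x = T"
    unfolding lmult_def
  proof (rule the_equality)
    show "\<forall>y\<in>M. T *\<^sub>V hat y = hat (x * y)" using T by blast
    show "S = T" if "\<forall>y\<in>M. S *\<^sub>V hat y = hat (x * y)" for S
      by (rule bop_eqI_hat) (use that T in simp)
  qed
  then show ?thesis using T y by simp
qed

lemma L_times: "x \<in> M \<Longrightarrow> y \<in> M \<Longrightarrow> L (x * y) = L x * L y"
  by (rule bop_eqI_hat) (simp add: L_hat times_in mult.assoc)

lemma L_one: "L 1 = 1"
  by (rule bop_eqI_hat) (simp add: L_hat one_in)

lemma L_adj: "x \<in> M \<Longrightarrow> adj (L x) = L (adj x)"
  by (rule bop_eqI_hat)
    (simp add: L_hat times_in adj_in cinner_hat adj_times mult.assoc flip: cinner_adj')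

section \<open>Operators commuting with the right multiplications\<close>

text \<open>
  The image of a bounded ball of \<open>M\<close> in the \<open>L\<^sup>2\<close> space is closed: a weak operator cluster point of
  the given sequence lies in \<open>M\<close>, and normality of the trace identifies its vector with \<open>\<xi>\<close>.
\<close>

lemma hat_ball_closed:
  assumes h: "\<And>n::nat. h n \<in> M" "\<And>n. bounded_by c (h n)" "c \<ge> 0" and lim: "(\<lambda>n. hat (h n)) \<longlonglongrightarrow> \<xi>"
  obtains k where "k \<in> M" "bounded_by c k" "hat k = \<xi>"
proof -
  obtain G k where G: "G \<le> sequentially" "G \<noteq> bot" "wot_tendsto h k G" "bounded_by c k"
    by (rule bounded_ball_wot_compact[OF sequentially_bot h(2,3)]) (rule that)
  have k: "k \<in> M"
    using wot_limit_in_commutant[OF G(2,3), of "commutant M"] h(1) unfolding bicommutant by blast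
  have "hat k = \<xi>"
  proof (rule cinner_ext_dense[OF dense])
    fix v assume "v \<in> hat ` M"
    then obtain y where y: "y \<in> M" "v = hat y" by blast
    obtain b where b: "b \<ge> 0" "bounded_by b (adj y)" by (rule ex_bounded_by)
    have "((\<lambda>n. \<tau> (adj y * h n)) \<longlongrightarrow> \<tau> (adj y * k)) G"
      by (rule wot_normal_onD[OF normal, of "b * c"])
        (use b h k y G in \<open>auto intro!: bounded_by_times times_in adj_in wot_tendsto_times always_eventually\<close>)
    then have "((\<lambda>n. cinner (hat (h n)) v) \<longlongrightarrow> cinner (hat k) v) G"
      using y h(1) k by (simp add: cinner_hat)
    moreover have "((\<lambda>n. cinner (hat (h n)) v) \<longlongrightarrow> cinner \<xi> v) G"
      by (rule tendsto_mono[OF G(1)]) (intro cinner.tendsto lim tendsto_const)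
    ultimately show "cinner (hat k) v = cinner \<xi> v" by (rule tendsto_unique[OF G(2)])
  qed
  then show ?thesis using that k G(4) by blast
qed

lemma polar_decomposition_in:
  assumes y: "y \<in> M"
  obtains u r where "u \<in> M" "r \<in> M" "bounded_by 1 u" "adj r = r" "y = u * (r * r)" "r * r = adj u * y"
proof -
  let ?s = "abs_op y"
  obtain r where r: "positive_op r" "r * r = ?s" "\<And>t. t * ?s = ?s * t \<Longrightarrow> t * r = r * t"
    by (rule positive_sqrt_exists[OF positive_abs_op[of y]]) (rule that)
  obtain u where u: "bounded_by 1 u" "y = u * ?s" "?s = adj u * y"
    "\<And>t. t * y = y * t \<Longrightarrow> t * adj y = adj y * t \<Longrightarrow> t * u = u * t"
    by (rule polar_decomposition[of y]) (rule that)
  have c: "t * y = y * t" "t * adj y = adj y * t" if "t \<in> commutant M" for t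
    using commutantD[OF that] y adj_in by blast+
  have "t * u = u * t" if "t \<in> commutant M" for t using u(4) c[OF that] by blast
  then have "u \<in> commutant (commutant M)" unfolding commutant_def[of "commutant M"] by simp
  moreover have "t * r = r * t" if "t \<in> commutant M" for t
  proof (rule r(3), rule sqrt_commute[OF positive_abs_op])
    have "t * (adj y * y) = (adj y * y) * t" by (metis c[OF that] mult.assoc)
    then show "t * (?s * ?s) = (?s * ?s) * t" by (simp only: abs_op_square)
  qed
  then have "r \<in> commutant (commutant M)" unfolding commutant_def[of "commutant M"] by simp
  ultimately show ?thesis
    using that[of u r] u(1-3) r(2) positive_op_adj[OF r(1)] unfolding bicommutant by simp
qed

text \<open>
  The commutation theorem in the form that is needed: the hypothesis says that \<open>T\<close> commutes with the
  right multiplications, without mentioning these.  Let \<open>c\<close> bound \<open>T\<close> and let \<open>K\<close> be the closed convex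
  set of the vectors of operators in \<open>M\<close> bounded by \<open>c\<close>.  The vector \<open>\<xi> = T 1\<close> cannot be separated
  from \<open>K\<close>: if \<open>y = u r\<^sup>2\<close> is the polar decomposition, with \<open>r\<^sup>2 = |y|\<close>, then
  \<open>Re \<langle>\<xi>, y\<rangle> = Re \<langle>T r, u r\<rangle> \<le> c \<tau>(r\<^sup>2) = \<langle>c u, y\<rangle>\<close>, and \<open>c u\<close> gives a vector of \<open>K\<close>.  So \<open>\<xi>\<close> is the vector
  of some \<open>h\<close> in \<open>M\<close>, and the modularity of \<open>T\<close> makes it equal to left multiplication by \<open>h\<close>.
\<close>

lemma left_multiplication_if_right_modular:
  assumes T: "\<And>y z. y \<in> M \<Longrightarrow> z \<in> M \<Longrightarrow> cinner (T *\<^sub>V hat y) (hat z) = cinner (T *\<^sub>V hat 1) (hat (z * adj y))"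
  obtains h where "h \<in> M" "T = L h"
proof -
  obtain c where c: "c \<ge> 0" "bounded_by c T" by (rule ex_bounded_by)
  define \<xi> where "\<xi> = T *\<^sub>V hat 1"
  define K where "K = hat ` {h \<in> M. bounded_by c h}"
  have Kn: "norm k \<le> c" if kK: "k \<in> K" for k
  proof -
    obtain h where h: "h \<in> M" "bounded_by c h" "k = hat h" using kK by (auto simp: K_def)
    then show ?thesis using norm_hat_times[OF h(1,2) c(1) one_in] by (simp add: norm_hat_one)
  qed
  have "closed K"
    unfolding closed_sequential_limits
  proof (intro allI impI, elim conjE)
    fix k l assume k: "\<forall>n. k n \<in> K" "k \<longlonglongrightarrow> l"
    then have "\<forall>n. \<exists>h. h \<in> M \<and> bounded_by c h \<and> k n = hat h" by (auto simp: K_def)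
    then obtain h where h: "\<And>n. h n \<in> M" "\<And>n. bounded_by c (h n)" "\<And>n. k n = hat (h n)" by metis
    have "k = (\<lambda>n. hat (h n))" using h(3) by blast
    then have "(\<lambda>n. hat (h n)) \<longlonglongrightarrow> l" using k(2) by simp
    then obtain h' where "h' \<in> M" "bounded_by c h'" "hat h' = l"
      by (rule hat_ball_closed[OF h(1,2) c(1)]) (rule that)
    then show "l \<in> K" unfolding K_def by blast
  qed
  moreover have "convex K"
    unfolding convex_def
  proof (intro ballI allI impI)
    fix k l and a b :: real assume kl: "k \<in> K" "l \<in> K" and ab: "0 \<le> a" "0 \<le> b" "a + b = 1"
    obtain h g where h: "h \<in> M" "bounded_by c h" "k = hat h" and g: "g \<in> M" "bounded_by c g" "l = hat g"
      using kl by (auto simp: K_def)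
    let ?x = "complex_of_real a *\<^sub>C h + complex_of_real b *\<^sub>C g"
    have "bounded_by (a * c + b * c) ?x"
      using bounded_by_add[OF bounded_by_scaleC[OF h(2), of "of_real a"] bounded_by_scaleC[OF g(2), of "of_real b"]] ab
      by simp
    then have "bounded_by c ?x" using ab by (simp flip: distrib_right)
    moreover have "?x \<in> M" by (intro add_in scaleC_in h g)
    moreover have "a *\<^sub>R k + b *\<^sub>R l = hat ?x"
      by (simp only: hat_add hat_scaleC scaleC_in h g) (simp only: scaleC_of_real)
    ultimately show "a *\<^sub>R k + b *\<^sub>R l \<in> K" unfolding K_def by blast
  qed
  moreover have "K \<noteq> {}"
  proof -
    have "bounded_by c (0 *\<^sub>C 1)" using c(1) by (simp add: bounded_by_def)
    then show ?thesis using scaleC_in[OF one_in] unfolding K_def by blast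
  qed
  ultimately obtain p where p: "p \<in> K" "\<And>k. k \<in> K \<Longrightarrow> inner (\<xi> - p) (k - p) \<le> 0"
    by (rule closed_convex_nearest_point[of K \<xi>]) (rule that)
  have est: "\<exists>k\<in>K. Re (cinner \<xi> (hat y)) \<le> Re (cinner k (hat y))" if y: "y \<in> M" for y
  proof -
    obtain u r where ur: "u \<in> M" "r \<in> M" "bounded_by 1 u" "adj r = r" "y = u * (r * r)" "r * r = adj u * y"
      by (rule polar_decomposition_in[OF y]) (rule that)
    let ?k = "hat (complex_of_real c *\<^sub>C u)"
    have "bounded_by c (complex_of_real c *\<^sub>C u)"
      using bounded_by_scaleC[OF ur(3), of "of_real c"] c(1) by simp
    then have "?k \<in> K" unfolding K_def using ur(1) scaleC_in by blast
    moreover have "Re (cinner \<xi> (hat y)) \<le> Re (cinner ?k (hat y))"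
    proof -
      have "cinner \<xi> (hat y) = cinner (T *\<^sub>V hat r) (hat (u * r))"
        using T[OF ur(2) times_in[OF ur(1,2)]] ur(4,5) by (simp add: \<xi>_def mult.assoc)
      then have "Re (cinner \<xi> (hat y)) \<le> norm (T *\<^sub>V hat r) * norm (hat (u * r))"
        using complex_Re_le_cmod norm_cinner_le order_trans by metis
      also have "\<dots> \<le> (c * norm (hat r)) * (1 * norm (hat r))"
        by (intro mult_mono bounded_byD[OF c(2)] norm_hat_times ur) (use c in auto)
      also have "\<dots> = c * (norm (hat r))\<^sup>2" by (simp add: power2_eq_square)
      also have "\<dots> = c * Re (\<tau> (r * r))" using norm_hat[OF ur(2)] ur(4) by simp
      also have "\<tau> (r * r) = \<tau> (adj y * u)"
      proof -
        have "adj (r * r) = adj y * u" unfolding ur(6) by (simp add: adj_times)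
        then show ?thesis by (simp add: adj_times ur(4))
      qed
      also have "c * Re (\<tau> (adj y * u)) = Re (cinner ?k (hat y))"
        using y ur(1) by (simp add: hat_scaleC cinner_scaleC_left cinner_hat)
      finally show ?thesis .
    qed
    ultimately show ?thesis by blast
  qed
  define \<eta> where "\<eta> = \<xi> - p"
  have "\<eta> = 0"
  proof (rule ccontr)
    assume "\<eta> \<noteq> 0"
    define N where "N = c + norm \<xi> + 1"
    have N: "N > 0" using c(1) by (simp add: N_def add_nonneg_pos)
    \<comment> \<open>Only vectors \<open>hat y\<close> satisfy the estimate, so \<open>\<eta>\<close> is approximated by one within a distance too small to close the gap.\<close>
    define d where "d = (norm \<eta>)\<^sup>2 / N"
    have d: "d > 0" using N \<open>\<eta> \<noteq> 0\<close> by (simp add: d_def)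
    have "\<eta> \<in> closure (hat ` M)" using dense by simp
    then obtain y where y: "y \<in> M" "dist (hat y) \<eta> < d"
      using d unfolding closure_approachable by blast
    obtain k where k: "k \<in> K" "Re (cinner \<xi> (hat y)) \<le> Re (cinner k (hat y))" using est[OF y(1)] by blast
    have near: "\<bar>inner v (hat y) - inner v \<eta>\<bar> \<le> norm v * d" for v
    proof -
      have "\<bar>inner v (hat y - \<eta>)\<bar> \<le> norm v * norm (hat y - \<eta>)" by (rule Cauchy_Schwarz_ineq2)
      also have "\<dots> \<le> norm v * d" using y(2) by (intro mult_left_mono) (auto simp: dist_norm)
      finally show ?thesis by (simp add: inner_diff_right)
    qed
    have kd: "norm k * d \<le> c * d" using Kn[OF k(1)] d by simp
    have "inner \<xi> \<eta> = inner p \<eta> + (norm \<eta>)\<^sup>2"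
      unfolding power2_norm_eq_inner by (simp add: \<eta>_def inner_diff_left inner_diff_right inner_commute)
    moreover have "inner k \<eta> \<le> inner p \<eta>"
      using p(2)[OF k(1)] by (simp add: \<eta>_def[symmetric] inner_diff_right inner_commute)
    moreover have "inner \<xi> (hat y) \<le> inner k (hat y)" using k(2) by (simp add: inner_eq_Re_cinner)
    ultimately have "(norm \<eta>)\<^sup>2 \<le> c * d + norm \<xi> * d"
      using near[of \<xi>] near[of k] kd by linarith
    also have "\<dots> < N * d" using d by (simp add: N_def distrib_right)
    also have "\<dots> = (norm \<eta>)\<^sup>2" using N by (simp add: d_def)
    finally show False by simp
  qed
  then have "\<xi> \<in> K" using p(1) by (simp add: \<eta>_def)
  then obtain h where h: "h \<in> M" "hat h = \<xi>" unfolding K_def by force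
  have "T = L h"
  proof (rule bop_eqI_hat)
    fix y z assume yz: "y \<in> M" "z \<in> M"
    have "cinner (T *\<^sub>V hat y) (hat z) = cinner (hat h) (hat (z * adj y))" by (simp add: T[OF yz] h(2) \<xi>_def)
    also have "\<dots> = \<tau> (y * (adj z * h))"
      using yz h(1) by (simp add: cinner_hat times_in adj_in adj_times mult.assoc)
    also have "\<dots> = \<tau> ((adj z * h) * y)" using yz h by (intro trace_commute times_in adj_in)
    also have "\<dots> = cinner (L h *\<^sub>V hat y) (hat z)"
      using yz h by (simp add: L_hat cinner_hat times_in mult.assoc)
    finally show "cinner (T *\<^sub>V hat y) (hat z) = cinner (L h *\<^sub>V hat y) (hat z)" .
  qed
  then show ?thesis using that h(1) by blast
qed

section \<open>The map of a hyperstate\<close>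

lemma hyperstate_state: "hyperstate M \<tau> hat \<phi> \<Longrightarrow> state_on UNIV \<phi>"
  and hyperstate_L: "hyperstate M \<tau> hat \<phi> \<Longrightarrow> x \<in> M \<Longrightarrow> \<phi> (L x) = \<tau> x"
  by (simp_all add: hyperstate_def)

lemma hyperstate_norm:
  assumes "hyperstate M \<tau> hat \<phi>" "y \<in> M"
  shows "sqrt (Re (\<phi> (adj (L y) * L y))) = norm (hat y)"
proof -
  have "adj (L y) * L y = L (adj y * y)" using assms(2) by (simp add: L_adj L_times adj_in)
  then have "Re (\<phi> (adj (L y) * L y)) = (norm (hat y))\<^sup>2"
    using assms by (simp add: hyperstate_L norm_hat times_in adj_in)
  then show ?thesis by simp
qed

lemma L_add: "x \<in> M \<Longrightarrow> y \<in> M \<Longrightarrow> L (x + y) = L x + L y"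
  by (rule bop_eqI_hat) (simp add: L_hat add_in times_in distrib_right hat_add)

lemma L_scaleC: "x \<in> M \<Longrightarrow> L (c *\<^sub>C x) = c *\<^sub>C L x"
  by (rule bop_eqI_hat) (simp add: L_hat scaleC_in times_in scaleC_times_bop hat_scaleC)

text \<open>
  Boundedness is the Cauchy--Schwarz inequality for the state together with the fact that the state
  restricts to the trace on \<open>M\<close>, which turns its values on \<open>M\<close> into norms of the \<open>L\<^sup>2\<close> space.
\<close>

lemma hyperstate_form:
  assumes hyp: "hyperstate M \<tau> hat \<phi>" and T: "bounded_by c T" "c \<ge> 0"
  obtains S where "bounded_by c S"
    "\<And>y z. y \<in> M \<Longrightarrow> z \<in> M \<Longrightarrow> cinner (S *\<^sub>V hat y) (hat z) = \<phi> (adj (L z) * T * L y)"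
proof -
  have st: "state_on UNIV \<phi>" using hyp by (rule hyperstate_state)
  have add: "\<phi> (S + R) = \<phi> S + \<phi> R" and sc: "\<phi> (a *\<^sub>C S) = a * \<phi> S" for S R a
    using st unfolding state_on_def by auto
  let ?b = "\<lambda>y z. \<phi> (adj (L z) * T * L y)"
  have b1: "?b (u + v) w = ?b u w + ?b v w" if "u \<in> M" "v \<in> M" "w \<in> M" for u v w
    using that by (simp add: L_add distrib_left add)
  have b2: "?b (a *\<^sub>C v) w = a * ?b v w" if "v \<in> M" "w \<in> M" for a v w
    using that by (simp add: L_scaleC scaleC_times_bop sc)
  have b3: "?b w (u + v) = ?b w u + ?b w v" if "u \<in> M" "v \<in> M" "w \<in> M" for u v w
    using that by (simp add: L_add adj_add distrib_right add)
  have b4: "?b w (a *\<^sub>C v) = cnj a * ?b w v" if "v \<in> M" "w \<in> M" for a v w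
    using that by (simp add: L_scaleC adj_scaleC scaleC_times_bop sc)
  have b5: "cmod (?b v w) \<le> c * norm (hat v) * norm (hat w)" if "v \<in> M" "w \<in> M" for v w
    using state_cauchy_schwarz[OF st T, of "L w" "L v"] that by (simp add: hyperstate_norm[OF hyp])
  show ?thesis
    by (rule bop_of_form_dense[of M hat ?b c, OF add_in scaleC_in hat_add hat_scaleC dense b1 b2 b3 b4 b5 T(2)])
      (assumption | rule that)+
qed

text \<open>
  The coefficients determine the map uniquely, so it only has to be checked that the map they define
  is unital, completely positive and bimodular.  For complete positivity the vectors can be taken of the
  form \<open>hat s\<close>, by density; the sum of coefficients is then the value of the state on the operator
  \<open>\<Sum>\<^sub>i\<^sub>j s\<^sub>i\<^sup>* T\<^sub>i\<^sub>j s\<^sub>j\<close>, which is positive.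
\<close>

lemma hyperstate_map_props:
  assumes hyp: "hyperstate M \<tau> hat \<phi>"
  defines "P \<equiv> hyperstate_map M hat \<phi>"
  shows hyperstate_map_ucp: "ucp P"
    and hyperstate_map_bimodular: "bimodular (L ` M) P"
    and hyperstate_map_coeff: "\<And>T y z. y \<in> M \<Longrightarrow> z \<in> M \<Longrightarrow>
        cinner (P T *\<^sub>V hat y) (hat z) = \<phi> (adj (L z) * T * L y)"
proof -
  have st: "state_on UNIV \<phi>" using hyp by (rule hyperstate_state)
  have add: "\<phi> (S + R) = \<phi> S + \<phi> R" and sc: "\<phi> (a *\<^sub>C S) = a * \<phi> S"
    and pos: "positive_op S \<Longrightarrow> \<phi> S \<in> \<real>\<^sub>\<ge>\<^sub>0" for S R a
    using st unfolding state_on_def by auto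
  have phi0: "\<phi> 0 = 0" using sc[of 0 0] by simp
  have phisum: "\<phi> (sum f F) = (\<Sum>i\<in>F. \<phi> (f i))" for f :: "nat \<Rightarrow> 'h bop" and F
    by (induction F rule: infinite_finite_induct) (simp_all add: add phi0)
  have "\<exists>S. \<forall>y\<in>M. \<forall>z\<in>M. cinner (S *\<^sub>V hat y) (hat z) = \<phi> (adj (L z) * T * L y)" for T
  proof -
    obtain c where c: "c \<ge> 0" "bounded_by c T" by (rule ex_bounded_by)
    obtain S where "\<And>y z. y \<in> M \<Longrightarrow> z \<in> M \<Longrightarrow> cinner (S *\<^sub>V hat y) (hat z) = \<phi> (adj (L z) * T * L y)"
      by (rule hyperstate_form[OF hyp c(2,1)]) (rule that)
    then show ?thesis by blast
  qed
  then obtain Q where Q0: "\<forall>T. \<forall>y\<in>M. \<forall>z\<in>M. cinner (Q T *\<^sub>V hat y) (hat z) = \<phi> (adj (L z) * T * L y)"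
    by metis
  then have Q: "cinner (Q T *\<^sub>V hat y) (hat z) = \<phi> (adj (L z) * T * L y)" if "y \<in> M" "z \<in> M" for T y z
    using that by blast
  have Qadd: "Q (S + T) = Q S + Q T" for S T
    by (rule bop_eqI_hat) (simp add: Q cinner_add_left distrib_left distrib_right add)
  have Qsc: "Q (c *\<^sub>C T) = c *\<^sub>C Q T" for c T
    by (rule bop_eqI_hat) (simp add: Q cinner_scaleC_left scaleC_times_bop sc)
  have Q1: "Q 1 = 1"
  proof (rule bop_eqI_hat)
    fix y z assume yz: "y \<in> M" "z \<in> M"
    have "adj (L z) * 1 * L y = L (adj z * y)" using yz by (simp add: L_adj L_times adj_in)
    then show "cinner (Q 1 *\<^sub>V hat y) (hat z) = cinner (1 *\<^sub>V hat y) (hat z)"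
      using yz hyp by (simp only: Q hyperstate_L times_in adj_in) (simp add: cinner_hat)
  qed
  have Qpos: "positive_matrix n (\<lambda>i j. Q (T i j))" if T: "positive_matrix n T" for n T
    unfolding positive_matrix_def
  proof
    fix \<xi> :: "nat \<Rightarrow> 'h"
    have "\<exists>s. (\<forall>m. s m \<in> M) \<and> (\<lambda>m. hat (s m)) \<longlonglongrightarrow> \<xi> i" for i
    proof -
      have "\<xi> i \<in> closure (hat ` M)" using dense by simp
      then obtain q where q: "\<And>m. q m \<in> hat ` M" "q \<longlonglongrightarrow> \<xi> i" by (auto simp: closure_sequential)
      then have "\<forall>m. \<exists>s. s \<in> M \<and> q m = hat s" by blast
      then obtain s where s: "\<And>m. s m \<in> M \<and> q m = hat (s m)" by metis
      then have "q = (\<lambda>m. hat (s m))" by blast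
      then show ?thesis using q(2) s by blast
    qed
    then obtain s where s: "\<And>i m. s i m \<in> M" "\<And>i. (\<lambda>m. hat (s i m)) \<longlonglongrightarrow> \<xi> i" by metis
    have lim: "(\<lambda>m. \<Sum>i<n. \<Sum>j<n. cinner (Q (T i j) *\<^sub>V hat (s j m)) (hat (s i m)))
        \<longlonglongrightarrow> (\<Sum>i<n. \<Sum>j<n. cinner (Q (T i j) *\<^sub>V \<xi> j) (\<xi> i))"
      by (intro tendsto_sum cinner.tendsto bop_tendsto s)
    have mem: "(\<Sum>i<n. \<Sum>j<n. cinner (Q (T i j) *\<^sub>V hat (s j m)) (hat (s i m))) \<in> \<real>\<^sub>\<ge>\<^sub>0" for m
    proof -
      let ?S = "\<Sum>i<n. \<Sum>j<n. adj (L (s i m)) * T i j * L (s j m)"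
      have "positive_op ?S"
        unfolding positive_op_def
      proof
        fix v
        have "cinner (?S *\<^sub>V v) v = (\<Sum>i<n. \<Sum>j<n. cinner (T i j *\<^sub>V L (s j m) *\<^sub>V v) (L (s i m) *\<^sub>V v))"
          by (simp add: bop_apply_sum cinner.sum_left cinner_adj'[symmetric])
        then show "cinner (?S *\<^sub>V v) v \<in> \<real>\<^sub>\<ge>\<^sub>0"
          using T[unfolded positive_matrix_def, rule_format, of "\<lambda>j. L (s j m) *\<^sub>V v"] by (simp only:)
      qed
      then have "\<phi> ?S \<in> \<real>\<^sub>\<ge>\<^sub>0" by (rule pos)
      then show ?thesis by (simp add: phisum Q s(1))
    qed
    show "(\<Sum>i<n. \<Sum>j<n. cinner (Q (T i j) *\<^sub>V \<xi> j) (\<xi> i)) \<in> \<real>\<^sub>\<ge>\<^sub>0"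
      by (rule closed_sequentially[OF closed_nonneg_Reals_complex mem lim])
  qed
  have Qucp: "ucp Q" unfolding ucp_def by (simp add: Qadd Qsc Q1 Qpos)
  have Qb: "Q (L x * T * L y) = L x * Q T * L y" if xy: "x \<in> M" "y \<in> M" for x y T
  proof (rule bop_eqI_hat)
    fix a b assume ab: "a \<in> M" "b \<in> M"
    have 2: "L (y * a) = L y * L a" using xy ab by (simp add: L_times)
    have 1: "adj (L (adj x * b)) = adj (L b) * L x"
      using xy ab by (simp add: L_times adj_in adj_times L_adj)
    have "cinner ((L x * Q T * L y) *\<^sub>V hat a) (hat b) = cinner (Q T *\<^sub>V hat (y * a)) (hat (adj x * b))"
      using xy ab by (simp add: L_hat cinner_adj[of "L x"] L_adj adj_in)
    also have "\<dots> = \<phi> (adj (L b) * (L x * T * L y) * L a)"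
      by (simp only: Q times_in adj_in xy ab 1 2 mult.assoc)
    finally show "cinner (Q (L x * T * L y) *\<^sub>V hat a) (hat b) = cinner ((L x * Q T * L y) *\<^sub>V hat a) (hat b)"
      using Q[OF ab] by simp
  qed
  then have Qbim: "bimodular (L ` M) Q" unfolding bimodular_def by (auto simp: Qb)
  have "P = Q"
    unfolding P_def hyperstate_map_def
  proof (rule the_equality)
    show "ucp Q \<and> bimodular (L ` M) Q \<and>
      (\<forall>T. \<forall>y\<in>M. \<forall>z\<in>M. cinner (Q T *\<^sub>V hat y) (hat z) = \<phi> (adj (L z) * T * L y))"
      using Qucp Qbim Q0 by blast
    fix R assume R: "ucp R \<and> bimodular (L ` M) R \<and>
      (\<forall>T. \<forall>y\<in>M. \<forall>z\<in>M. cinner (R T *\<^sub>V hat y) (hat z) = \<phi> (adj (L z) * T * L y))"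
    show "R = Q"
    proof
      show "R T = Q T" for T by (rule bop_eqI_hat) (use R Q in simp)
    qed
  qed
  then show "ucp P" "bimodular (L ` M) P"
    "\<And>T y z. y \<in> M \<Longrightarrow> z \<in> M \<Longrightarrow> cinner (P T *\<^sub>V hat y) (hat z) = \<phi> (adj (L z) * T * L y)"
    using Qucp Qbim Q by simp_all
qed

lemma hyperstate_map_bounded:
  assumes hyp: "hyperstate M \<tau> hat \<phi>" and T: "bounded_by c T" "c \<ge> 0"
  shows "bounded_by c (hyperstate_map M hat \<phi> T)"
proof -
  obtain S where S: "bounded_by c S"
    "\<And>y z. y \<in> M \<Longrightarrow> z \<in> M \<Longrightarrow> cinner (S *\<^sub>V hat y) (hat z) = \<phi> (adj (L z) * T * L y)"
    by (rule hyperstate_form[OF hyp T]) (rule that)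
  have "hyperstate_map M hat \<phi> T = S"
    by (rule bop_eqI_hat) (simp add: S(2) hyperstate_map_coeff[OF hyp])
  then show ?thesis using S(1) by simp
qed

lemma hyperstate_map_wot_continuous:
  assumes hyp: "hyperstate M \<tau> hat \<phi>" and nor: "wot_normal_on UNIV \<phi>"
    and X: "\<And>i. bounded_by c (X i)" "bounded_by c T" "c \<ge> 0" and lim: "wot_tendsto X T F"
  shows "wot_tendsto (\<lambda>i. hyperstate_map M hat \<phi> (X i)) (hyperstate_map M hat \<phi> T) F"
proof (rule wot_tendstoI_dense[OF dense _ _ X(3)])
  show "bounded_by c (hyperstate_map M hat \<phi> (X i))" for i
    by (rule hyperstate_map_bounded[OF hyp X(1,3)])
  show "bounded_by c (hyperstate_map M hat \<phi> T)"
    by (rule hyperstate_map_bounded[OF hyp X(2,3)])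
  fix v w assume "v \<in> hat ` M" "w \<in> hat ` M"
  then obtain y z where yz: "y \<in> M" "v = hat y" "z \<in> M" "w = hat z" by blast
  obtain a where a: "a \<ge> 0" "bounded_by a (adj (L z))" by (rule ex_bounded_by)
  obtain b where b: "b \<ge> 0" "bounded_by b (L y)" by (rule ex_bounded_by)
  have bd: "bounded_by (a * c * b) (adj (L z) * Y * L y)" if "bounded_by c Y" for Y
    by (intro bounded_by_times a b that mult_nonneg_nonneg X(3))
  have "((\<lambda>i. \<phi> (adj (L z) * X i * L y)) \<longlongrightarrow> \<phi> (adj (L z) * T * L y)) F"
    by (rule wot_normal_onD[OF nor, of "a * c * b"])
      (use a b X(3) bd[OF X(1)] bd[OF X(2)] wot_tendsto_sandwich[OF lim] in simp_all)
  then show "((\<lambda>i. cinner (hyperstate_map M hat \<phi> (X i) *\<^sub>V v) w)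
      \<longlongrightarrow> cinner (hyperstate_map M hat \<phi> T *\<^sub>V v) w) F"
    using yz by (simp add: hyperstate_map_coeff[OF hyp])
qed

end

section \<open>Powers of the map of a hyperstate\<close>

locale normal_hyperstate = tracial_L2 M \<tau> hat
  for M :: "'k::chilbert_space bop set" and \<tau> and hat :: "'k bop \<Rightarrow> 'h::chilbert_space" +
  fixes \<phi> :: "'h bop \<Rightarrow> complex" and P :: "'h bop \<Rightarrow> 'h bop"
  assumes hyperstate: "hyperstate M \<tau> hat \<phi>" and phi_normal: "wot_normal_on UNIV \<phi>"
    and P_def: "P = hyperstate_map M hat \<phi>"
begin

lemma P_add: "P (S + T) = P S + P T"
  and P_scaleC: "P (c *\<^sub>C T) = c *\<^sub>C P T"
  and P_one: "P 1 = 1"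
  using hyperstate_map_ucp[OF hyperstate] by (simp_all add: P_def ucp_def)

lemma P_positive:
  assumes "positive_op T"
  shows "positive_op (P T)"
proof -
  have "positive_matrix 1 (\<lambda>i j. T)"
    using assms by (simp add: positive_matrix_def positive_op_def)
  then have "positive_matrix 1 (\<lambda>i j. P T)"
    using hyperstate_map_ucp[OF hyperstate] by (auto simp: P_def ucp_def)
  from this[unfolded positive_matrix_def, rule_format, of "\<lambda>_. x" for x]
  show ?thesis by (simp add: positive_op_def)
qed

lemma P_bimodular: "x \<in> M \<Longrightarrow> y \<in> M \<Longrightarrow> P (L x * T * L y) = L x * P T * L y"
  using hyperstate_map_bimodular[OF hyperstate] by (simp add: P_def bimodular_def)

lemma power_add: "(P ^^ n) (S + T) = (P ^^ n) S + (P ^^ n) T"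
  and power_scaleC: "(P ^^ n) (c *\<^sub>C T) = c *\<^sub>C (P ^^ n) T"
  and power_one: "(P ^^ n) 1 = 1"
  and power_positive: "positive_op T \<Longrightarrow> positive_op ((P ^^ n) T)"
  and power_bimodular: "x \<in> M \<Longrightarrow> y \<in> M \<Longrightarrow> (P ^^ n) (L x * T * L y) = L x * (P ^^ n) T * L y"
  by (induction n) (simp_all add: P_add P_scaleC P_one P_positive P_bimodular)

lemma power_L_left: "x \<in> M \<Longrightarrow> (P ^^ n) (L x * T) = L x * (P ^^ n) T"
  and power_L_right: "x \<in> M \<Longrightarrow> (P ^^ n) (T * L x) = (P ^^ n) T * L x"
  using power_bimodular[of x 1 n T] power_bimodular[of 1 x n T] by (simp_all add: L_one one_in)

lemma power_diff: "(P ^^ n) (S - T) = (P ^^ n) S - (P ^^ n) T"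
  using power_add[of n S "(-1) *\<^sub>C T"] power_scaleC[of n "-1" T] by (simp add: scaleC_minus_one)

lemma power_bounded: "bounded_by c T \<Longrightarrow> c \<ge> 0 \<Longrightarrow> bounded_by c ((P ^^ n) T)"
  by (induction n) (simp_all add: P_def hyperstate_map_bounded[OF hyperstate])

lemma power_wot_continuous:
  assumes X: "\<And>i. bounded_by c (X i)" "bounded_by c T" "c \<ge> 0" and lim: "wot_tendsto X T F"
  shows "wot_tendsto (\<lambda>i. (P ^^ n) (X i)) ((P ^^ n) T) F"
proof (induction n)
  case 0
  show ?case using lim by simp
next
  case (Suc n)
  have "wot_tendsto (\<lambda>i. hyperstate_map M hat \<phi> ((P ^^ n) (X i))) (hyperstate_map M hat \<phi> ((P ^^ n) T)) F"
    by (rule hyperstate_map_wot_continuous[OF hyperstate phi_normal power_bounded[OF X(1,3)] power_bounded[OF X(2,3)] X(3) Suc])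
  then show ?case by (simp add: P_def)
qed

lemma L_in_Har: "x \<in> M \<Longrightarrow> L x \<in> Har P"
  using P_bimodular[of x 1 1] by (simp add: Har_def L_one one_in P_one)

lemma power_state: "state_on UNIV (\<lambda>T. cinner ((P ^^ n) T *\<^sub>V hat 1) (hat 1))"
  using power_positive[of _ n]
  by (simp add: state_on_def power_add power_scaleC power_one cinner_add_left cinner_scaleC_left
      positive_op_def cinner_self norm_hat_one)

text \<open>
  The filter in the definition of normality is bounded only eventually, so the operators outside the
  ball are replaced by the limit.
\<close>

lemma power_state_normal: "wot_normal_on UNIV (\<lambda>T. cinner ((P ^^ n) T *\<^sub>V hat 1) (hat 1))"
  unfolding wot_normal_on_def
proof (intro allI impI)
  fix F c and T :: "'h bop"
  assume c: "c \<ge> 0" "bounded_by c T" and ev: "\<forall>\<^sub>F X in F. bounded_by c X \<and> X \<in> UNIV"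
    and lim: "wot_tendsto (\<lambda>X. X) T F"
  define Y where "Y X = (if bounded_by c X then X else T)" for X
  have eq: "\<forall>\<^sub>F X in F. Y X = X" using ev by (rule eventually_mono) (simp add: Y_def)
  have Yb: "bounded_by c (Y X)" for X by (simp add: Y_def c)
  have "wot_tendsto Y T F"
    unfolding wot_tendsto_def
  proof (intro allI)
    fix v w
    have "\<forall>\<^sub>F X in F. cinner (X *\<^sub>V v) w = cinner (Y X *\<^sub>V v) w"
      using eq by (rule eventually_mono) simp
    then show "((\<lambda>X. cinner (Y X *\<^sub>V v) w) \<longlongrightarrow> cinner (T *\<^sub>V v) w) F"
      using Lim_transform_eventually[of "\<lambda>X. cinner (X *\<^sub>V v) w" "cinner (T *\<^sub>V v) w" F] lim
      by (simp add: wot_tendsto_def)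
  qed
  then have "wot_tendsto (\<lambda>X. (P ^^ n) (Y X)) ((P ^^ n) T) F"
    by (rule power_wot_continuous[OF Yb c(2,1)])
  then have "((\<lambda>X. cinner ((P ^^ n) (Y X) *\<^sub>V hat 1) (hat 1)) \<longlongrightarrow> cinner ((P ^^ n) T *\<^sub>V hat 1) (hat 1)) F"
    unfolding wot_tendsto_def by blast
  moreover have "\<forall>\<^sub>F X in F. cinner ((P ^^ n) (Y X) *\<^sub>V hat 1) (hat 1) = cinner ((P ^^ n) X *\<^sub>V hat 1) (hat 1)"
    using eq by (rule eventually_mono) simp
  ultimately show "((\<lambda>X. cinner ((P ^^ n) X *\<^sub>V hat 1) (hat 1)) \<longlongrightarrow> cinner ((P ^^ n) T *\<^sub>V hat 1) (hat 1)) F"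
    by (rule Lim_transform_eventually)
qed

abbreviation density :: "nat \<Rightarrow> 'h bop" where "density n \<equiv> density_matrix hat (P ^^ n)"

lemma density_props:
  shows density_positive: "positive_op (density n)"
    and density_trace_class: "trace_class (density n)"
    and density_trace: "trace (density n * T) = cinner ((P ^^ n) T *\<^sub>V hat 1) (hat 1)"
proof -
  obtain A where A: "positive_op A" "trace_class A"
    "\<And>T. cinner ((P ^^ n) T *\<^sub>V hat 1) (hat 1) = trace (A * T)"
    by (rule normal_state_density[OF power_state power_state_normal, of n]) (rule that)
  have "\<exists>!A. positive_op A \<and> trace_class A \<and> (\<forall>T. cinner ((P ^^ n) T *\<^sub>V hat 1) (hat 1) = trace (A * T))"
  proof (rule ex1I[of _ A])
    fix B assume "positive_op B \<and> trace_class B \<and> (\<forall>T. cinner ((P ^^ n) T *\<^sub>V hat 1) (hat 1) = trace (B * T))"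
    then show "B = A" using A(3) by (intro density_unique) simp
  qed (use A in simp)
  from theI'[OF this]
  have *: "positive_op (density n) \<and> trace_class (density n) \<and>
      (\<forall>T. cinner ((P ^^ n) T *\<^sub>V hat 1) (hat 1) = trace (density n * T))"
    unfolding density_matrix_def .
  then show "positive_op (density n)" "trace_class (density n)"
    "trace (density n * T) = cinner ((P ^^ n) T *\<^sub>V hat 1) (hat 1)"
    by simp_all
qed

text \<open>
  Bimodularity moves \<open>L x\<close> out of \<open>P\<^sup>n\<close>; this is the bridge between the commutators of the density
  operators and those of the operators \<open>P\<^sup>n(T)\<close>.
\<close>

lemma density_commutator:
  assumes "x \<in> M"
  shows "trace (density n * (T * L x - L x * T)) =
    cinner (((P ^^ n) T * L x - L x * (P ^^ n) T) *\<^sub>V hat 1) (hat 1)"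
  using assms by (simp only: density_trace power_diff power_L_left power_L_right)

section \<open>Asymptotic centrality and triviality of the harmonic operators\<close>

lemma weak_if_trace_norm:
  assumes x: "x \<in> M" and lim: "(\<lambda>n. trace_norm (L x * density n - density n * L x)) \<longlonglongrightarrow> 0"
  shows "tc_weakly_tendsto (\<lambda>n. L x * density n - density n * L x) 0"
  unfolding tc_weakly_tendsto_def
proof
  fix T :: "'h bop"
  obtain c where c: "c \<ge> 0" "bounded_by c T" by (rule ex_bounded_by)
  have tc: "trace_class (L x * density n - density n * L x)" for n
    by (rule trace_norm_commutator[OF density_positive density_trace_class])
  have "(\<lambda>n. trace ((L x * density n - density n * L x) * T)) \<longlonglongrightarrow> 0"
  proof (rule Lim_null_comparison)
    show "\<forall>\<^sub>F n in sequentially. norm (trace ((L x * density n - density n * L x) * T))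
        \<le> c * trace_norm (L x * density n - density n * L x)"
      by (intro always_eventually allI trace_times_bound tc c)
    show "(\<lambda>n. c * trace_norm (L x * density n - density n * L x)) \<longlonglongrightarrow> 0"
      using tendsto_mult_left[OF lim, of c] by simp
  qed
  moreover have "trace (0 * T) = 0" by (simp add: trace_def cinner.zero_left)
  ultimately show "(\<lambda>n. trace ((L x * density n - density n * L x) * T)) \<longlonglongrightarrow> trace (0 * T)"
    by simp
qed

text \<open>
  For harmonic \<open>T\<close> the pairing of the commutator with the again harmonic operator \<open>z T\<close> does not
  depend on \<open>n\<close>.  Its limit being zero says that \<open>\<langle>z T x 1, 1\<rangle> = \<langle>x z T 1, 1\<rangle>\<close> for all \<open>x\<close> and \<open>z\<close> in
  \<open>M\<close>, which is the right modularity required by the commutation theorem.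
\<close>

lemma Har_if_weak:
  assumes weak: "\<And>x. x \<in> M \<Longrightarrow> tc_weakly_tendsto (\<lambda>n. L x * density n - density n * L x) 0"
  shows "Har P = L ` M"
proof
  show "L ` M \<subseteq> Har P" using L_in_Har by blast
  show "Har P \<subseteq> L ` M"
  proof
    fix T assume "T \<in> Har P"
    then have PT: "(P ^^ n) T = T" for n by (induction n) (simp_all add: Har_def)
    have central: "cinner ((L z * T * L x) *\<^sub>V hat 1) (hat 1) = cinner ((L x * L z * T) *\<^sub>V hat 1) (hat 1)"
      if xz: "x \<in> M" "z \<in> M" for x z
    proof -
      let ?T = "L z * T"
      let ?a = "cinner ((?T * L x - L x * ?T) *\<^sub>V hat 1) (hat 1)"
      have "(\<lambda>n. trace ((L x * density n - density n * L x) * ?T)) \<longlonglongrightarrow> trace (0 * ?T)"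
        using weak[OF xz(1)] unfolding tc_weakly_tendsto_def by blast
      moreover have "trace (0 * ?T) = 0" by (simp add: trace_def cinner.zero_left)
      moreover have "trace ((L x * density n - density n * L x) * ?T) = ?a" for n
        using xz by (simp only: trace_commutator[OF density_positive density_trace_class]
            density_commutator power_L_left PT)
      ultimately have "?a = 0" using LIMSEQ_unique[OF tendsto_const[of ?a]] by simp
      then show ?thesis by (simp add: cinner.diff_left)
    qed
    have "cinner (T *\<^sub>V hat y) (hat z) = cinner (T *\<^sub>V hat 1) (hat (z * adj y))"
      if yz: "y \<in> M" "z \<in> M" for y z
    proof -
      have "cinner (T *\<^sub>V hat y) (hat z) = cinner ((L (adj z) * T * L y) *\<^sub>V hat 1) (hat 1)"
        using yz by (simp add: L_hat one_in adj_in cinner_adj[of "L (adj z)"] L_adj)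
      also have "\<dots> = cinner ((L y * L (adj z) * T) *\<^sub>V hat 1) (hat 1)"
        using yz by (intro central adj_in)
      also have "\<dots> = cinner (T *\<^sub>V hat 1) (hat (z * adj y))"
        using yz by (simp add: L_hat one_in adj_in times_in cinner_adj[of "L (adj z)"] cinner_adj[of "L y"] L_adj)
      finally show ?thesis .
    qed
    then obtain h where "h \<in> M" "T = L h"
      by (rule left_multiplication_if_right_modular) (assumption | rule that)+
    then show "T \<in> L ` M" by blast
  qed
qed

text \<open>
  The trace norm of the commutator is attained at a contraction \<open>V n\<close>, and equals
  \<open>\<langle>(Z n x - x Z n) 1, 1\<rangle>\<close> for \<open>Z n = P\<^sup>n(V n)\<close>.  By the uniform asymptotic regularity of the powers,
  \<open>P(Z n) - Z n\<close> tends to zero in norm even though \<open>V n\<close> varies, so by normality of \<open>P\<close> every weak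
  operator cluster point of \<open>Z n\<close> is harmonic, hence in \<open>M\<close>, where the trace property kills the
  limit.  Compactness of the unit ball concludes.
\<close>

lemma trace_norm_if_Har:
  assumes har: "Har P = L ` M" and x: "x \<in> M"
    and asymp: "\<And>T n. bounded_by 1 T \<Longrightarrow> bounded_by (1 / sqrt (Suc n)) ((P ^^ Suc n) T - (P ^^ n) T)"
  shows "(\<lambda>n. trace_norm (L x * density n - density n * L x)) \<longlonglongrightarrow> 0"
proof -
  let ?X = "L x"
  let ?C = "\<lambda>n. ?X * density n - density n * ?X"
  have "\<exists>V. bounded_by 1 V \<and> complex_of_real (trace_norm (?C n)) = trace (density n * (V * ?X - ?X * V))" for n
  proof -
    obtain V where "bounded_by 1 V" "complex_of_real (trace_norm (?C n)) = trace (density n * (V * ?X - ?X * V))"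
      by (rule trace_norm_commutator[OF density_positive[of n] density_trace_class[of n], of ?X]) (rule that)
    then show ?thesis by blast
  qed
  then obtain V where V: "\<And>n. bounded_by 1 (V n)"
    "\<And>n. complex_of_real (trace_norm (?C n)) = trace (density n * (V n * ?X - ?X * V n))"
    by metis
  define Z where "Z n = (P ^^ n) (V n)" for n
  define g where "g n = cinner ((Z n * ?X - ?X * Z n) *\<^sub>V hat 1) (hat 1)" for n
  have gC: "complex_of_real (trace_norm (?C n)) = g n" for n
    unfolding V(2) g_def Z_def by (rule density_commutator[OF x])
  have Z1: "bounded_by 1 (Z n)" for n unfolding Z_def by (rule power_bounded[OF V(1)]) simp
  have step: "bounded_by (1 / sqrt (Suc n)) (P (Z n) - Z n)" for n
    using asymp[OF V(1), of n n] by (simp add: Z_def)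
  have "g \<longlonglongrightarrow> 0"
  proof (rule tendstoI, rule ccontr)
    fix e :: real assume e: "e > 0" and "\<not> (\<forall>\<^sub>F n in sequentially. dist (g n) 0 < e)"
    then have freq: "\<exists>\<^sub>F n in sequentially. e \<le> cmod (g n)"
      by (simp add: not_eventually not_less)
    \<comment> \<open>Restricting to the bad indices before passing to a cluster point makes the limit contradict them.\<close>
    define F where "F = inf sequentially (principal {n. e \<le> cmod (g n)})"
    have F: "F \<noteq> bot"
      using freq by (auto simp: F_def frequently_def eventually_inf_principal trivial_limit_def)
    obtain G T where G: "G \<le> F" "G \<noteq> bot" "wot_tendsto Z T G" "bounded_by 1 T"
      by (rule bounded_ball_wot_compact[OF F Z1]) (simp, rule that)
    have Gs: "G \<le> sequentially" using G(1) by (simp add: F_def)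
    have PZ: "wot_tendsto (\<lambda>n. P (Z n)) (P T) G"
      using power_wot_continuous[OF Z1 G(4) _ G(3), of 1] by simp
    have "P T = T"
    proof (rule bop_eqI, rule cinner_ext)
      fix v w
      have "(\<lambda>n. cinner ((P (Z n) - Z n) *\<^sub>V v) w) \<longlonglongrightarrow> 0"
      proof (rule Lim_null_comparison)
        have "cmod (cinner ((P (Z n) - Z n) *\<^sub>V v) w) \<le> (1 / sqrt (Suc n) * norm v) * norm w" for n
          by (intro order_trans[OF norm_cinner_le] mult_right_mono bounded_byD[OF step] norm_ge_zero)
        then show "\<forall>\<^sub>F n in sequentially. norm (cinner ((P (Z n) - Z n) *\<^sub>V v) w)
            \<le> (1 / sqrt (Suc n)) * (norm v * norm w)"
          by (simp add: mult.assoc)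
        have "(\<lambda>n. inverse (sqrt (Suc n))) \<longlonglongrightarrow> 0"
          by (intro tendsto_inverse_0_at_top filterlim_compose[OF sqrt_at_top]
              filterlim_compose[OF filterlim_real_sequentially filterlim_Suc])
        then show "(\<lambda>n. 1 / sqrt (Suc n) * (norm v * norm w)) \<longlonglongrightarrow> 0"
          using tendsto_mult_left_zero by (simp only: inverse_eq_divide)
      qed
      then have "((\<lambda>n. cinner ((P (Z n) - Z n) *\<^sub>V v) w) \<longlongrightarrow> 0) G" by (rule tendsto_mono[OF Gs])
      moreover have "((\<lambda>n. cinner ((P (Z n) - Z n) *\<^sub>V v) w) \<longlongrightarrow> cinner (P T *\<^sub>V v) w - cinner (T *\<^sub>V v) w) G"
        using PZ G(3) unfolding wot_tendsto_def bop_apply_simps cinner.diff_left by (intro tendsto_diff) auto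
      ultimately have "cinner (P T *\<^sub>V v) w - cinner (T *\<^sub>V v) w = 0"
        by (rule tendsto_unique[OF G(2), rotated])
      then show "cinner (P T *\<^sub>V v) w = cinner (T *\<^sub>V v) w" by simp
    qed
    then have "T \<in> L ` M" using har by (auto simp: Har_def)
    then obtain z where z: "z \<in> M" "T = L z" by blast
    have "(g \<longlongrightarrow> cinner ((T * ?X) *\<^sub>V hat 1) (hat 1) - cinner ((?X * T) *\<^sub>V hat 1) (hat 1)) G"
      unfolding g_def bop_apply_simps(4) cinner.diff_left
      using wot_tendsto_times[OF G(3), of ?X] unfolding wot_tendsto_def by (intro tendsto_diff) auto
    moreover have "cinner ((T * ?X) *\<^sub>V hat 1) (hat 1) = cinner ((?X * T) *\<^sub>V hat 1) (hat 1)"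
      using z x by (simp add: L_hat one_in times_in cinner_hat trace_commute)
    ultimately have "(g \<longlongrightarrow> 0) G" by simp
    then have "\<forall>\<^sub>F n in G. cmod (g n) < e" using e by (auto dest: tendstoD simp: dist_norm)
    moreover have "\<forall>\<^sub>F n in G. e \<le> cmod (g n)"
      using G(1) by (rule filter_leD) (simp add: F_def eventually_inf_principal)
    ultimately have "\<forall>\<^sub>F n in G. False" by eventually_elim simp
    then show False using G(2) by simp
  qed
  then have "(\<lambda>n. Re (g n)) \<longlonglongrightarrow> Re 0" by (rule tendsto_Re)
  then show ?thesis by (simp flip: gC)
qed

end

context tracial_L2
begin

lemma hyperstate_average:
  assumes psi: "hyperstate M \<tau> hat \<psi>"
  shows "hyperstate M \<tau> hat (\<lambda>T. 1/2 * \<psi> T + 1/2 * cinner (T *\<^sub>V hat 1) (hat 1))"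
proof -
  have st: "state_on UNIV \<psi>" using psi by (rule hyperstate_state)
  have add: "\<psi> (S + R) = \<psi> S + \<psi> R" and sc: "\<psi> (a *\<^sub>C S) = a * \<psi> S"
    and pos: "positive_op S \<Longrightarrow> \<psi> S \<in> \<real>\<^sub>\<ge>\<^sub>0" and one: "\<psi> 1 = 1" for S R a
    using st unfolding state_on_def by auto
  have "state_on UNIV (\<lambda>T. 1/2 * \<psi> T + 1/2 * cinner (T *\<^sub>V hat 1) (hat 1))"
    unfolding state_on_def
  proof (intro conjI ballI allI impI)
    fix T :: "'h bop" assume T: "positive_op T"
    show "1/2 * \<psi> T + 1/2 * cinner (T *\<^sub>V hat 1) (hat 1) \<in> \<real>\<^sub>\<ge>\<^sub>0"
      using pos[OF T] T unfolding positive_op_def by (simp add: complex_nonneg_Reals_iff)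
  qed (simp_all add: add sc one cinner_add_left cinner_scaleC_left cinner_self norm_hat_one algebra_simps)
  moreover have "1/2 * \<psi> (L x) + 1/2 * cinner (L x *\<^sub>V hat 1) (hat 1) = \<tau> x" if "x \<in> M" for x
    using that by (simp add: hyperstate_L[OF psi] L_hat one_in cinner_hat)
  ultimately show ?thesis by (simp add: hyperstate_def)
qed

lemma wot_normal_average:
  assumes "wot_normal_on UNIV \<psi>"
  shows "wot_normal_on UNIV (\<lambda>T. 1/2 * \<psi> T + 1/2 * cinner (T *\<^sub>V hat 1) (hat 1))"
  unfolding wot_normal_on_def
proof (intro allI impI tendsto_add tendsto_mult tendsto_const)
  fix F c and T :: "'h bop"
  assume c: "c \<ge> 0" "bounded_by c T" and ev: "\<forall>\<^sub>F X in F. bounded_by c X \<and> X \<in> UNIV"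
    and lim: "wot_tendsto (\<lambda>X. X) T F"
  show "(\<psi> \<longlongrightarrow> \<psi> T) F"
    by (rule wot_normal_onD[OF assms c UNIV_I ev lim])
  show "((\<lambda>X. cinner (X *\<^sub>V hat 1) (hat 1)) \<longlongrightarrow> cinner (T *\<^sub>V hat 1) (hat 1)) F"
    using lim by (simp add: wot_tendsto_def)
qed

lemma hyperstate_map_average:
  assumes psi: "hyperstate M \<tau> hat \<psi>"
  shows "hyperstate_map M hat (\<lambda>T. 1/2 * \<psi> T + 1/2 * cinner (T *\<^sub>V hat 1) (hat 1)) T
    = (1/2) *\<^sub>R (hyperstate_map M hat \<psi> T + T)"
proof (rule bop_eqI_hat)
  fix y z assume yz: "y \<in> M" "z \<in> M"
  have "cinner (T *\<^sub>V hat y) (hat z) = cinner ((adj (L z) * T * L y) *\<^sub>V hat 1) (hat 1)"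
    using yz by (simp add: L_hat one_in flip: cinner_adj')
  then show "cinner (hyperstate_map M hat (\<lambda>T. 1/2 * \<psi> T + 1/2 * cinner (T *\<^sub>V hat 1) (hat 1)) T *\<^sub>V hat y) (hat z)
      = cinner (((1/2) *\<^sub>R (hyperstate_map M hat \<psi> T + T)) *\<^sub>V hat y) (hat z)"
    using yz unfolding hyperstate_map_coeff[OF hyperstate_average[OF psi] yz]
    by (simp only: bop_apply_scaleR cinner_scaleR_left bop_apply_simps(3) cinner_add_left
        hyperstate_map_coeff[OF psi yz]) (simp add: distrib_left)
qed

end

theorem theorem2p10:
  fixes M :: "'k::chilbert_space bop set"
    and \<tau> :: "'k bop \<Rightarrow> complex"
    and hat :: "'k bop \<Rightarrow> 'h::chilbert_space"
    and \<psi> \<phi> :: "'h bop \<Rightarrow> complex"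
    and P :: "'h bop \<Rightarrow> 'h bop"
    and A :: "nat \<Rightarrow> 'h bop"
  assumes "tracial_von_neumann_algebra M \<tau>"
    and "is_L2 M \<tau> hat"
    and "hyperstate M \<tau> hat \<psi>"
    and "normal_on UNIV \<psi>"
    and "\<phi> = (\<lambda>T. 1/2 * \<psi> T + 1/2 * cinner (T *\<^sub>V hat 1) (hat 1))"
    and "P = hyperstate_map M hat \<phi>"
    and "A = (\<lambda>n. density_matrix hat (P ^^ n))"
  shows "((\<forall>x\<in>M. (\<lambda>n. trace_norm (lmult M hat x * A n - A n * lmult M hat x)) \<longlonglongrightarrow> 0) \<longleftrightarrow>
           (\<forall>x\<in>M. tc_weakly_tendsto (\<lambda>n. lmult M hat x * A n - A n * lmult M hat x) 0)) \<and>
         ((\<forall>x\<in>M. tc_weakly_tendsto (\<lambda>n. lmult M hat x * A n - A n * lmult M hat x) 0) \<longleftrightarrow>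
           Har P = lmult M hat ` M)"
proof -
  interpret tracial_L2 M \<tau> hat using assms(1,2) by unfold_locales
  interpret normal_hyperstate M \<tau> hat \<phi> P
  proof unfold_locales
    show "hyperstate M \<tau> hat \<phi>" unfolding assms(5) by (rule hyperstate_average[OF assms(3)])
    show "wot_normal_on UNIV \<phi>"
      unfolding assms(5) by (rule wot_normal_average[OF normal_on_imp_wot_normal_on[OF assms(4)]])
  qed (rule assms(6))
  let ?Q = "hyperstate_map M hat \<psi>"
  have PQ: "P T = (1/2) *\<^sub>R (?Q T + T)" for T
    unfolding assms(5,6) by (rule hyperstate_map_average[OF assms(3)])
  have "linear ?Q"
    using hyperstate_map_ucp[OF assms(3)] by (intro linearI) (simp_all add: ucp_def flip: scaleC_of_real)
  then have asymp: "bounded_by (1 / sqrt (Suc n)) ((P ^^ Suc n) T - (P ^^ n) T)" if "bounded_by 1 T" for T n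
    by (rule average_power_step[OF _ hyperstate_map_bounded[OF assms(3)] _ PQ that]) auto
  show ?thesis
    unfolding assms(7)
    using weak_if_trace_norm Har_if_weak trace_norm_if_Har[OF _ _ asymp] by blast
qed

end
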